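(* Let $0<\nu<2$, and for integers $n\ge 1$ define $$\mathfrak e_{n,\nu}=\frac{n(n+1)(2-\nu)}{2n+\nu},\qquad \mathfrak h_{n,\nu}=\min\left\{1,\sqrt{\tfrac14+\mathfrak e_{n,\nu}}\right\}.$$ Let $F\not\equiv 0$ be real and even, and assume that $F$ is either a polynomial or an entire function of order at most one. (i) Fix $n\ge 1$. If $\mathcal Z(F)\subseteq S_{\mathfrak h_{n,\nu}}$, then $$\mathscr M_{F,\nu}\bigl(y^n(y+t)\bigr)\in\mathcal E_{n+1}\qquad\text{for all } t\in\mathbb R,$$ and hence $\mathscr M_{F,\nu}(y^n)\preceq\mathscr M_{F,\nu}(y^{n+1})$. If $\mathfrak e_{n,\nu}\le 3/4$, the strip width $\mathfrak h_{n,\nu}$ is sharp for this fixed value of $n$ (including the boundary case $\mathfrak e_{n,\nu}=3/4$, where $\mathfrak h_{n,\nu}=1$): for every $H>\mathfrak h_{n,\nu}$ there is a nonzero real even polynomial $F$ with $\mathcal Z(F)\subseteq S_H$ for which the relation $\mathscr M_{F,\nu}(y^n)\preceq\mathscr M_{F,\nu}(y^{n+1})$ (and hence the pencil inclusion) fails. (ii) If $\mathcal Z(F)\subseteq S_{\mathfrak h_{1,\nu}}$, then $$\mathscr M_{F,\nu}(y^n)\preceq\mathscr M_{F,\nu}(y^{n+1})\qquad\text{for all } n\ge 0.$$ When $\nu\ge 10/11$, the width $\mathfrak h_{1,\nu}$ is sharp uniformly in $n$: for every $H>\mathfrak h_{1,\nu}$ there is a nonzero real even polynomial $F$ with $\mathcal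 Z(F)\subseteq S_H$ for which $\mathscr M_{F,\nu}(y^n)\preceq\mathscr M_{F,\nu}(y^{n+1})$ fails for some $n\ge0$.
   Context: A polynomial or entire function $H$ is called real if $H(\overline u)=\overline{H(u)}$. $\mathcal Z(H)$ is the zero set of $H$, and $S_h=\{u\in\mathbb C: |\operatorname{Re} u|\le h\}$. Jacobi multiplier: for $0<\nu<2$ let $$\mathscr J_\nu=y(y-4)\frac{d^2}{dy^2}+(2y-4\nu)\frac{d}{dy},$$ and for $r\ge 0$ let $\mathsf P_r^{(\nu)}\in\mathbb R[y]$ be its unique monic eigenpolynomial of degree $r$, with $\mathscr J_\nu\mathsf P_r^{(\nu)}=r(r+1)\mathsf P_r^{(\nu)}$. The linear operator $\mathscr M_{F,\nu}:\mathbb R[y]\to\mathbb R[y]$ is defined by $\mathscr M_{F,\nu}\mathsf P_r^{(\nu)}=F(r+1/2)\,\mathsf P_r^{(\nu)}$ for all $r\ge 0$. One-defect class: $\mathcal E_N$ consists of the zero polynomial and all nonzero $P\in\mathbb R[y]$ of degree at most $N$ having at most one complex zero outside the real interval $[0,4]$, zeros counted with multiplicity. Weak Obreschkoff relation: for real polynomials $A,B$, write $A\preceq B$ if every nonzero polynomial of the form $B+tA$, $t\in\mathbb R$, has only real zeros (nonzero constants count as real-rooted). Conventions: $0\preceq 0$, and $0\preceq B$ and $B\preceq 0$ for every nonzero real-rooted polynomial $B$. *)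

theory Defs
  imports "HOL-Complex_Analysis.Complex_Analysis" "HOL-Library.Landau_Symbols"
begin

subsection \<open>Functions on the complex plane\<close>

definition real_fun :: "(complex \<Rightarrow> complex) \<Rightarrow> bool" where
  "real_fun H \<longleftrightarrow> (\<forall>u. H (cnj u) = cnj (H u))"

definition even_fun :: "(complex \<Rightarrow> complex) \<Rightarrow> bool" where
  "even_fun H \<longleftrightarrow> (\<forall>u. H (- u) = H u)"

definition is_polynomial :: "(complex \<Rightarrow> complex) \<Rightarrow> bool" where
  "is_polynomial H \<longleftrightarrow> (\<exists>p. H = poly p)"

definition zero_set :: "(complex \<Rightarrow> complex) \<Rightarrow> complex set" where
  "zero_set H = {u. H u = 0}"

definition strip :: "real \<Rightarrow> complex set" where
  "strip h = {u. \<bar>Re u\<bar> \<le> h}"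

text \<open>The order of growth, as the infimum of the exponents \<open>\<rho> \<ge> 0\<close> with
  \<open>F(z) = O(exp(|z|^\<rho>))\<close>; it is \<open>\<infinity>\<close> if there are none.\<close>

definition growth_order :: "(complex \<Rightarrow> complex) \<Rightarrow> ereal" where
  "growth_order F =
     Inf {ereal \<rho> | \<rho>. 0 \<le> \<rho> \<and>
            (\<lambda>z. norm (F z)) \<in> O[at_infinity](\<lambda>z. exp (norm z powr \<rho>))}"

definition entire_order_le_one :: "(complex \<Rightarrow> complex) \<Rightarrow> bool" where
  "entire_order_le_one F \<longleftrightarrow> F holomorphic_on UNIV \<and> growth_order F \<le> 1"


subsection \<open>The Jacobi multiplier\<close>

definition jacobi_op :: "real \<Rightarrow> real poly \<Rightarrow> real poly" where
  "jacobi_op \<nu> p =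
     [:0, 1:] * [:- 4, 1:] * pderiv (pderiv p) + [:- 4 * \<nu>, 2:] * pderiv p"

definition is_jacobi_poly :: "real \<Rightarrow> nat \<Rightarrow> real poly \<Rightarrow> bool" where
  "is_jacobi_poly \<nu> r p \<longleftrightarrow>
     lead_coeff p = 1 \<and> degree p = r \<and> jacobi_op \<nu> p = smult (real r * (real r + 1)) p"

definition jacobi_poly :: "real \<Rightarrow> nat \<Rightarrow> real poly" where
  "jacobi_poly \<nu> r = (THE p. is_jacobi_poly \<nu> r p)"

text \<open>The multiplier is only used for real functions \<open>F\<close>, whose values at the real points
  \<open>r + 1/2\<close> are real, so that \<open>Re\<close> is merely the coercion from \<open>complex\<close> to \<open>real\<close>.\<close>

definition is_multiplier ::
    "(complex \<Rightarrow> complex) \<Rightarrow> real \<Rightarrow> (real poly \<Rightarrow> real poly) \<Rightarrow> bool" where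
  "is_multiplier F \<nu> M \<longleftrightarrow>
     Vector_Spaces.linear smult smult M \<and>
     (\<forall>r. M (jacobi_poly \<nu> r) = smult (Re (F (of_nat r + 1 / 2))) (jacobi_poly \<nu> r))"

definition multiplier ::
    "(complex \<Rightarrow> complex) \<Rightarrow> real \<Rightarrow> real poly \<Rightarrow> real poly" where
  "multiplier F \<nu> = (THE M. is_multiplier F \<nu> M)"


subsection \<open>Both definite descriptions are proper\<close>

lemma coeff_jacobi_op:
  "coeff (jacobi_op \<nu> p) k =
     real k * (real k + 1) * coeff p k - 4 * (real k + 1) * (real k + \<nu>) * coeff p (Suc k)"
proof -
  have *: "[:0, 1:] * [:- 4, 1:] = ([:0, - 4, 1:] :: real poly)" by simp
  show ?thesis
    unfolding jacobi_op_def *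
    by (cases k; cases "k - 1")
       (auto simp: coeff_pCons coeff_pderiv algebra_simps split: nat.splits)
qed

lemma jacobi_eigen_iff:
  "jacobi_op \<nu> p = smult (real r * (real r + 1)) p \<longleftrightarrow>
     (\<forall>k. (real r * (real r + 1) - real k * (real k + 1)) * coeff p k =
          - 4 * (real k + 1) * (real k + \<nu>) * coeff p (Suc k))"
  unfolding poly_eq_iff coeff_jacobi_op coeff_smult by (auto simp: algebra_simps)

lemma eigenvalue_gap:
  assumes "k < r"
  shows "real r * (real r + 1) - real k * (real k + 1) \<noteq> 0"
proof -
  have "real k * (real k + 1) < real r * (real r + 1)"
    using assms by (intro mult_strict_mono) auto
  thus ?thesis by simp
qed

lemma ex1_jacobi_poly: "\<exists>!p. is_jacobi_poly \<nu> r p"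
proof (rule ex_ex1I)
  define b where "b = rec_nat (1::real) (\<lambda>j c.
     - 4 * (real (r - Suc j) + 1) * (real (r - Suc j) + \<nu>) * c /
     (real r * (real r + 1) - real (r - Suc j) * (real (r - Suc j) + 1)))"
  have b0: "b 0 = 1" by (simp add: b_def)
  have bS: "b (Suc j) = - 4 * (real (r - Suc j) + 1) * (real (r - Suc j) + \<nu>) * b j /
     (real r * (real r + 1) - real (r - Suc j) * (real (r - Suc j) + 1))" for j
    by (simp add: b_def)
  define p where "p = (\<Sum>k\<le>r. monom (b (r - k)) k)"
  have cp: "coeff p k = (if k \<le> r then b (r - k) else 0)" for k
    by (simp add: p_def coeff_sum if_distrib[of "\<lambda>x. coeff x _"] sum.delta)
  have deg: "degree p = r"
    by (intro antisym degree_le le_degree) (auto simp: cp b0)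
  have "(real r * (real r + 1) - real k * (real k + 1)) * coeff p k =
          - 4 * (real k + 1) * (real k + \<nu>) * coeff p (Suc k)" for k
  proof (cases "k < r")
    case True
    then obtain j where j: "r - k = Suc j" by (metis Suc_diff_Suc)
    hence k: "r - Suc j = k" and j': "r - Suc k = j" using True by auto
    show ?thesis using True eigenvalue_gap[OF True] by (simp add: cp j j' bS k)
  qed (auto simp: cp)
  hence "is_jacobi_poly \<nu> r p"
    unfolding is_jacobi_poly_def jacobi_eigen_iff by (auto simp: deg cp b0)
  thus "\<exists>p. is_jacobi_poly \<nu> r p" ..
next
  fix p q assume pq: "is_jacobi_poly \<nu> r p" "is_jacobi_poly \<nu> r q"
  have "coeff p k = coeff q k" for k
  proof (cases "k \<le> r")
    case True
    thus ?thesis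
    proof (induction rule: inc_induct)
      case base
      show ?case using pq by (auto simp: is_jacobi_poly_def)
    next
      case (step k)
      have "(real r * (real r + 1) - real k * (real k + 1)) * coeff p k =
            (real r * (real r + 1) - real k * (real k + 1)) * coeff q k"
        using pq step.IH unfolding is_jacobi_poly_def jacobi_eigen_iff by metis
      thus ?case using eigenvalue_gap[OF step.hyps(2)] by simp
    qed
  next
    case False
    thus ?thesis using pq by (auto simp: is_jacobi_poly_def coeff_eq_0)
  qed
  thus "p = q" by (simp add: poly_eq_iff)
qed

lemma is_jacobi_poly_jacobi_poly: "is_jacobi_poly \<nu> r (jacobi_poly \<nu> r)"
  unfolding jacobi_poly_def by (rule theI'[OF ex1_jacobi_poly])

lemma linear_smult_iff:
  "Vector_Spaces.linear smult smult (M :: real poly \<Rightarrow> real poly) \<longleftrightarrow>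
     (\<forall>p q. M (p + q) = M p + M q) \<and> (\<forall>c p. M (smult c p) = smult c (M p))"
  by (auto simp: Vector_Spaces.linear_def module_hom_def module_hom_axioms_def
        vector_space_def module_def smult_add_right smult_add_left)

lemma ex1_diagonal_operator:
  fixes P :: "nat \<Rightarrow> real poly" and c :: "nat \<Rightarrow> real"
  assumes deg: "\<And>r. degree (P r) = r" and lc: "\<And>r. lead_coeff (P r) = 1"
  shows "\<exists>!M. Vector_Spaces.linear smult smult M \<and> (\<forall>r. M (P r) = smult (c r) (P r))"
proof (rule ex_ex1I)
  have top: "coeff (P n) n = 1" for n using lc[of n] deg[of n] by simp
  define T where "T = rec_nat (\<lambda>_. 0) (\<lambda>n S p.
     smult (coeff p n * c n) (P n) + S (p - smult (coeff p n) (P n)))"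
  have T0: "T 0 p = 0" for p by (simp add: T_def)
  have TS: "T (Suc n) p = smult (coeff p n * c n) (P n) + T n (p - smult (coeff p n) (P n))"
    for n p by (simp add: T_def)
  have Tadd: "T n (p + q) = T n p + T n q" for n p q
  proof (induction n arbitrary: p q)
    case (Suc n)
    have "p + q - smult (coeff (p + q) n) (P n) =
          (p - smult (coeff p n) (P n)) + (q - smult (coeff q n) (P n))"
      by (simp add: smult_add_left)
    hence "T n (p + q - smult (coeff (p + q) n) (P n)) =
        T n (p - smult (coeff p n) (P n)) + T n (q - smult (coeff q n) (P n))"
      by (simp only: Suc.IH)
    thus ?case unfolding TS by (simp add: smult_add_left distrib_right)
  qed (simp add: T0)
  have Tsmult: "T n (smult a p) = smult a (T n p)" for n a p
  proof (induction n arbitrary: p)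
    case (Suc n)
    have "smult a p - smult (coeff (smult a p) n) (P n) = smult a (p - smult (coeff p n) (P n))"
      by (simp add: smult_diff_right)
    thus ?case unfolding TS using Suc.IH by (simp add: smult_add_right mult.assoc)
  qed (simp add: T0)
  have Tstab: "T n p = T (Suc (degree p)) p" if "degree p < n" for n p
    using that
  proof (induction n)
    case (Suc n)
    show ?case
    proof (cases "degree p = n")
      case False
      hence "degree p < n" using Suc.prems by simp
      thus ?thesis using Suc.IH by (simp add: TS[of n] coeff_eq_0)
    qed simp
  qed simp
  define M where "M p = T (Suc (degree p)) p" for p
  have MT: "M p = T n p" if "degree p < n" for n p
    using Tstab[OF that] by (simp add: M_def)
  have "M (p + q) = M p + M q" for p q
  proof -
    define n where "n = Suc (max (degree p) (degree q))"
    have "degree (p + q) < n" "degree p < n" "degree q < n"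
      using degree_add_le_max[of p q] by (auto simp: n_def)
    thus ?thesis by (simp add: MT[of _ n] Tadd)
  qed
  moreover have "M (smult a p) = smult a (M p)" for a p
  proof -
    have "degree (smult a p) < Suc (degree p)" by (simp add: le_imp_less_Suc)
    thus ?thesis by (simp add: MT[of _ "Suc (degree p)"] Tsmult)
  qed
  moreover have "M (P r) = smult (c r) (P r)" for r
    using Tsmult[of r 0 0] by (simp add: M_def deg TS top)
  ultimately show "\<exists>M. Vector_Spaces.linear smult smult M \<and> (\<forall>r. M (P r) = smult (c r) (P r))"
    unfolding linear_smult_iff by blast
next
  fix M N
  assume M: "Vector_Spaces.linear smult smult M \<and> (\<forall>r. M (P r) = smult (c r) (P r))"
    and N: "Vector_Spaces.linear smult smult N \<and> (\<forall>r. N (P r) = smult (c r) (P r))"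
  have top: "coeff (P n) n = 1" for n using lc[of n] deg[of n] by simp
  have zero: "K 0 = 0" if "Vector_Spaces.linear smult smult K" for K :: "real poly \<Rightarrow> real poly"
    using that unfolding linear_smult_iff by (metis smult_0_left)
  have "\<forall>k\<ge>n. coeff p k = 0 \<Longrightarrow> M p = N p" for n p
  proof (induction n arbitrary: p)
    case 0
    hence "p = 0" by (simp add: poly_eq_iff)
    thus ?case using zero M N by metis
  next
    case (Suc n)
    define q where "q = p - smult (coeff p n) (P n)"
    have "coeff q k = 0" if "k \<ge> n" for k
      using that Suc.prems by (cases "k = n") (auto simp: q_def top deg coeff_eq_0)
    hence "M q = N q" using Suc.IH by blast
    moreover have "p = q + smult (coeff p n) (P n)" by (simp add: q_def)
    ultimately show ?case using M N unfolding linear_smult_iff by metis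
  qed
  moreover have "\<forall>k\<ge>Suc (degree p). coeff p k = 0" for p :: "real poly"
    by (simp add: coeff_eq_0)
  ultimately show "M = N" by blast
qed

lemma ex1_multiplier: "\<exists>!M. is_multiplier F \<nu> M"
  unfolding is_multiplier_def
  using is_jacobi_poly_jacobi_poly[of \<nu>] unfolding is_jacobi_poly_def
  by (intro ex1_diagonal_operator) blast+

lemma is_multiplier_multiplier: "is_multiplier F \<nu> (multiplier F \<nu>)"
  unfolding multiplier_def by (rule theI'[OF ex1_multiplier])


subsection \<open>Zero location\<close>

definition one_defect :: "nat \<Rightarrow> real poly set" where
  "one_defect N =
     {P. P = 0 \<or> (degree P \<le> N \<and>
        size {# z \<in># proots (map_poly complex_of_real P). z \<notin> complex_of_real ` {0..4} #} \<le> 1)}"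

definition real_rooted :: "real poly \<Rightarrow> bool" where
  "real_rooted P \<longleftrightarrow> (\<forall>z. poly (map_poly complex_of_real P) z = 0 \<longrightarrow> z \<in> \<real>)"

text \<open>The conventions for a zero argument need no separate clauses; see the lemma below.\<close>

definition weak_obreschkoff :: "real poly \<Rightarrow> real poly \<Rightarrow> bool"  (infix "\<preceq>" 50) where
  "A \<preceq> B \<longleftrightarrow> (\<forall>t. B + smult t A \<noteq> 0 \<longrightarrow> real_rooted (B + smult t A))"

lemma weak_obreschkoff_zero:
  shows "0 \<preceq> 0"
    and "B \<noteq> 0 \<Longrightarrow> 0 \<preceq> B \<longleftrightarrow> real_rooted B"
    and "B \<noteq> 0 \<Longrightarrow> B \<preceq> 0 \<longleftrightarrow> real_rooted B"
proof -
  have map: "poly (map_poly complex_of_real (smult t B)) z =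
      of_real t * poly (map_poly complex_of_real B) z" for t B z
    by (simp add: map_poly_smult)
  show "0 \<preceq> 0" and "B \<noteq> 0 \<Longrightarrow> 0 \<preceq> B \<longleftrightarrow> real_rooted B"
    by (auto simp: weak_obreschkoff_def)
  show "B \<noteq> 0 \<Longrightarrow> B \<preceq> 0 \<longleftrightarrow> real_rooted B"
    unfolding weak_obreschkoff_def real_rooted_def map add_0
    by (auto intro: exI[of _ 1])
qed


subsection \<open>Strip widths\<close>

definition e_const :: "nat \<Rightarrow> real \<Rightarrow> real" where
  "e_const n \<nu> = real n * (real n + 1) * (2 - \<nu>) / (2 * real n + \<nu>)"

definition h_const :: "nat \<Rightarrow> real \<Rightarrow> real" where
  "h_const n \<nu> = min 1 (sqrt (1 / 4 + e_const n \<nu>))"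

end

theory Submission
  imports Defs "HOL-Real_Asymp.Real_Asymp" "HOL-Computational_Algebra.Fundamental_Theorem_Algebra"
begin

text \<open>
  Write \<open>F(s) = G(s\<^sup>2)\<close>, so that the multiplier is \<open>G(J + 1/4)\<close>. A real polynomial \<open>G\<close> splits into
  factors \<open>J + 1/4 - w\<close> with \<open>w = u\<^sup>2\<close>, where \<open>F(u) = 0\<close>. Three kinds of factors preserve the class of
  polynomials with at most one zero outside \<open>[0, 4]\<close>: a single real \<open>w \<le> 1/4\<close>, a complex conjugate
  pair, and a pair of real \<open>w \<in> (1/4, 1]\<close>. In each case the operator does not decrease the number of
  sign changes on \<open>(0, 4)\<close>. This follows from Rolle's theorem along a factorization of the
  operator into first-order ones, built on a positive solution that is regular at \<open>0\<close> and, for pairs,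
  has zero flux at \<open>4\<close>. For a pair \<open>w1\<close>, \<open>w2\<close> this solution is the hypergeometric series whose numerators are
  divided differences, at \<open>w1\<close>, \<open>w2\<close>, of \<open>\<Prod>j<k. (1 - w / (j + 1/2)\<^sup>2)\<close>
  normalised by the limit \<open>cos (pi u)\<close>. For a conjugate pair they are nonnegative because the argument of
  that product decreases with \<open>k\<close>, from \<open>0\<close> to a limit that is at least \<open>-pi\<close> exactly when \<open>\<bar>Re u\<bar> \<le> 1\<close>.

  At most one real factor with \<open>w > 1/4\<close> remains unpaired. It is applied first, to \<open>y\<^sup>n (y + t)\<close>,
  where it produces \<open>y\<^sup>n\<^sup>-\<^sup>1\<close> times an explicit quadratic; this is where \<open>w \<le> 1/4 + e\<^sub>n\<close> is needed, and the
  discriminant of that quadratic gives sharpness. Entire \<open>F\<close> of order at most one are limits of polynomials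
  with zeros among those of \<open>F\<close>.
\<close>

subsection \<open>Sign changes and Rolle chains\<close>

text \<open>The obstacle is the endpoint 4. Every differentiation in a Rolle chain can cost a sign
  change, which then has to be regained from boundary values. A single real factor regains it at 4,
  because the flux of its solution there is a positive multiple of \<open>cos (pi * u)\<close>. For
  1/2 < u < 1 this cosine is negative and the mechanism breaks down, so such factors are treated in
  pairs: two solutions normalised to the same flux at 4 have a divided difference whose flux
  cancels, while its image under the Jacobi operator keeps a positive flux. The cancelled flux makes
  the second differentiation lossless, and the positive one pays for the first.

  The number \<open>e_const n \<nu>\<close> has an algebraic origin. The quadratic left by the
  unpaired factor depends on t linearly, and at the point where t drops out its value has the sign
  of -(a + \<open>e_const n \<nu>\<close>) with a = 1/4 - w.\<close>

definition sign_alternates :: "nat \<Rightarrow> (real \<Rightarrow> real) \<Rightarrow> bool" where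
  "sign_alternates n g \<longleftrightarrow>
     (\<exists>a. (\<forall>i\<le>n. 0 < a i \<and> a i < 4 \<and> (-1) ^ i * g (a i) > 0) \<and> (\<forall>i<n. a (Suc i) < a i))"

text \<open>The points run from right to left and start with a positive value, so
  \<open>sign_alternates\<close> fixes an orientation besides the number of sign changes. Only signs
  enter, hence weights, densities and squares can be inserted or cancelled between two
  differentiations.\<close>

lemma sign_alternates_pos_mult:
  assumes "sign_alternates n g" "\<And>y. 0 < y \<Longrightarrow> y < 4 \<Longrightarrow> h y = c y * g y \<and> c y > 0"
  shows "sign_alternates n h"
proof -
  obtain a where a: "\<And>i. i \<le> n \<Longrightarrow> 0 < a i \<and> a i < 4 \<and> (-1) ^ i * g (a i) > 0"
    and dec: "\<And>i. i < n \<Longrightarrow> a (Suc i) < a i"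
    using assms(1) unfolding sign_alternates_def by blast
  have "(-1) ^ i * h (a i) > 0" if "i \<le> n" for i
  proof -
    have "(-1) ^ i * h (a i) = c (a i) * ((-1) ^ i * g (a i))"
      using assms(2)[of "a i"] a[OF that] by simp
    thus ?thesis using a[OF that] assms(2)[of "a i"] by (metis mult_pos_pos)
  qed
  thus ?thesis unfolding sign_alternates_def using a dec by blast
qed

lemma MVT_signs:
  fixes g g' :: "real \<Rightarrow> real"
  assumes "0 < x" "x < y" "y < 4" "\<And>t. 0 < t \<Longrightarrow> t < 4 \<Longrightarrow> (g has_real_derivative g' t) (at t)"
    and "s * g x < s * g y"
  shows "\<exists>z>x. z < y \<and> s * g' z > 0"
proof -
  obtain z where z: "x < z" "z < y" "g y - g x = (y - x) * g' z"
    using MVT2[of x y g g'] assms by force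
  have "0 < s * (g y - g x)" using assms(5) by (simp add: algebra_simps)
  also have "\<dots> = (y - x) * (s * g' z)" using z by simp
  finally show ?thesis using z assms(2) by (auto simp: zero_less_mult_iff)
qed

lemma sign_alternates_between:
  assumes a: "\<And>i. i \<le> n \<Longrightarrow> 0 < a i \<and> a i < 4 \<and> (-1) ^ i * g (a i) > (0::real)"
    and dec: "\<And>i. i < n \<Longrightarrow> a (Suc i) < a i"
    and der: "\<And>t. 0 < t \<Longrightarrow> t < 4 \<Longrightarrow> (g has_real_derivative g' t) (at t)"
  shows "\<exists>b. \<forall>i<n. a (Suc i) < b i \<and> b i < a i \<and> (-1) ^ i * g' (b i) > 0"
proof -
  have "\<exists>z. a (Suc i) < z \<and> z < a i \<and> (-1) ^ i * g' z > 0" if "i < n" for i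
  proof -
    have "(-1) ^ i * g (a (Suc i)) < 0" "(-1) ^ i * g (a i) > 0"
      using a[of i] a[of "Suc i"] that by auto
    hence "(-1) ^ i * g (a (Suc i)) < (-1) ^ i * g (a i)" by linarith
    from MVT_signs[of "a (Suc i)" "a i" g g' "(-1) ^ i", OF _ _ _ der this]
    show ?thesis using a[of i] a[of "Suc i"] dec[OF that] that by auto
  qed
  thus ?thesis by metis
qed

text \<open>Plain Rolle: n + 2 points leave n + 1 gaps. The orientation survives because g rises
  from \<open>a 1\<close> to \<open>a 0\<close>.\<close>

lemma sign_alternates_deriv:
  assumes "sign_alternates (Suc n) g"
    and der: "\<And>t. 0 < t \<Longrightarrow> t < 4 \<Longrightarrow> (g has_real_derivative g' t) (at t)"
  shows "sign_alternates n g'"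
proof -
  obtain a where a: "\<And>i. i \<le> Suc n \<Longrightarrow> 0 < a i \<and> a i < 4 \<and> (-1) ^ i * g (a i) > 0"
    and dec: "\<And>i. i < Suc n \<Longrightarrow> a (Suc i) < a i"
    using assms(1) unfolding sign_alternates_def by blast
  from sign_alternates_between[OF a dec der] obtain b where
    b: "\<And>i. i < Suc n \<Longrightarrow> a (Suc i) < b i \<and> b i < a i \<and> (-1) ^ i * g' (b i) > 0" by blast
  have "0 < b i \<and> b i < 4" if "i \<le> n" for i
    using a[of i] a[of "Suc i"] b[of i] that by force
  moreover have "b (Suc i) < b i" if "i < n" for i
    using b[of i] b[of "Suc i"] that by force
  ultimately show ?thesis unfolding sign_alternates_def
    using b by (intro exI[of _ b]) auto
qed

text \<open>The limit acts as an extra zero at 4: g has to come down from its positive value at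
  \<open>a 0\<close>, so g' is negative somewhere to the right of the Rolle points. That point makes
  up for the lost gap, and the minus sign restores the orientation.\<close>

lemma sign_alternates_deriv_right:
  assumes "sign_alternates n g"
    and der: "\<And>t. 0 < t \<Longrightarrow> t < 4 \<Longrightarrow> (g has_real_derivative g' t) (at t)"
    and lim: "(g \<longlongrightarrow> 0) (at_left 4)"
  shows "sign_alternates n (\<lambda>y. - g' y)"
proof -
  obtain a where a: "\<And>i. i \<le> n \<Longrightarrow> 0 < a i \<and> a i < 4 \<and> (-1) ^ i * g (a i) > 0"
    and dec: "\<And>i. i < n \<Longrightarrow> a (Suc i) < a i"
    using assms(1) unfolding sign_alternates_def by blast
  from sign_alternates_between[OF a dec der] obtain b where
    b: "\<And>i. i < n \<Longrightarrow> a (Suc i) < b i \<and> b i < a i \<and> (-1) ^ i * g' (b i) > 0" by blast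
  have a0: "0 < a 0" "a 0 < 4" "g (a 0) > 0" using a[of 0] by auto
  have "eventually (\<lambda>y. g y < g (a 0)) (at_left 4)"
    using order_tendstoD(2)[OF lim a0(3)] .
  moreover have "eventually (\<lambda>y. y \<in> {a 0<..<4}) (at_left 4)"
    using a0(2) by (rule eventually_at_left_real)
  ultimately have "eventually (\<lambda>y. g y < g (a 0) \<and> y \<in> {a 0<..<4}) (at_left 4)"
    by eventually_elim auto
  then obtain y where y: "g y < g (a 0)" "a 0 < y" "y < 4"
    using eventually_happens[of _ "at_left (4::real)"] trivial_limit_at_left_real by force
  obtain c where c: "a 0 < c" "c < y" "-1 * g' c > 0"
    using MVT_signs[of "a 0" y g g' "-1", OF _ _ _ der] a0 y by auto
  \<comment> \<open>The new point takes index 0 and shifts the Rolle points by one, which matches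
    the sign (-1)^i of g' at \<open>b i\<close> with the sign required of -g' at index i +
    1.\<close>
  define d where "d = case_nat c b"
  have "0 < d i \<and> d i < 4 \<and> (-1) ^ i * - g' (d i) > 0" if "i \<le> n" for i
  proof (cases i)
    case 0 thus ?thesis using c a0 y by (simp add: d_def)
  next
    case (Suc j)
    thus ?thesis using b[of j] a[of j] a[of "Suc j"] that by (force simp: d_def)
  qed
  moreover have "d (Suc i) < d i" if "i < n" for i
  proof (cases i)
    case 0 thus ?thesis using b[of 0] c that by (simp add: d_def)
  next
    case (Suc j)
    thus ?thesis using b[of j] b[of "Suc j"] that by (force simp: d_def)
  qed
  ultimately show ?thesis unfolding sign_alternates_def by (intro exI[of _ d]) auto
qed

text \<open>Here the extra zero sits at 0 and the additional point lies to the left of all Rolle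
  points, so the orientation at the right end is untouched.\<close>

lemma sign_alternates_deriv_left:
  assumes "sign_alternates n g"
    and der: "\<And>t. 0 < t \<Longrightarrow> t < 4 \<Longrightarrow> (g has_real_derivative g' t) (at t)"
    and lim: "(g \<longlongrightarrow> 0) (at_right 0)"
  shows "sign_alternates n g'"
proof -
  obtain a where a: "\<And>i. i \<le> n \<Longrightarrow> 0 < a i \<and> a i < 4 \<and> (-1) ^ i * g (a i) > 0"
    and dec: "\<And>i. i < n \<Longrightarrow> a (Suc i) < a i"
    using assms(1) unfolding sign_alternates_def by blast
  from sign_alternates_between[OF a dec der] obtain b where
    b: "\<And>i. i < n \<Longrightarrow> a (Suc i) < b i \<and> b i < a i \<and> (-1) ^ i * g' (b i) > 0" by blast
  have an: "0 < a n" "a n < 4" "(-1) ^ n * g (a n) > 0" using a[of n] by auto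
  have "((\<lambda>y. (-1) ^ n * g y) \<longlongrightarrow> (-1) ^ n * 0) (at_right 0)"
    by (intro tendsto_intros lim)
  hence "eventually (\<lambda>y. (-1) ^ n * g y < (-1) ^ n * g (a n)) (at_right 0)"
    using order_tendstoD(2) an(3) by fastforce
  moreover have "eventually (\<lambda>y. y \<in> {0<..<a n}) (at_right 0)"
    using an(1) by (rule eventually_at_right_real)
  ultimately have "eventually (\<lambda>y. (-1) ^ n * g y < (-1) ^ n * g (a n) \<and> y \<in> {0<..<a n}) (at_right 0)"
    by eventually_elim auto
  then obtain y where y: "(-1) ^ n * g y < (-1) ^ n * g (a n)" "0 < y" "y < a n"
    using eventually_happens[of _ "at_right (0::real)"] trivial_limit_at_right_real by force
  obtain c where c: "y < c" "c < a n" "(-1) ^ n * g' c > 0"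
    using MVT_signs[of y "a n" g g' "(-1) ^ n", OF _ _ _ der] an y by auto
  define d where "d = b(n := c)"
  have "0 < d i \<and> d i < 4 \<and> (-1) ^ i * g' (d i) > 0" if "i \<le> n" for i
    using b[of i] a[of i] a[of "Suc i"] c y an that by (cases "i = n") (force simp: d_def)+
  moreover have "d (Suc i) < d i" if "i < n" for i
    using b[of i] b[of "Suc i"] c that by (cases "Suc i = n") (force simp: d_def)+
  ultimately show ?thesis unfolding sign_alternates_def by (intro exI[of _ d]) auto
qed

text \<open>The source of a gained sign change: a negative value beyond the positive rightmost
  point. Passing to -g restores the convention that the rightmost value is positive.\<close>

lemma sign_alternates_Cons:
  assumes "sign_alternates n g" "eventually (\<lambda>y. g y < 0) (at_left 4)"
  shows "sign_alternates (Suc n) (\<lambda>y. - g y)"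
proof -
  obtain a where a: "\<And>i. i \<le> n \<Longrightarrow> 0 < a i \<and> a i < 4 \<and> (-1) ^ i * g (a i) > 0"
    and dec: "\<And>i. i < n \<Longrightarrow> a (Suc i) < a i"
    using assms(1) unfolding sign_alternates_def by blast
  have "a 0 < 4" using a by simp
  hence "eventually (\<lambda>y. y \<in> {a 0<..<4}) (at_left 4)" by (rule eventually_at_left_real)
  with assms(2) have "eventually (\<lambda>y. g y < 0 \<and> y \<in> {a 0<..<4}) (at_left 4)"
    by eventually_elim auto
  then obtain y where y: "g y < 0" "a 0 < y" "y < 4"
    using eventually_happens[of _ "at_left (4::real)"] trivial_limit_at_left_real by force
  define d where "d = case_nat y a"
  have "0 < d i \<and> d i < 4 \<and> (-1) ^ i * - g (d i) > 0" if "i \<le> Suc n" for i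
  proof (cases i)
    case 0 thus ?thesis using a[of 0] y by (simp add: d_def)
  next
    case (Suc j)
    thus ?thesis using a[of j] that by (force simp: d_def)
  qed
  moreover have "d (Suc i) < d i" if "i < Suc n" for i
    using that y dec by (cases i) (auto simp: d_def)
  ultimately show ?thesis unfolding sign_alternates_def by (intro exI[of _ d]) auto
qed

section \<open>Self-adjoint form of the Jacobi operator and its flux\<close>

text \<open>\<open>weight\<close> and \<open>density\<close> put the Jacobi operator J into the form
  density * J f = -(weight * f')'. Both powers of the weight have positive exponents when 0 < \<nu>
  < 2, so it vanishes at 0 and at 4.\<close>

definition weight :: "real \<Rightarrow> real \<Rightarrow> real" where
  "weight \<nu> y = y powr \<nu> * (4 - y) powr (2 - \<nu>)"

definition density :: "real \<Rightarrow> real \<Rightarrow> real" where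
  "density \<nu> y = y powr (\<nu> - 1) * (4 - y) powr (1 - \<nu>)"

lemma density_pos: "0 < y \<Longrightarrow> y < 4 \<Longrightarrow> density \<nu> y > 0"
  by (simp add: density_def)

lemma weight_pos: "0 < y \<Longrightarrow> y < 4 \<Longrightarrow> weight \<nu> y > 0"
  by (simp add: weight_def)

lemma weight_eq: "0 < y \<Longrightarrow> y < 4 \<Longrightarrow> weight \<nu> y = density \<nu> y * (y * (4 - y))"
  unfolding weight_def density_def
  using powr_mult_base[of y "\<nu> - 1"] powr_mult_base[of "4 - y" "1 - \<nu>"] by (simp add: algebra_simps)

lemma has_derivative_weight:
  assumes "0 < y" "y < 4"
  shows "(weight \<nu> has_real_derivative density \<nu> y * (4 * \<nu> - 2 * y)) (at y)"
proof -
  have "(weight \<nu> has_real_derivative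
     (\<nu> * y powr (\<nu> - 1)) * (4 - y) powr (2 - \<nu>) +
     ((2 - \<nu>) * (4 - y) powr (2 - \<nu> - 1) * - 1) * y powr \<nu>) (at y)"
    unfolding weight_def using assms
    by (auto intro!: derivative_eq_intros)
  also have "(\<nu> * y powr (\<nu> - 1)) * (4 - y) powr (2 - \<nu>) +
     ((2 - \<nu>) * (4 - y) powr (2 - \<nu> - 1) * - 1) * y powr \<nu> = density \<nu> y * (4 * \<nu> - 2 * y)"
  proof -
    have *: "y powr \<nu> = y * y powr (\<nu> - 1)" "(4 - y) powr (2 - \<nu>) = (4 - y) * (4 - y) powr (1 - \<nu>)"
      "2 - \<nu> - 1 = 1 - \<nu>"
      using powr_mult_base[of y "\<nu> - 1"] powr_mult_base[of "4 - y" "1 - \<nu>"] assms by simp_all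
    show ?thesis unfolding density_def * by (simp only: algebra_simps)
  qed
  finally show ?thesis .
qed

lemma weight_tendsto_0_right:
  assumes "0 < \<nu>"
  shows "(weight \<nu> \<longlongrightarrow> 0) (at_right 0)"
proof -
  have "((\<lambda>y. y powr \<nu> * (4 - y) powr (2 - \<nu>)) \<longlongrightarrow> 0 powr \<nu> * (4 - 0) powr (2 - \<nu>)) (at_right 0)"
    by (intro tendsto_mult tendsto_powr' tendsto_intros)
       (use assms in \<open>auto simp: eventually_at_filter\<close>)
  thus ?thesis by (simp add: weight_def[abs_def])
qed

text \<open>A relation, because the solutions used below are power series and
  \<open>jacobi_op\<close> acts on polynomials only. The derivative a' is an argument of its own
  since the flux refers to it.\<close>

definition jacobi_image ::
  "real \<Rightarrow> (real \<Rightarrow> real) \<Rightarrow> (real \<Rightarrow> real) \<Rightarrow> (real \<Rightarrow> real) \<Rightarrow> bool" where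
  "jacobi_image \<nu> a a' ja \<longleftrightarrow> (\<forall>y. 0 < y \<and> y < 4 \<longrightarrow> (a has_real_derivative a' y) (at y) \<and>
      (\<exists>d. (a' has_real_derivative d) (at y) \<and> y * (y - 4) * d + (2 * y - 4 * \<nu>) * a' y = ja y))"

lemma jacobi_image_poly:
  "jacobi_image \<nu> (poly f) (poly (pderiv f)) (poly (jacobi_op \<nu> f))"
  unfolding jacobi_image_def
proof (intro allI impI conjI)
  fix y :: real
  show "\<exists>d. (poly (pderiv f) has_real_derivative d) (at y) \<and>
            y * (y - 4) * d + (2 * y - 4 * \<nu>) * poly (pderiv f) y = poly (jacobi_op \<nu> f) y"
    by (intro exI[of _ "poly (pderiv (pderiv f)) y"] conjI poly_DERIV)
       (simp add: jacobi_op_def algebra_simps)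
qed (rule poly_DERIV)

definition flux :: "real \<Rightarrow> (real \<Rightarrow> real) \<Rightarrow> (real \<Rightarrow> real) \<Rightarrow> (real \<Rightarrow> real) \<Rightarrow> (real \<Rightarrow> real) \<Rightarrow> real \<Rightarrow> real" where
  "flux \<nu> a a' b b' y = weight \<nu> y * (a' y * b y - a y * b' y)"

text \<open>Lagrange's identity: in the derivative of the weighted Wronskian the products a' b'
  cancel, and the derivative of the weight supplies the first-order terms of the two applications of
  the Jacobi operator.\<close>

lemma has_derivative_flux:
  assumes "jacobi_image \<nu> a a' ja" "jacobi_image \<nu> b b' jb" "0 < y" "y < 4"
  shows "(flux \<nu> a a' b b' has_real_derivative - density \<nu> y * (b y * ja y - a y * jb y)) (at y)"
proof -
  obtain d where d: "(a has_real_derivative a' y) (at y)" "(a' has_real_derivative d) (at y)"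
    "ja y = y * (y - 4) * d + (2 * y - 4 * \<nu>) * a' y"
    using assms unfolding jacobi_image_def by metis
  obtain e where e: "(b has_real_derivative b' y) (at y)" "(b' has_real_derivative e) (at y)"
    "jb y = y * (y - 4) * e + (2 * y - 4 * \<nu>) * b' y"
    using assms unfolding jacobi_image_def by metis
  have "(flux \<nu> a a' b b' has_real_derivative
     density \<nu> y * (4 * \<nu> - 2 * y) * (a' y * b y - a y * b' y) +
     (d * b y + b' y * a' y - (a' y * b' y + e * a y)) * weight \<nu> y) (at y)"
    unfolding flux_def[abs_def]
    by (intro DERIV_mult DERIV_diff has_derivative_weight d e assms)
  moreover have "density \<nu> y * (4 * \<nu> - 2 * y) * (a' y * b y - a y * b' y) +
     (d * b y + b' y * a' y - (a' y * b' y + e * a y)) * weight \<nu> y =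
     - density \<nu> y * (b y * ja y - a y * jb y)"
    using assms by (simp add: weight_eq d e algebra_simps)
  ultimately show ?thesis by simp
qed

section \<open>Rolle chains for operators of order two and four\<close>

text \<open>J - \<omega> is, up to positive factors, the composition: divide by E, differentiate,
  multiply by weight * E^2 to get the flux L, differentiate -L. The first derivative loses a sign
  change. As L ends at -f(4) * C < 0, \<open>sign_alternates_Cons\<close> regains it, and the second
  derivative is free because L vanishes at 0.\<close>

lemma single_step_alternates:
  assumes E: "jacobi_image \<nu> E E' (\<lambda>y. \<omega> * E y)"
    and \<nu>: "0 < \<nu>" "\<nu> < 2"
    and pos: "\<And>y. 0 < y \<Longrightarrow> y < 4 \<Longrightarrow> E y > 0"
    and E0: "(E \<longlongrightarrow> E0) (at_right 0)" "(E' \<longlongrightarrow> E0') (at_right 0)"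
    and E4: "((\<lambda>y. weight \<nu> y * E y) \<longlongrightarrow> 0) (at_left 4)"
            "((\<lambda>y. weight \<nu> y * E' y) \<longlongrightarrow> C) (at_left 4)" "C > 0"
    and f: "sign_alternates (Suc n) (poly f)" "poly f 4 > 0"
  shows "sign_alternates (Suc n) (poly (jacobi_op \<nu> f - smult \<omega> f))"
proof -
  define L where "L = flux \<nu> (poly f) (poly (pderiv f)) E E'"
  have polylim: "(poly p \<longlongrightarrow> poly p x) (at x within A)" for p :: "real poly" and x A
    by (intro tendsto_poly tendsto_ident_at)
  have "((\<lambda>y. poly (pderiv f) y * (weight \<nu> y * E y) - poly f y * (weight \<nu> y * E' y)) \<longlongrightarrow>
      poly (pderiv f) 4 * 0 - poly f 4 * C) (at_left 4)"
    by (intro tendsto_intros polylim E4)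
  hence L4: "(L \<longlongrightarrow> - poly f 4 * C) (at_left 4)"
    by (simp add: L_def flux_def[abs_def] algebra_simps)
  have L0: "(L \<longlongrightarrow> 0 * (poly (pderiv f) 0 * E0 - poly f 0 * E0')) (at_right 0)"
    unfolding L_def flux_def[abs_def]
    by (intro tendsto_intros polylim E0 weight_tendsto_0_right \<nu>)
  have "sign_alternates (Suc n) (\<lambda>y. poly f y / E y)"
    by (rule sign_alternates_pos_mult[OF f(1), of _ "\<lambda>y. 1 / E y"]) (use pos in auto)
  hence "sign_alternates n (\<lambda>y. L y / (weight \<nu> y * (E y)\<^sup>2))"
  proof (rule sign_alternates_deriv)
    fix y :: real assume y: "0 < y" "y < 4"
    have "((\<lambda>y. poly f y / E y) has_real_derivative
        (poly (pderiv f) y * E y - poly f y * E' y) / (E y * E y)) (at y)"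
      using y E pos[OF y] unfolding jacobi_image_def by (intro DERIV_divide poly_DERIV) auto
    thus "((\<lambda>y. poly f y / E y) has_real_derivative L y / (weight \<nu> y * (E y)\<^sup>2)) (at y)"
      using weight_pos[OF y, of \<nu>] by (simp add: L_def flux_def power2_eq_square)
  qed
  hence "sign_alternates n L"
    by (rule sign_alternates_pos_mult[where c="\<lambda>y. weight \<nu> y * (E y)\<^sup>2"])
       (use pos weight_pos in \<open>auto simp: less_imp_neq[OF pos, symmetric] less_imp_neq[OF weight_pos, symmetric]\<close>)
  moreover have "eventually (\<lambda>y. L y < 0) (at_left 4)"
    using f E4(3) by (intro order_tendstoD(2)[OF L4]) (simp add: )
  ultimately have "sign_alternates (Suc n) (\<lambda>y. - L y)" by (rule sign_alternates_Cons)
  hence "sign_alternates (Suc n) (\<lambda>y. density \<nu> y * (E y * poly (jacobi_op \<nu> f) y - poly f y * (\<omega> * E y)))"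
  proof (rule sign_alternates_deriv_left)
    fix y :: real assume y: "0 < y" "y < 4"
    show "((\<lambda>y. - L y) has_real_derivative
        density \<nu> y * (E y * poly (jacobi_op \<nu> f) y - poly f y * (\<omega> * E y))) (at y)"
      using DERIV_minus[OF has_derivative_flux[OF jacobi_image_poly[of \<nu> f] E y]] by (simp add: L_def)
  next
    show "((\<lambda>y. - L y) \<longlongrightarrow> 0) (at_right 0)" using tendsto_minus[OF L0] by simp
  qed
  thus ?thesis
    by (rule sign_alternates_pos_mult[where c="\<lambda>y. 1 / (density \<nu> y * E y)"])
       (use pos density_pos[of _ \<nu>] in \<open>auto simp: less_imp_neq[OF pos, symmetric] less_imp_neq[OF density_pos, symmetric] field_simps\<close>)
qed

text \<open>\<phi> and \<psi> = J \<phi> span a plane that J^2 - p J + m annihilates. Factoring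
  along this plane gives four derivatives, of f / \<phi>, L / X, U and -K. Only the first loses a
  sign change: L / X vanishes at 4, U and K vanish at 0, and K ends negative at 4, which pays for
  the loss. The first two quotients annihilate \<phi> and then \<psi>.\<close>

lemma pair_step_alternates:
  assumes \<phi>: "jacobi_image \<nu> \<phi> \<phi>' \<psi>"
    and \<psi>: "jacobi_image \<nu> \<psi> \<psi>' (\<lambda>y. p * \<psi> y - m * \<phi> y)"
    and \<nu>: "0 < \<nu>" "\<nu> < 2"
    and pos: "\<And>y. 0 < y \<Longrightarrow> y < 4 \<Longrightarrow> \<phi> y > 0"
    and wronskian: "\<And>y. 0 < y \<Longrightarrow> y < 4 \<Longrightarrow> \<psi>' y * \<phi> y - \<psi> y * \<phi>' y > 0"
    and lim0: "(\<phi> \<longlongrightarrow> \<phi>0) (at_right 0)" "\<phi>0 > 0" "(\<phi>' \<longlongrightarrow> \<phi>0') (at_right 0)"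
              "(\<psi> \<longlongrightarrow> \<psi>0) (at_right 0)" "(\<psi>' \<longlongrightarrow> \<psi>0') (at_right 0)"
    and lim4: "((\<lambda>y. weight \<nu> y * \<phi> y) \<longlongrightarrow> 0) (at_left 4)"
              "((\<lambda>y. weight \<nu> y * \<phi>' y) \<longlongrightarrow> 0) (at_left 4)"
              "((\<lambda>y. weight \<nu> y * \<psi> y) \<longlongrightarrow> 0) (at_left 4)"
              "((\<lambda>y. weight \<nu> y * \<psi>' y) \<longlongrightarrow> C) (at_left 4)" "C > 0"
    and c: "c > 0"
    and bound: "eventually (\<lambda>y. weight \<nu> y * (\<psi>' y * \<phi> y - \<psi> y * \<phi>' y) \<ge> c) (at_left 4)"
    and f: "sign_alternates (Suc n) (poly f)" "poly f 4 > 0"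
  shows "sign_alternates (Suc n)
           (poly (jacobi_op \<nu> (jacobi_op \<nu> f) - smult p (jacobi_op \<nu> f) + smult m f))"
proof -
  define g where "g = jacobi_op \<nu> f"
  define G where "G = jacobi_op \<nu> g - smult p g + smult m f"
  note f_img = jacobi_image_poly[of \<nu> f, folded g_def]
  note g_img = jacobi_image_poly[of \<nu> g]
  define L where "L = flux \<nu> (poly f) (poly (pderiv f)) \<phi> \<phi>'"
  define X where "X = flux \<nu> \<psi> \<psi>' \<phi> \<phi>'"
  \<comment> \<open>K is the bilinear concomitant of f and \<phi> for the self-adjoint operator J^2
    - p J + m. Since that operator annihilates \<phi>, only its value G on f survives in the
    derivative of K.\<close>
  define K where "K y = flux \<nu> (poly g) (poly (pderiv g)) \<phi> \<phi>' y +
                        flux \<nu> (poly f) (poly (pderiv f)) \<psi> \<psi>' y - p * L y" for y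
  define Q where "Q y = (\<psi> y)\<^sup>2 - p * \<psi> y * \<phi> y + m * (\<phi> y)\<^sup>2" for y
  \<comment> \<open>U is -(L / X)' freed of the positive factor density * \<phi>^2 / X^2. Written
    this way it stays finite at 0, where X vanishes.\<close>
  define U where "U y = (X y * (\<phi> y * poly g y - \<psi> y * poly f y) + L y * Q y) / (\<phi> y)\<^sup>2" for y
  have polylim: "(poly q \<longlongrightarrow> poly q x) (at x within A)" for q :: "real poly" and x A
    by (intro tendsto_poly tendsto_ident_at)
  have d\<phi>: "(\<phi> has_real_derivative \<phi>' y) (at y)" and d\<psi>: "(\<psi> has_real_derivative \<psi>' y) (at y)"
    if "0 < y" "y < 4" for y
    using \<phi> \<psi> that unfolding jacobi_image_def by auto
  have \<phi>nz: "\<phi> y \<noteq> 0" and wnz: "weight \<nu> y \<noteq> 0" and rnz: "density \<nu> y \<noteq> 0"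
    if "0 < y" "y < 4" for y
    using pos[OF that] weight_pos[OF that, of \<nu>] density_pos[OF that, of \<nu>] by auto
  have Xpos: "X y > 0" if "0 < y" "y < 4" for y
    unfolding X_def flux_def using wronskian[OF that] weight_pos[OF that, of \<nu>] by simp
  have dL: "(L has_real_derivative - density \<nu> y * (\<phi> y * poly g y - poly f y * \<psi> y)) (at y)"
    if "0 < y" "y < 4" for y
    unfolding L_def by (rule has_derivative_flux[OF f_img \<phi> that])
  have dX: "(X has_real_derivative density \<nu> y * Q y) (at y)" if "0 < y" "y < 4" for y
  proof -
    have "(X has_real_derivative - density \<nu> y * (\<phi> y * (p * \<psi> y - m * \<phi> y) - \<psi> y * \<psi> y)) (at y)"
      unfolding X_def by (rule has_derivative_flux[OF \<psi> \<phi> that])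
    thus ?thesis by (simp add: Q_def algebra_simps power2_eq_square)
  qed
  have dK: "(K has_real_derivative - (density \<nu> y * \<phi> y * poly G y)) (at y)"
    if "0 < y" "y < 4" for y
  proof -
    have *: "(K has_real_derivative - density \<nu> y * (\<phi> y * poly (jacobi_op \<nu> g) y - poly g y * \<psi> y) +
        - density \<nu> y * (\<psi> y * poly g y - poly f y * (p * \<psi> y - m * \<phi> y)) -
        p * (- density \<nu> y * (\<phi> y * poly g y - poly f y * \<psi> y))) (at y)"
      unfolding K_def[abs_def]
      by (intro DERIV_diff DERIV_add DERIV_cmult dL has_derivative_flux[OF g_img \<phi>]
            has_derivative_flux[OF f_img \<psi>] that)
    show ?thesis by (rule DERIV_cong[OF *]) (simp add: G_def algebra_simps)
  qed
  have dU: "(U has_real_derivative K y * (X y / (weight \<nu> y * (\<phi> y)\<^sup>2))) (at y)"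
    if y: "0 < y" "y < 4" for y
  proof -
    define w where "w = weight \<nu> y"
    define N where "N y = X y * (\<phi> y * poly g y - \<psi> y * poly f y) + L y * Q y" for y
    define Q' where "Q' = 2 * \<psi> y * \<psi>' y - p * (\<psi>' y * \<phi> y + \<psi> y * \<phi>' y) + m * (2 * \<phi> y * \<phi>' y)"
    define H where "H = \<phi>' y * poly g y + \<phi> y * poly (pderiv g) y - (\<psi>' y * poly f y + \<psi> y * poly (pderiv f) y)"
    have dQ: "(Q has_real_derivative Q') (at y)"
      unfolding Q_def[abs_def] Q'_def
      by (auto intro!: derivative_eq_intros d\<phi>[OF y] d\<psi>[OF y] simp: algebra_simps)
    have dH: "((\<lambda>y. \<phi> y * poly g y - \<psi> y * poly f y) has_real_derivative H) (at y)"
      unfolding H_def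
      by (auto intro!: derivative_eq_intros d\<phi>[OF y] d\<psi>[OF y] simp: algebra_simps)
    have dN: "(N has_real_derivative X y * H + L y * Q') (at y)"
    proof -
      have "(N has_real_derivative
         (density \<nu> y * Q y * (\<phi> y * poly g y - \<psi> y * poly f y) + H * X y) +
         (- density \<nu> y * (\<phi> y * poly g y - poly f y * \<psi> y) * Q y + Q' * L y)) (at y)"
        unfolding N_def[abs_def] by (intro DERIV_add DERIV_mult dX[OF y] dL[OF y] dH dQ)
      thus ?thesis by (simp add: algebra_simps)
    qed
    have "(U has_real_derivative
       ((X y * H + L y * Q') * (\<phi> y)\<^sup>2 - N y * (2 * \<phi> y * \<phi>' y)) / ((\<phi> y)\<^sup>2 * (\<phi> y)\<^sup>2)) (at y)"
      unfolding U_def[abs_def] N_def[symmetric]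
      by (intro DERIV_divide dN) (use \<phi>nz[OF y] in \<open>auto intro!: derivative_eq_intros d\<phi>[OF y]\<close>)
    also have "((X y * H + L y * Q') * (\<phi> y)\<^sup>2 - N y * (2 * \<phi> y * \<phi>' y)) / ((\<phi> y)\<^sup>2 * (\<phi> y)\<^sup>2)
        = K y * (X y / (weight \<nu> y * (\<phi> y)\<^sup>2))"
    proof -
      have e: "L y = w * (poly (pderiv f) y * \<phi> y - poly f y * \<phi>' y)"
        "X y = w * (\<psi>' y * \<phi> y - \<psi> y * \<phi>' y)"
        "K y = w * (poly (pderiv g) y * \<phi> y - poly g y * \<phi>' y) +
            w * (poly (pderiv f) y * \<psi> y - poly f y * \<psi>' y) - p * L y"
        by (simp_all add: L_def X_def K_def flux_def w_def)
      \<comment> \<open>L, X and K each contain the weight once, so K * X carries it twice and the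
        bracket on the left once. The extra factor w balances this and leaves a polynomial
        identity.\<close>
      have "w * ((X y * H + L y * Q') * (\<phi> y)\<^sup>2 - N y * (2 * \<phi> y * \<phi>' y)) = K y * X y * (\<phi> y)\<^sup>2"
        unfolding e N_def Q_def H_def Q'_def by algebra
      hence "(X y * H + L y * Q') * (\<phi> y)\<^sup>2 - N y * (2 * \<phi> y * \<phi>' y) = K y * X y * (\<phi> y)\<^sup>2 / w"
        using wnz[OF y] by (simp add: w_def eq_divide_eq mult.commute)
      thus ?thesis using \<phi>nz[OF y] by (simp add: w_def power2_eq_square)
    qed
    finally show ?thesis .
  qed
  have dLX: "((\<lambda>y. L y / X y) has_real_derivative - (U y * (density \<nu> y * (\<phi> y)\<^sup>2 / (X y)\<^sup>2))) (at y)"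
    if y: "0 < y" "y < 4" for y
  proof -
    have "((\<lambda>y. L y / X y) has_real_derivative
       (- density \<nu> y * (\<phi> y * poly g y - poly f y * \<psi> y) * X y - L y * (density \<nu> y * Q y)) / (X y * X y)) (at y)"
      using Xpos[OF y] by (intro DERIV_divide dL dX y) auto
    also have "(- density \<nu> y * (\<phi> y * poly g y - poly f y * \<psi> y) * X y - L y * (density \<nu> y * Q y)) / (X y * X y)
      = - (U y * (density \<nu> y * (\<phi> y)\<^sup>2 / (X y)\<^sup>2))"
      using \<phi>nz[OF y] by (simp add: U_def power2_eq_square algebra_simps add_divide_distrib diff_divide_distrib)
    finally show ?thesis .
  qed

  have w0: "(weight \<nu> \<longlongrightarrow> 0) (at_right 0)" by (rule weight_tendsto_0_right[OF \<nu>(1)])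
  have L0: "(L \<longlongrightarrow> 0 * (poly (pderiv f) 0 * \<phi>0 - poly f 0 * \<phi>0')) (at_right 0)"
    unfolding L_def flux_def[abs_def] by (intro tendsto_intros polylim lim0 w0)
  have X0: "(X \<longlongrightarrow> 0 * (\<psi>0' * \<phi>0 - \<psi>0 * \<phi>0')) (at_right 0)"
    unfolding X_def flux_def[abs_def] by (intro tendsto_intros polylim lim0 w0)
  have K0: "(K \<longlongrightarrow> 0 * (poly (pderiv g) 0 * \<phi>0 - poly g 0 * \<phi>0') +
        0 * (poly (pderiv f) 0 * \<psi>0 - poly f 0 * \<psi>0') -
        p * (0 * (poly (pderiv f) 0 * \<phi>0 - poly f 0 * \<phi>0'))) (at_right 0)"
    unfolding K_def[abs_def] by (intro tendsto_diff tendsto_add tendsto_mult tendsto_const L0)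
      (unfold flux_def[abs_def], (intro tendsto_intros polylim lim0 w0)+)
  have U0: "(U \<longlongrightarrow> ((0 * (\<psi>0' * \<phi>0 - \<psi>0 * \<phi>0')) * (\<phi>0 * poly g 0 - \<psi>0 * poly f 0) +
      (0 * (poly (pderiv f) 0 * \<phi>0 - poly f 0 * \<phi>0')) * (\<psi>0\<^sup>2 - p * \<psi>0 * \<phi>0 + m * \<phi>0\<^sup>2)) / \<phi>0\<^sup>2) (at_right 0)"
    unfolding U_def[abs_def] Q_def
    by (intro tendsto_intros L0 X0 polylim lim0) (use lim0(2) in auto)
  have lim4': "((\<lambda>y. poly (pderiv q) y * (weight \<nu> y * b y) - poly q y * (weight \<nu> y * b' y))
      \<longlongrightarrow> poly (pderiv q) 4 * 0 - poly q 4 * c) (at_left 4)"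
    if "((\<lambda>y. weight \<nu> y * b y) \<longlongrightarrow> 0) (at_left 4)" "((\<lambda>y. weight \<nu> y * b' y) \<longlongrightarrow> c) (at_left 4)"
    for q b b' c
    by (intro tendsto_intros polylim that)
  have flux4: "(flux \<nu> (poly q) (poly (pderiv q)) b b' \<longlongrightarrow> - poly q 4 * c) (at_left 4)"
    if "((\<lambda>y. weight \<nu> y * b y) \<longlongrightarrow> 0) (at_left 4)" "((\<lambda>y. weight \<nu> y * b' y) \<longlongrightarrow> c) (at_left 4)"
    for q b b' c
    using lim4'[OF that, of q] by (simp add: flux_def[abs_def] algebra_simps)
  have L4: "(L \<longlongrightarrow> 0) (at_left 4)"
    using flux4[OF lim4(1,2), of f] by (simp add: L_def)
  have "(K \<longlongrightarrow> - poly g 4 * 0 + - poly f 4 * C - p * 0) (at_left 4)"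
    unfolding K_def[abs_def]
    by (intro tendsto_add tendsto_diff tendsto_mult tendsto_const L4 flux4 lim4)
  hence K4: "eventually (\<lambda>y. K y < 0) (at_left 4)"
    using f(2) lim4(5) by (intro order_tendstoD(2)) auto
  \<comment> \<open>Only a lower bound for X is assumed near 4, not a limit. It suffices because L
    tends to 0 there, by the vanishing flux of \<phi>.\<close>
  have LX4: "((\<lambda>y. L y / X y) \<longlongrightarrow> 0) (at_left 4)"
  proof (rule tendsto_rabs_zero_cancel, rule tendsto_sandwich[where f="\<lambda>_. 0"])
    show "eventually (\<lambda>y. \<bar>L y / X y\<bar> \<le> \<bar>L y\<bar> / c) (at_left 4)"
      using bound
    proof eventually_elim
      case (elim y)
      hence "c \<le> X y" by (simp add: X_def flux_def)
      thus ?case using c by (simp add: abs_divide divide_left_mono)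
    qed
    show "((\<lambda>y. \<bar>L y\<bar> / c) \<longlongrightarrow> 0) (at_left 4)"
      using tendsto_divide[OF tendsto_rabs[OF L4] tendsto_const[of c]] c by simp
  qed auto

  have "sign_alternates (Suc n) (\<lambda>y. poly f y / \<phi> y)"
    by (rule sign_alternates_pos_mult[OF f(1), of _ "\<lambda>y. 1 / \<phi> y"]) (use pos in auto)
  hence "sign_alternates n (\<lambda>y. L y / (weight \<nu> y * (\<phi> y)\<^sup>2))"
  proof (rule sign_alternates_deriv)
    fix y :: real assume y: "0 < y" "y < 4"
    have "((\<lambda>y. poly f y / \<phi> y) has_real_derivative
        (poly (pderiv f) y * \<phi> y - poly f y * \<phi>' y) / (\<phi> y * \<phi> y)) (at y)"
      using y \<phi>nz[OF y] by (intro DERIV_divide poly_DERIV d\<phi>) auto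
    thus "((\<lambda>y. poly f y / \<phi> y) has_real_derivative L y / (weight \<nu> y * (\<phi> y)\<^sup>2)) (at y)"
      using wnz[OF y] by (simp add: L_def flux_def power2_eq_square)
  qed
  hence "sign_alternates n (\<lambda>y. L y / X y)"
    by (rule sign_alternates_pos_mult[where c="\<lambda>y. weight \<nu> y * (\<phi> y)\<^sup>2 / X y"])
       (use \<phi>nz wnz Xpos weight_pos[of _ \<nu>] in \<open>auto intro!: divide_pos_pos mult_pos_pos\<close>)
  hence "sign_alternates n (\<lambda>y. - (- (U y * (density \<nu> y * (\<phi> y)\<^sup>2 / (X y)\<^sup>2))))"
    by (rule sign_alternates_deriv_right) (use dLX LX4 in auto)
  hence "sign_alternates n U"
    by (rule sign_alternates_pos_mult[where c="\<lambda>y. (X y)\<^sup>2 / (density \<nu> y * (\<phi> y)\<^sup>2)"])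
       (use \<phi>nz rnz Xpos density_pos[of _ \<nu>] in
         \<open>force simp: less_imp_neq[OF Xpos, symmetric] intro!: divide_pos_pos mult_pos_pos\<close>)
  hence "sign_alternates n (\<lambda>y. K y * (X y / (weight \<nu> y * (\<phi> y)\<^sup>2)))"
    by (rule sign_alternates_deriv_left) (use dU U0 in auto)
  hence "sign_alternates n K"
    by (rule sign_alternates_pos_mult[where c="\<lambda>y. weight \<nu> y * (\<phi> y)\<^sup>2 / X y"])
       (use \<phi>nz wnz Xpos weight_pos[of _ \<nu>] in
         \<open>force simp: less_imp_neq[OF Xpos, symmetric] intro!: divide_pos_pos mult_pos_pos\<close>)
  hence "sign_alternates (Suc n) (\<lambda>y. - K y)" by (rule sign_alternates_Cons[OF _ K4])
  hence "sign_alternates (Suc n) (\<lambda>y. density \<nu> y * \<phi> y * poly G y)"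
  proof (rule sign_alternates_deriv_left)
    fix y :: real assume y: "0 < y" "y < 4"
    show "((\<lambda>y. - K y) has_real_derivative density \<nu> y * \<phi> y * poly G y) (at y)"
      using DERIV_minus[OF dK[OF y]] by simp
  next
    show "((\<lambda>y. - K y) \<longlongrightarrow> 0) (at_right 0)" using tendsto_minus[OF K0] by simp
  qed
  hence "sign_alternates (Suc n) (poly G)"
    by (rule sign_alternates_pos_mult[where c="\<lambda>y. 1 / (density \<nu> y * \<phi> y)"])
       (use pos \<phi>nz rnz density_pos[of _ \<nu>] in auto)
  thus ?thesis by (simp add: G_def g_def)
qed

subsection \<open>Hypergeometric solutions\<close>

lemma pochhammer_powser_sums:
  fixes s x :: real
  assumes "0 \<le> x" "x < 1"
  shows "(\<lambda>k. pochhammer s k / fact k * x ^ k) sums (1 - x) powr (- s)"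
proof -
  have "(\<lambda>n. (- s gchoose n) * (- x) ^ n) sums (1 + (- x)) powr (- s)"
    using assms by (intro gen_binomial_real) auto
  moreover have "(- s gchoose n) * (- x) ^ n = pochhammer s n / fact n * x ^ n" for n
  proof -
    have "(- x) ^ n = (- 1) ^ n * x ^ n" by (metis power_mult_distrib mult_minus1)
    thus ?thesis by (simp add: gbinomial_pochhammer mult_ac flip: power_mult_distrib)
  qed
  ultimately show ?thesis by simp
qed

text \<open>An Abelian theorem: subtract L times the series of (1 - x) powr (-s), whose coefficients
  are g k. The remaining coefficients are o(g k); a finite head is killed by (1 - x) powr s, and the
  tail is a small multiple of the comparison series.\<close>

lemma abel_binomial_comparison:
  fixes a :: "nat \<Rightarrow> real" and s L :: real
  assumes s: "s > 0" and lim: "(\<lambda>k. a k / (pochhammer s k / fact k)) \<longlonglongrightarrow> L"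
  shows "((\<lambda>x. (1 - x) powr s * (\<Sum>k. a k * x ^ k)) \<longlongrightarrow> L) (at_left 1)"
proof -
  define g where "g k = pochhammer s k / fact k" for k
  have g: "g k > 0" for k using s by (simp add: g_def pochhammer_pos)
  have gs: "(\<lambda>k. g k * x ^ k) sums (1 - x) powr (- s)" if "0 \<le> x" "x < 1" for x
    unfolding g_def by (rule pochhammer_powser_sums[OF that])
  define d where "d k = a k - L * g k" for k
  have "(\<lambda>k. a k / g k - L) \<longlonglongrightarrow> L - L" using lim by (intro tendsto_intros) (simp add: g_def)
  moreover have "a k / g k - L = d k / g k" for k
    using g[of k] by (simp add: d_def field_simps)
  ultimately have d0: "(\<lambda>k. d k / g k) \<longlonglongrightarrow> 0" by simp
  have sd: "summable (\<lambda>k. d k * x ^ k)" if x: "0 \<le> x" "x < 1" for x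
  proof -
    obtain B where B: "\<And>k. norm (d k / g k) \<le> B"
      using Bseq_def convergentI[OF d0] convergent_imp_Bseq by metis
    show ?thesis
    proof (rule summable_comparison_test'[of "\<lambda>k. B * (g k * x ^ k)"])
      show "summable (\<lambda>k. B * (g k * x ^ k))" using gs[OF x] by (intro summable_mult) (rule sums_summable)
      fix k
      have "\<bar>d k\<bar> \<le> B * g k" using B[of k] g[of k] by (simp add: abs_divide divide_le_eq)
      thus "norm (d k * x ^ k) \<le> B * (g k * x ^ k)"
        using x by (simp add: abs_mult mult_right_mono flip: mult.assoc)
    qed
  qed
  have as: "(\<Sum>k. a k * x ^ k) = L * (1 - x) powr (- s) + (\<Sum>k. d k * x ^ k)" if x: "0 \<le> x" "x < 1" for x
  proof -
    have "(\<lambda>k. L * (g k * x ^ k) + d k * x ^ k) sums (L * (1 - x) powr (- s) + (\<Sum>k. d k * x ^ k))"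
      by (intro sums_add sums_mult gs summable_sums sd x)
    moreover have "L * (g k * x ^ k) + d k * x ^ k = a k * x ^ k" for k by (simp add: d_def algebra_simps)
    ultimately show ?thesis by (simp add: sums_iff)
  qed
  have ev01: "eventually (\<lambda>x. 0 < x \<and> x < 1) (at_left (1::real))"
    using eventually_at_left_real[of 0 "1::real"] by (auto elim: eventually_mono)
  have "((\<lambda>x. (1 - x) powr s * (\<Sum>k. d k * x ^ k)) \<longlongrightarrow> 0) (at_left 1)"
  proof (rule tendstoI)
    fix e :: real assume e: "e > 0"
    have "eventually (\<lambda>k. norm (d k / g k) < e / 2) sequentially"
      using tendstoD[OF d0, of "e/2"] e by (simp add: dist_norm)
    then obtain K where K: "\<And>k. k \<ge> K \<Longrightarrow> norm (d k / g k) < e / 2"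
      by (auto simp: eventually_sequentially)
    define D where "D = (\<Sum>k<K. \<bar>d k\<bar>)"
    have bd: "\<bar>(1 - x) powr s * (\<Sum>k. d k * x ^ k)\<bar> \<le> (1 - x) powr s * D + e / 2"
      if x: "0 < x" "x < 1" for x
    proof -
      have sb: "(\<lambda>k. (if k < K then \<bar>d k\<bar> else 0) + e / 2 * (g k * x ^ k)) sums (D + e / 2 * (1 - x) powr (- s))"
      proof (intro sums_add sums_mult gs)
        have "(\<lambda>k. if k \<in> {..<K} then \<bar>d k\<bar> else 0) sums (\<Sum>k\<in>{..<K}. \<bar>d k\<bar>)"
          by (rule sums_If_finite_set) simp
        thus "(\<lambda>k. if k < K then \<bar>d k\<bar> else 0) sums D" by (simp add: D_def)
      qed (use x in auto)
      have "norm (\<Sum>k. d k * x ^ k) \<le> (\<Sum>k. (if k < K then \<bar>d k\<bar> else 0) + e / 2 * (g k * x ^ k))"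
      proof (rule norm_suminf_le)
        fix k
        show "norm (d k * x ^ k) \<le> (if k < K then \<bar>d k\<bar> else 0) + e / 2 * (g k * x ^ k)"
        proof (cases "k < K")
          case True
          have "\<bar>d k\<bar> * x ^ k \<le> \<bar>d k\<bar> * 1" using x by (intro mult_left_mono power_le_one) auto
          moreover have "0 \<le> e / 2 * (g k * x ^ k)" using e g[of k] x by simp
          ultimately show ?thesis using True x by (simp add: abs_mult)
        next
          case False
          hence "\<bar>d k\<bar> \<le> e / 2 * g k" using K[of k] g[of k] by (simp add: abs_divide divide_less_eq)
          hence "\<bar>d k\<bar> * x ^ k \<le> e / 2 * g k * x ^ k" using x by (intro mult_right_mono) auto
          thus ?thesis using False x by (simp add: abs_mult mult_ac)
        qed
      qed (use sb in \<open>simp add: sums_iff\<close>)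
      also have "\<dots> = D + e / 2 * (1 - x) powr (- s)" using sb by (simp add: sums_iff)
      finally have "(1 - x) powr s * norm (\<Sum>k. d k * x ^ k) \<le> (1 - x) powr s * (D + e / 2 * (1 - x) powr (- s))"
        by (intro mult_left_mono) auto
      also have "\<dots> = (1 - x) powr s * D + e / 2 * ((1 - x) powr s * (1 - x) powr (- s))"
        by (simp add: algebra_simps)
      also have "(1 - x) powr s * (1 - x) powr (- s) = 1"
        using x by (simp flip: powr_add)
      finally show ?thesis by (simp add: abs_mult)
    qed
    have "((\<lambda>x. (1 - x) powr s * D) \<longlongrightarrow> (1 - 1) powr s * D) (at_left (1::real))"
      by (intro tendsto_intros tendsto_powr') (use s in \<open>auto simp: eventually_at_filter\<close>)
    hence "eventually (\<lambda>x. (1 - x) powr s * D < e / 2) (at_left (1::real))"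
      using e s by (intro order_tendstoD(2)[where y = 0]) auto
    with ev01 show "eventually (\<lambda>x. dist ((1 - x) powr s * (\<Sum>k. d k * x ^ k)) 0 < e) (at_left 1)"
      by eventually_elim (use bd in \<open>force simp: dist_norm\<close>)
  qed
  hence "((\<lambda>x. L + (1 - x) powr s * (\<Sum>k. d k * x ^ k)) \<longlongrightarrow> L + 0) (at_left 1)"
    by (intro tendsto_intros)
  moreover have "eventually (\<lambda>x. (1 - x) powr s * (\<Sum>k. a k * x ^ k) =
      L + (1 - x) powr s * (\<Sum>k. d k * x ^ k)) (at_left 1)"
    using ev01
  proof eventually_elim
    case (elim x)
    have "(1 - x) powr s * (1 - x) powr (- s) = 1" using elim by (simp flip: powr_add)
    thus ?case using as[of x] elim by (simp add: distrib_left mult.left_commute[of "(1 - x) powr s" L])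
  qed
  ultimately show ?thesis by (simp add: tendsto_cong)
qed

section \<open>Power series solutions with prescribed numerators\<close>

text \<open>The coefficients of 2F1(1/2, 1/2; \<nu>; y/4), the solution regular at 0 for w = 0. All
  other solutions are obtained by multiplying them with a convergent sequence of numerators.\<close>

definition hyp_coeff :: "real \<Rightarrow> nat \<Rightarrow> real" where
  "hyp_coeff \<nu> k = (pochhammer (1 / 2) k)\<^sup>2 / (fact k * pochhammer \<nu> k * 4 ^ k)"

lemma hyp_coeff_pos: "0 < \<nu> \<Longrightarrow> hyp_coeff \<nu> k > 0"
  using pochhammer_pos[of \<nu> k] pochhammer_pos[of "1 / 2 :: real" k]
  by (simp add: hyp_coeff_def)

lemma hyp_coeff_0 [simp]: "hyp_coeff \<nu> 0 = 1"
  by (simp add: hyp_coeff_def)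

lemma hyp_coeff_Suc:
  assumes "0 < \<nu>"
  shows "4 * (real k + 1) * (real k + \<nu>) * hyp_coeff \<nu> (Suc k) = (real k + 1 / 2)\<^sup>2 * hyp_coeff \<nu> k"
proof -
  have "pochhammer \<nu> k > 0" using assms by (rule pochhammer_pos)
  thus ?thesis using assms
    by (simp add: hyp_coeff_def pochhammer_Suc divide_simps add_eq_0_iff power_mult_distrib)
       (simp add: algebra_simps power2_eq_square)
qed

definition hyp_series :: "real \<Rightarrow> (nat \<Rightarrow> real) \<Rightarrow> real fps" where
  "hyp_series \<nu> e = Abs_fps (\<lambda>k. e k * hyp_coeff \<nu> k)"

abbreviation hyp_fun :: "real \<Rightarrow> (nat \<Rightarrow> real) \<Rightarrow> real \<Rightarrow> real" where
  "hyp_fun \<nu> e \<equiv> eval_fps (hyp_series \<nu> e)"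

abbreviation hyp_fun' :: "real \<Rightarrow> (nat \<Rightarrow> real) \<Rightarrow> real \<Rightarrow> real" where
  "hyp_fun' \<nu> e \<equiv> eval_fps (fps_deriv (hyp_series \<nu> e))"

abbreviation hyp_flux :: "real \<Rightarrow> (nat \<Rightarrow> real) \<Rightarrow> (nat \<Rightarrow> real) \<Rightarrow> real \<Rightarrow> real" where
  "hyp_flux \<nu> e f \<equiv> flux \<nu> (hyp_fun \<nu> e) (hyp_fun' \<nu> e) (hyp_fun \<nu> f) (hyp_fun' \<nu> f)"

lemma conv_radius_hyp_coeff:
  assumes "0 < \<nu>"
  shows "conv_radius (hyp_coeff \<nu>) = 4"
proof (rule conv_radius_ratio_limit_nonzero)
  show "4 = ereal 4" by simp
  have "(\<lambda>k. 4 * (real k + 1) * (real k + \<nu>) / (real k + 1 / 2)\<^sup>2) \<longlonglongrightarrow> 4"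
    using assms by real_asymp
  moreover have "norm (hyp_coeff \<nu> k) / norm (hyp_coeff \<nu> (Suc k)) =
      4 * (real k + 1) * (real k + \<nu>) / (real k + 1 / 2)\<^sup>2" for k
  proof -
    have "hyp_coeff \<nu> k / hyp_coeff \<nu> (Suc k) = 4 * (real k + 1) * (real k + \<nu>) / (real k + 1 / 2)\<^sup>2"
    proof (subst frac_eq_eq)
      show "(real k + 1 / 2)\<^sup>2 \<noteq> 0" by (simp add: add_eq_0_iff)
      show "hyp_coeff \<nu> (Suc k) \<noteq> 0" using hyp_coeff_pos[OF assms, of "Suc k"] by simp
      show "hyp_coeff \<nu> k * (real k + 1 / 2)\<^sup>2 = 4 * (real k + 1) * (real k + \<nu>) * hyp_coeff \<nu> (Suc k)"
        by (metis hyp_coeff_Suc[OF assms] mult.commute)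
    qed
    thus ?thesis using hyp_coeff_pos[OF assms, of k] hyp_coeff_pos[OF assms, of "Suc k"] by simp
  qed
  ultimately show "(\<lambda>k. norm (hyp_coeff \<nu> k) / norm (hyp_coeff \<nu> (Suc k))) \<longlonglongrightarrow> 4" by simp
qed simp

lemma conv_radius_hyp_series:
  assumes "0 < \<nu>" "convergent e"
  shows "fps_conv_radius (hyp_series \<nu> e) \<ge> 4"
  unfolding fps_conv_radius_def
proof (rule conv_radius_geI_ex')
  fix r :: real assume r: "0 < r" "ereal r < 4"
  obtain B where B: "\<And>k. norm (e k) \<le> B"
    using Bseq_def convergent_imp_Bseq[OF assms(2)] by metis
  have "summable (\<lambda>k. norm (hyp_coeff \<nu> k * r ^ k))"
    using r conv_radius_hyp_coeff[OF assms(1)] by (intro abs_summable_in_conv_radius) auto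
  hence "summable (\<lambda>k. B * norm (hyp_coeff \<nu> k * r ^ k))" by (rule summable_mult)
  thus "summable (\<lambda>k. fps_nth (hyp_series \<nu> e) k * of_real r ^ k)"
  proof (rule summable_comparison_test'[of _ 0])
    fix k
    have "norm (e k) * norm (hyp_coeff \<nu> k * r ^ k) \<le> B * norm (hyp_coeff \<nu> k * r ^ k)"
      by (intro mult_right_mono B) simp
    thus "norm (fps_nth (hyp_series \<nu> e) k * of_real r ^ k) \<le> B * norm (hyp_coeff \<nu> k * r ^ k)"
      by (simp add: hyp_series_def norm_mult mult.assoc abs_mult)
  qed
qed

text \<open>Relative to \<open>hyp_coeff\<close> the Jacobi operator becomes a recurrence on the
  numerators in which \<nu> no longer occurs, because \<open>hyp_coeff_Suc\<close> absorbs it.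
  Positivity of the solutions is therefore a question about the numerators alone, the same for every
  \<nu>.\<close>

lemma jacobi_image_hyp_series:
  assumes \<nu>: "0 < \<nu>" and e: "convergent e"
    and s: "\<And>k. s k = real k * (real k + 1) * e k - (real k + 1 / 2)\<^sup>2 * e (Suc k)"
  shows "jacobi_image \<nu> (hyp_fun \<nu> e) (hyp_fun' \<nu> e)
           (hyp_fun \<nu> s)"
proof -
  define f where "f = hyp_series \<nu> e"
  have cr: "fps_conv_radius f \<ge> 4" "fps_conv_radius (fps_deriv f) \<ge> 4"
    "fps_conv_radius (fps_deriv (fps_deriv f)) \<ge> 4"
    using conv_radius_hyp_series[OF \<nu> e] fps_conv_radius_deriv[of f] fps_conv_radius_deriv[of "fps_deriv f"]
    unfolding f_def by (auto intro: order_trans)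
  have ode: "hyp_series \<nu> s = (fps_X * (fps_X * fps_deriv (fps_deriv f)) + fps_const 2 * (fps_X * fps_deriv f)) -
      (fps_const 4 * (fps_X * fps_deriv (fps_deriv f)) + fps_const (4 * \<nu>) * fps_deriv f)" (is "_ = ?rhs")
  proof (rule fps_ext)
    fix k
    have a: "fps_nth f k = e k * hyp_coeff \<nu> k" for k by (simp add: f_def hyp_series_def)
    have "fps_nth ?rhs k = real k * (real k + 1) * fps_nth f k -
        4 * (real k + 1) * (real k + \<nu>) * fps_nth f (Suc k)"
    proof (cases k)
      case (Suc j)
      thus ?thesis by (cases j) (simp_all add: algebra_simps)
    qed (simp add: algebra_simps)
    also have "\<dots> = real k * (real k + 1) * e k * hyp_coeff \<nu> k -
        (4 * (real k + 1) * (real k + \<nu>) * hyp_coeff \<nu> (Suc k)) * e (Suc k)"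
      by (simp add: a mult_ac)
    also have "\<dots> = s k * hyp_coeff \<nu> k"
      unfolding hyp_coeff_Suc[OF \<nu>] s by (simp add: algebra_simps)
    finally show "fps_nth (hyp_series \<nu> s) k = fps_nth ?rhs k" by (simp add: hyp_series_def)
  qed
  show ?thesis unfolding jacobi_image_def f_def[symmetric]
  proof (intro allI impI conjI, goal_cases)
    case (1 y)
    hence "ereal (norm y) < 4" by simp
    from less_le_trans[OF this cr(1)] show ?case by (rule has_field_derivative_eval_fps)
  next
    case (2 y)
    hence y: "ereal (norm y) < 4" by simp
    hence y3: "ereal (norm y) < fps_conv_radius f" "ereal (norm y) < fps_conv_radius (fps_deriv f)"
      "ereal (norm y) < fps_conv_radius (fps_deriv (fps_deriv f))"
      using less_le_trans[OF y cr(1)] less_le_trans[OF y cr(2)] less_le_trans[OF y cr(3)] by auto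
    have m: "ereal (norm y) < fps_conv_radius (p * q)"
      if "ereal (norm y) < fps_conv_radius p" "ereal (norm y) < fps_conv_radius q" for p q :: "real fps"
      using fps_conv_radius_mult[of p q] that by (metis less_le_trans min_less_iff_conj)
    have d: "ereal (norm y) < fps_conv_radius (p + q)"
      if "ereal (norm y) < fps_conv_radius p" "ereal (norm y) < fps_conv_radius q" for p q :: "real fps"
      using fps_conv_radius_add[of p q] that by (metis less_le_trans min_less_iff_conj)
    show ?case
    proof (intro exI conjI)
      show "(eval_fps (fps_deriv f) has_real_derivative eval_fps (fps_deriv (fps_deriv f)) y) (at y)"
        by (rule has_field_derivative_eval_fps[OF y3(2)])
      show "y * (y - 4) * eval_fps (fps_deriv (fps_deriv f)) y + (2 * y - 4 * \<nu>) * eval_fps (fps_deriv f) y =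
         hyp_fun \<nu> s y"
      proof -
        have inf: "ereal (norm y) < fps_conv_radius (fps_const c)" "ereal (norm y) < fps_conv_radius fps_X" for c
          by simp_all
        note c = inf y3 m[OF inf(2) y3(3)] m[OF inf(2) y3(2)] m[OF inf(2) m[OF inf(2) y3(3)]]
          m[OF inf(1) m[OF inf(2) y3(2)]] m[OF inf(1) m[OF inf(2) y3(3)]] m[OF inf(1) y3(2)]
        have "hyp_fun \<nu> s y =
            (y * (y * eval_fps (fps_deriv (fps_deriv f)) y) + 2 * (y * eval_fps (fps_deriv f) y)) -
            (4 * (y * eval_fps (fps_deriv (fps_deriv f)) y) + 4 * \<nu> * eval_fps (fps_deriv f) y)"
          unfolding ode eval_fps_diff[OF d[OF c(8,9)] d[OF c(10,11)]]
          unfolding eval_fps_add[OF c(8,9)] eval_fps_add[OF c(10,11)]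
          by (simp only: eval_fps_mult[OF inf(1) c(6)] eval_fps_mult[OF inf(1) c(7)] eval_fps_mult[OF inf(1) y3(2)]
              eval_fps_mult[OF inf(2) c(6)] eval_fps_mult[OF inf(2) y3(2)] eval_fps_mult[OF inf(2) y3(3)] eval_fps_const eval_fps_X)
        thus ?thesis by (simp add: algebra_simps)
      qed
    qed
  qed
qed

lemma hyp_series_at_0:
  assumes \<nu>: "0 < \<nu>" and e: "convergent e"
  shows "(hyp_fun \<nu> e \<longlongrightarrow> e 0) (at_right 0)"
    and "(hyp_fun' \<nu> e \<longlongrightarrow> hyp_fun' \<nu> e 0) (at_right 0)"
proof -
  have cr: "fps_conv_radius (hyp_series \<nu> e) > 0"
    using conv_radius_hyp_series[OF assms] by (auto intro: less_le_trans[of _ 4])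
  have "(hyp_fun \<nu> e \<longlongrightarrow> hyp_fun \<nu> e 0) (at_right 0)"
    using continuous_eval_fps[of 0 "hyp_series \<nu> e"] cr by (auto simp: continuous_within zero_ereal_def)
  thus "(hyp_fun \<nu> e \<longlongrightarrow> e 0) (at_right 0)"
    by (simp add: eval_fps_at_0 hyp_series_def)
  show "(hyp_fun' \<nu> e \<longlongrightarrow> hyp_fun' \<nu> e 0) (at_right 0)"
    using continuous_eval_fps[of 0 "fps_deriv (hyp_series \<nu> e)"]
      less_le_trans[OF cr fps_conv_radius_deriv]
    by (auto simp: continuous_within zero_ereal_def)
qed

section \<open>Boundary behaviour of the series at 4\<close>

text \<open>The flux at 4 of a series whose numerators tend to 1, that is, the connection
  coefficient of 2F1(1/2, 1/2; \<nu>; y/4) that governs the growth of its derivative.\<close>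

definition flux_const :: "real \<Rightarrow> real" where
  "flux_const \<nu> = 4 * Gamma \<nu> * Gamma (2 - \<nu>) / (Gamma (1 / 2))\<^sup>2"

lemma flux_const_pos: "0 < \<nu> \<Longrightarrow> \<nu> < 2 \<Longrightarrow> flux_const \<nu> > 0"
  using Gamma_real_pos[of \<nu>] Gamma_real_pos[of "2 - \<nu>"]
  by (simp add: flux_const_def Gamma_one_half_real)

text \<open>Gauss's limit formula for Gamma. The powers of k have exponents \<nu> and 2 - \<nu> in
  the numerator and twice 1/2 in the denominator, so one factor k is left. The length k + 1 is that
  of the product in \<open>Gamma_series\<close>.\<close>

lemma pochhammer_ratio_LIMSEQ:
  assumes "0 < \<nu>" "\<nu> < 2"
  shows "(\<lambda>k. real k * ((pochhammer (1 / 2) (k + 1))\<^sup>2 / (pochhammer \<nu> (k + 1) * pochhammer (2 - \<nu>) (k + 1))))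
           \<longlonglongrightarrow> flux_const \<nu> / 4"
proof -
  have "(\<lambda>k. Gamma_series \<nu> k * Gamma_series (2 - \<nu>) k / (Gamma_series (1 / 2) k)\<^sup>2)
      \<longlonglongrightarrow> Gamma \<nu> * Gamma (2 - \<nu>) / (Gamma (1 / 2))\<^sup>2"
    using Gamma_real_pos[of "1/2 :: real"] by (intro tendsto_intros) (auto simp: Gamma_one_half_real)
  moreover have "eventually (\<lambda>k. Gamma_series \<nu> k * Gamma_series (2 - \<nu>) k / (Gamma_series (1 / 2) k)\<^sup>2 =
     real k * ((pochhammer (1 / 2) (k + 1))\<^sup>2 / (pochhammer \<nu> (k + 1) * pochhammer (2 - \<nu>) (k + 1)))) sequentially"
    using eventually_gt_at_top[of 0]
  proof eventually_elim
    case (elim k)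
    have p: "pochhammer \<nu> (k + 1) > 0" "pochhammer (2 - \<nu>) (k + 1) > 0" "pochhammer (1 / 2 :: real) (k + 1) > 0"
      using assms by (auto intro: pochhammer_pos)
    have e: "exp (\<nu> * ln (real k)) * exp ((2 - \<nu>) * ln (real k)) =
        real k * (exp (1 / 2 * ln (real k)))\<^sup>2"
    proof -
      have "exp (\<nu> * ln (real k)) * exp ((2 - \<nu>) * ln (real k)) = exp (ln (real k)) * exp (ln (real k))"
        by (simp add: algebra_simps flip: exp_add)
      also have "(exp (1 / 2 * ln (real k)))\<^sup>2 = exp (ln (real k))"
        by (simp add: power2_eq_square flip: exp_add)
      ultimately show ?thesis using elim by simp
    qed
    have "Gamma_series \<nu> k * Gamma_series (2 - \<nu>) k / (Gamma_series (1 / 2) k)\<^sup>2 =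
      ((exp (\<nu> * ln (real k)) * exp ((2 - \<nu>) * ln (real k))) / (exp (1 / 2 * ln (real k)))\<^sup>2) *
      ((pochhammer (1 / 2) (k + 1))\<^sup>2 / (pochhammer \<nu> (k + 1) * pochhammer (2 - \<nu>) (k + 1)))"
      unfolding Gamma_series_def power_divide power_mult_distrib using p
      by (simp add: field_simps power2_eq_square del: pochhammer_Suc)
    thus ?case unfolding e by simp
  qed
  ultimately show ?thesis unfolding flux_const_def by (simp add: tendsto_cong)
qed

text \<open>The factor 16 collects 4 powr (2 - \<nu>) from the rescaling y = 4 x and 4 powr \<nu>
  from the other power in the weight.\<close>

lemma weight_tendsto_at_4:
  fixes f :: "real \<Rightarrow> real"
  assumes "((\<lambda>x. (1 - x) powr (2 - \<nu>) * f (4 * x)) \<longlongrightarrow> L) (at_left 1)"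
  shows "((\<lambda>y. weight \<nu> y * f y) \<longlongrightarrow> 16 * L) (at_left 4)"
proof -
  have fl: "filterlim (\<lambda>y::real. y / 4) (at_left 1) (at_left 4)"
    unfolding filterlim_at by (auto simp: eventually_at_filter intro!: tendsto_eq_intros)
  have "((\<lambda>y. (1 - y / 4) powr (2 - \<nu>) * f (4 * (y / 4))) \<longlongrightarrow> L) (at_left 4)"
    by (rule filterlim_compose[OF assms fl])
  hence *: "((\<lambda>y. (4 powr (2 - \<nu>) * y powr \<nu>) * ((1 - y / 4) powr (2 - \<nu>) * f (4 * (y / 4))))
      \<longlongrightarrow> (4 powr (2 - \<nu>) * 4 powr \<nu>) * L) (at_left 4)"
    by (intro tendsto_mult tendsto_powr tendsto_intros) auto
  have 16: "4 powr (2 - \<nu>) * 4 powr \<nu> = (16::real)" by (simp flip: powr_add)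
  have "eventually (\<lambda>y. (4 powr (2 - \<nu>) * y powr \<nu>) * ((1 - y / 4) powr (2 - \<nu>) * f (4 * (y / 4))) =
      weight \<nu> y * f y) (at_left 4)"
    using eventually_at_left_real[of 0 "4::real", simplified]
  proof eventually_elim
    case (elim y)
    have "(4 * (1 - y / 4)) powr (2 - \<nu>) = 4 powr (2 - \<nu>) * (1 - y / 4) powr (2 - \<nu>)"
      by (rule powr_mult)
    thus ?case by (simp add: weight_def algebra_simps)
  qed
  from Lim_transform_eventually[OF * this] show ?thesis unfolding 16 .
qed

text \<open>The coefficients of the derivative are comparable with those of (1 - x) powr (\<nu> -
  2), and those of the function are smaller by a factor of order k. So the weight kills the function
  at 4 and leaves, for the derivative, the limit of the numerators times a universal
  constant.\<close>

lemma hyp_series_at_4: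
  assumes \<nu>: "0 < \<nu>" "\<nu> < 2" and e: "e \<longlonglongrightarrow> l"
  shows "((\<lambda>y. weight \<nu> y * hyp_fun \<nu> e y) \<longlongrightarrow> 0) (at_left 4)"
    and "((\<lambda>y. weight \<nu> y * hyp_fun' \<nu> e y) \<longlongrightarrow> flux_const \<nu> * l) (at_left 4)"
proof -
  have ev: "eval_fps f (4 * x) = (\<Sum>k. (fps_nth f k * 4 ^ k) * x ^ k)" for f :: "real fps" and x
    by (simp add: eval_fps_def power_mult_distrib mult.assoc)
  define q where "q k = real k * ((pochhammer (1 / 2) (k + 1))\<^sup>2 / (pochhammer \<nu> (k + 1) * pochhammer (2 - \<nu>) (k + 1)))" for k
  have q: "q \<longlonglongrightarrow> flux_const \<nu> / 4" unfolding q_def[abs_def] by (rule pochhammer_ratio_LIMSEQ[OF \<nu>])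
  have p: "pochhammer \<nu> k > 0" "pochhammer (2 - \<nu>) k > 0" "pochhammer (1 / 2 :: real) k > 0" for k
    using \<nu> by (auto intro: pochhammer_pos)
  show "((\<lambda>y. weight \<nu> y * hyp_fun \<nu> e y) \<longlongrightarrow> 0) (at_left 4)"
  proof -
    define a where "a k = fps_nth (hyp_series \<nu> e) k * 4 ^ k" for k
    have lim: "(\<lambda>k. e k * q k * (1 / real k * ((\<nu> + real k) * (2 - \<nu> + real k) / (1 / 2 + real k)\<^sup>2)))
        \<longlonglongrightarrow> l * (flux_const \<nu> / 4) * (0 * 1)"
      by (intro tendsto_mult e q) (real_asymp)+
    have "(\<lambda>k. a k / (pochhammer (2 - \<nu>) k / fact k)) \<longlonglongrightarrow> 0"
    proof (rule Lim_transform_eventually)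
      show "(\<lambda>k. e k * q k * (1 / real k * ((\<nu> + real k) * (2 - \<nu> + real k) / (1 / 2 + real k)\<^sup>2))) \<longlonglongrightarrow> 0"
        using lim by simp
      show "eventually (\<lambda>k. e k * q k * (1 / real k * ((\<nu> + real k) * (2 - \<nu> + real k) / (1 / 2 + real k)\<^sup>2)) =
          a k / (pochhammer (2 - \<nu>) k / fact k)) sequentially"
        using eventually_gt_at_top[of 0]
      proof eventually_elim
        case (elim k)
        have nz: "\<nu> + real k \<noteq> 0" "2 - \<nu> + real k \<noteq> 0" "1 / 2 + real k \<noteq> 0" "real k \<noteq> 0"
          using elim \<nu> by auto
        have "q k * (1 / real k * ((\<nu> + real k) * (2 - \<nu> + real k) / (1 / 2 + real k)\<^sup>2)) =
          (pochhammer (1 / 2) k)\<^sup>2 / (pochhammer \<nu> k * pochhammer (2 - \<nu>) k)"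
          unfolding q_def using nz p[of k]
          by (simp add: pochhammer_Suc power_mult_distrib)
        moreover have "a k / (pochhammer (2 - \<nu>) k / fact k) =
            e k * ((pochhammer (1 / 2) k)\<^sup>2 / (pochhammer \<nu> k * pochhammer (2 - \<nu>) k))"
          using p[of k] by (simp add: a_def hyp_series_def hyp_coeff_def)
        ultimately show ?case by (simp only: mult.assoc)
      qed
    qed
    from abel_binomial_comparison[OF _ this] \<nu>
    have "((\<lambda>x. (1 - x) powr (2 - \<nu>) * hyp_fun \<nu> e (4 * x)) \<longlongrightarrow> 0) (at_left 1)"
      by (simp add: ev a_def)
    from weight_tendsto_at_4[OF this] show ?thesis by simp
  qed
  show "((\<lambda>y. weight \<nu> y * hyp_fun' \<nu> e y) \<longlongrightarrow> flux_const \<nu> * l) (at_left 4)"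
  proof -
    define a where "a k = fps_nth (fps_deriv (hyp_series \<nu> e)) k * 4 ^ k" for k
    have lim: "(\<lambda>k. e (Suc k) * q k * ((2 - \<nu> + real k) / (4 * real k)))
        \<longlonglongrightarrow> l * (flux_const \<nu> / 4) * (1 / 4)"
      by (intro tendsto_mult LIMSEQ_Suc[OF e] q) (real_asymp)+
    have "(\<lambda>k. a k / (pochhammer (2 - \<nu>) k / fact k)) \<longlonglongrightarrow> l * flux_const \<nu> / 16"
    proof (rule Lim_transform_eventually)
      show "(\<lambda>k. e (Suc k) * q k * ((2 - \<nu> + real k) / (4 * real k))) \<longlonglongrightarrow> l * flux_const \<nu> / 16"
        using lim by simp
      show "eventually (\<lambda>k. e (Suc k) * q k * ((2 - \<nu> + real k) / (4 * real k)) =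
          a k / (pochhammer (2 - \<nu>) k / fact k)) sequentially"
        using eventually_gt_at_top[of 0]
      proof eventually_elim
        case (elim k)
        have nz: "2 - \<nu> + real k \<noteq> 0" "real k \<noteq> 0" using elim \<nu> by auto
        define P where "P = pochhammer (1 / 2 :: real) (Suc k)"
        define V where "V = pochhammer \<nu> (Suc k)"
        define T where "T = pochhammer (2 - \<nu>) k"
        have T: "pochhammer (2 - \<nu>) (k + 1) = T * (2 - \<nu> + real k)"
          by (simp add: T_def pochhammer_Suc)
        have pos: "V \<noteq> 0" "T \<noteq> 0" using p[of "Suc k"] p[of k] by (auto simp: V_def T_def)
        have "q k * ((2 - \<nu> + real k) / (4 * real k)) = P\<^sup>2 / (4 * V * T)"
          unfolding q_def T using nz pos by (simp add: P_def[symmetric] V_def[symmetric])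
        moreover have "a k / (T / fact k) = e (Suc k) * (P\<^sup>2 / (4 * V * T))"
        proof -
          have "a k = (1 + real k) * (e (Suc k) * (P\<^sup>2 / ((1 + real k) * fact k * V * (4 * 4 ^ k)))) * 4 ^ k"
            by (simp add: a_def hyp_series_def hyp_coeff_def P_def V_def)
          also have "\<dots> = e (Suc k) * P\<^sup>2 / (fact k * V * 4)"
          proof -
            have "1 + real k \<noteq> 0" by simp
            thus ?thesis by (simp add: divide_simps)
          qed
          finally show ?thesis by simp
        qed
        ultimately show ?case unfolding T_def by (simp only: mult.assoc)
      qed
    qed
    from abel_binomial_comparison[OF _ this] \<nu>
    have "((\<lambda>x. (1 - x) powr (2 - \<nu>) * hyp_fun' \<nu> e (4 * x))
        \<longlongrightarrow> l * flux_const \<nu> / 16) (at_left 1)"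
      by (simp add: ev a_def)
    from weight_tendsto_at_4[OF this] show ?thesis by (simp add: mult.commute)
  qed
qed

subsection \<open>Factors preserving sign changes\<close>

text \<open>With w = u^2 this is (1/2 - u)_k (1/2 + u)_k / ((1/2)_k)^2, so these numerators turn
  \<open>hyp_series\<close> into 2F1(1/2 - u, 1/2 + u; \<nu>; y/4), an eigenfunction of the Jacobi
  operator for w - 1/4. The product form shows how sign and argument vary with k.\<close>

definition hyp_num :: "'a::real_normed_field \<Rightarrow> nat \<Rightarrow> 'a" where
  "hyp_num w k = (\<Prod>j<k. 1 - w / (of_nat j + 1 / 2)\<^sup>2)"

lemma of_nat_plus_half_nonzero: "(of_nat j + 1 / 2 :: 'a::real_normed_field) \<noteq> 0"
proof -
  have "(of_nat j + 1 / 2 :: 'a) = of_real (real j + 1 / 2)" by simp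
  also have "\<dots> \<noteq> 0" unfolding of_real_eq_0_iff by (simp add: add_eq_0_iff)
  finally show ?thesis .
qed

lemma hyp_num_0 [simp]: "hyp_num w 0 = 1"
  by (simp add: hyp_num_def)

lemma hyp_num_Suc:
  "(of_nat k + 1 / 2)\<^sup>2 * hyp_num w (Suc k) = ((of_nat k + 1 / 2)\<^sup>2 - w) * hyp_num w k"
proof -
  have "(of_nat k + 1 / 2 :: 'a)\<^sup>2 * (1 - w / (of_nat k + 1 / 2)\<^sup>2) = (of_nat k + 1 / 2)\<^sup>2 - w"
    using of_nat_plus_half_nonzero[of k, where 'a='a] by (simp add: right_diff_distrib)
  thus ?thesis by (simp add: hyp_num_def mult.left_commute mult.commute)
qed

lemma of_real_hyp_num: "of_real (hyp_num w k) = hyp_num (of_real w) k"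
  by (simp add: hyp_num_def)

lemma hyp_num_split: "k \<le> m \<Longrightarrow> hyp_num w m = hyp_num w k * (\<Prod>j\<in>{k..<m}. 1 - w / (of_nat j + 1 / 2)\<^sup>2)"
  unfolding hyp_num_def by (simp add: lessThan_atLeast0 prod.atLeastLessThan_concat)

text \<open>Euler's product for the cosine, from the limit formula for 1 / Gamma and the reflection
  formula.\<close>

lemma hyp_num_LIMSEQ:
  fixes u :: complex
  shows "hyp_num (u\<^sup>2) \<longlonglongrightarrow> cos (of_real pi * u)"
proof -
  have P: "hyp_num (u\<^sup>2) k = pochhammer (1/2 - u) k * pochhammer (1/2 + u) k / (pochhammer (1/2) k)\<^sup>2" for k
  proof (induction k)
    case (Suc k)
    have nz: "(of_nat k + 1/2 :: complex) \<noteq> 0" by (rule of_nat_plus_half_nonzero)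
    have "1 - u\<^sup>2 / (of_nat k + 1 / 2)\<^sup>2 = (1/2 - u + of_nat k) * (1/2 + u + of_nat k) / (1/2 + of_nat k)\<^sup>2"
    proof -
      have "1 - u\<^sup>2 / (of_nat k + 1 / 2)\<^sup>2 = ((of_nat k + 1 / 2)\<^sup>2 - u\<^sup>2) / (of_nat k + 1 / 2)\<^sup>2"
        using nz by (simp add: diff_divide_distrib)
      also have "(of_nat k + 1 / 2)\<^sup>2 - u\<^sup>2 = (1/2 - u + of_nat k) * (1/2 + u + of_nat k)"
        by (simp add: algebra_simps power2_eq_square)
      finally show ?thesis by (simp add: add.commute)
    qed
    moreover have "hyp_num (u\<^sup>2) (Suc k) = hyp_num (u\<^sup>2) k * (1 - u\<^sup>2 / (of_nat k + 1 / 2)\<^sup>2)"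
      by (simp add: hyp_num_def)
    ultimately show ?case by (simp only: Suc.IH) (simp add: pochhammer_Suc power_mult_distrib)
  qed (simp)
  have "(\<lambda>n. rGamma_series (1/2 - u) n * rGamma_series (1/2 + u) n / (rGamma_series (1/2) n)\<^sup>2) \<longlonglongrightarrow>
      rGamma (1/2 - u) * rGamma (1/2 + u) / (rGamma (1/2))\<^sup>2"
    by (intro tendsto_intros) (simp add: rGamma_inverse_Gamma Gamma_one_half_complex)
  also have "eventually (\<lambda>n. rGamma_series (1/2 - u) n * rGamma_series (1/2 + u) n / (rGamma_series (1/2) n)\<^sup>2 =
      hyp_num (u\<^sup>2) (n + 1)) sequentially"
  proof (rule always_eventually, rule allI)
    fix n :: nat
    define l where "l = (of_real (ln (of_nat n)) :: complex)"
    have e: "exp ((1/2 - u) * l) * exp ((1/2 + u) * l) = (exp (1/2 * l))\<^sup>2"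
      by (simp add: power2_eq_square algebra_simps flip: exp_add)
    have *: "a / (f * x) * (b / (f * y)) / (c / (f * z))\<^sup>2 = a * b / c\<^sup>2"
      if "x * y = z\<^sup>2" "f \<noteq> 0" "z \<noteq> 0" for a b c f x y z :: complex
    proof -
      have "a / (f * x) * (b / (f * y)) / (c / (f * z))\<^sup>2 = (a * b * (f\<^sup>2 * z\<^sup>2)) / (c\<^sup>2 * (f\<^sup>2 * (x * y)))"
        by (simp add: power_mult_distrib power2_eq_square mult_ac power_divide)
      thus ?thesis using that by simp
    qed
    show "rGamma_series (1/2 - u) n * rGamma_series (1/2 + u) n / (rGamma_series (1/2) n)\<^sup>2 =
      hyp_num (u\<^sup>2) (n + 1)"
      unfolding rGamma_series_def P l_def[symmetric] by (rule *) (simp_all add: e)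
  qed
  hence "(\<lambda>n. rGamma_series (1/2 - u) n * rGamma_series (1/2 + u) n / (rGamma_series (1/2) n)\<^sup>2) \<longlonglongrightarrow>
      rGamma (1/2 - u) * rGamma (1/2 + u) / (rGamma (1/2))\<^sup>2 \<longleftrightarrow>
    (\<lambda>n. hyp_num (u\<^sup>2) (n + 1)) \<longlonglongrightarrow> rGamma (1/2 - u) * rGamma (1/2 + u) / (rGamma (1/2))\<^sup>2"
    by (rule tendsto_cong)
  finally have "(\<lambda>n. hyp_num (u\<^sup>2) (n + 1)) \<longlonglongrightarrow> rGamma (1/2 - u) * rGamma (1/2 + u) / (rGamma (1/2))\<^sup>2" .
  moreover have "rGamma (1/2 - u) * rGamma (1/2 + u) / (rGamma (1/2))\<^sup>2 = cos (of_real pi * u)"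
  proof -
    have "rGamma (1/2 + u) * rGamma (1 - (1/2 + u)) = sin (of_real pi * (1/2 + u)) / of_real pi"
      by (rule rGamma_reflection_complex)
    also have "sin (of_real pi * (1/2 + u)) = cos (of_real pi * u)"
      by (simp add: distrib_left sin_add)
    finally have "rGamma (1/2 - u) * rGamma (1/2 + u) = cos (of_real pi * u) / of_real pi"
      by (simp add: mult.commute)
    moreover have "(rGamma (1/2 :: complex))\<^sup>2 = 1 / of_real pi"
    proof -
      have "(complex_of_real (sqrt pi))\<^sup>2 = of_real pi" by (simp flip: of_real_power)
      thus ?thesis unfolding rGamma_inverse_Gamma Gamma_one_half_complex power_inverse
        by (simp add: inverse_eq_divide)
    qed
    ultimately show ?thesis by simp
  qed
  ultimately show ?thesis by (simp add: filterlim_sequentially_Suc)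
qed

lemma eval_hyp_series_linear:
  assumes \<nu>: "0 < \<nu>" and e: "convergent e" "convergent f" and y: "0 < y" "y < 4"
  shows "hyp_fun \<nu> (\<lambda>k. a * e k + b * f k) y =
           a * hyp_fun \<nu> e y + b * hyp_fun \<nu> f y"
    and "hyp_fun' \<nu> (\<lambda>k. a * e k + b * f k) y =
           a * hyp_fun' \<nu> e y + b * hyp_fun' \<nu> f y"
proof -
  have y4: "ereal (norm y) < 4" using y by simp
  note r = less_le_trans[OF y4 conv_radius_hyp_series[OF \<nu> e(1)]]
           less_le_trans[OF y4 conv_radius_hyp_series[OF \<nu> e(2)]]
  note r' = less_le_trans[OF r(1) fps_conv_radius_deriv] less_le_trans[OF r(2) fps_conv_radius_deriv]
  have eq: "hyp_series \<nu> (\<lambda>k. a * e k + b * f k) = fps_const a * hyp_series \<nu> e + fps_const b * hyp_series \<nu> f"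
    by (intro fps_ext) (simp add: hyp_series_def algebra_simps)
  have m: "ereal (norm y) < fps_conv_radius (fps_const c * q)" if "ereal (norm y) < fps_conv_radius q" for c and q :: "real fps"
    using fps_conv_radius_mult[of "fps_const c" q] that by (auto intro: less_le_trans)
  show "hyp_fun \<nu> (\<lambda>k. a * e k + b * f k) y =
           a * hyp_fun \<nu> e y + b * hyp_fun \<nu> f y"
    unfolding eq eval_fps_add[OF m[OF r(1)] m[OF r(2)]] using r by (simp add: eval_fps_mult)
  show "hyp_fun' \<nu> (\<lambda>k. a * e k + b * f k) y =
           a * hyp_fun' \<nu> e y + b * hyp_fun' \<nu> f y"
    unfolding eq fps_deriv_add fps_deriv_mult_const_left eval_fps_add[OF m[OF r'(1)] m[OF r'(2)]]
    using r' by (simp add: eval_fps_mult)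
qed

lemma eval_fps_nonneg_coeffs:
  assumes "ereal (norm y) < fps_conv_radius f" "\<And>k. fps_nth f k \<ge> (0::real)" "0 < y" "fps_nth f i > 0"
  shows "eval_fps f y > 0"
proof -
  have "summable (\<lambda>n. fps_nth f n * y ^ n)" using assms(1) by (rule summable_fps)
  thus ?thesis unfolding eval_fps_def using assms(2-4)
    by (intro suminf_pos2[where i = i]) auto
qed

lemma eval_hyp_series_pos:
  assumes \<nu>: "0 < \<nu>" and e: "convergent e" "\<And>k. e k \<ge> 0" "e i > 0" and y: "0 < y" "y < 4"
  shows "hyp_fun \<nu> e y > 0"
proof (rule eval_fps_nonneg_coeffs)
  have "ereal (norm y) < 4" using y by simp
  thus "ereal (norm y) < fps_conv_radius (hyp_series \<nu> e)"
    using conv_radius_hyp_series[OF \<nu> e(1)] by (rule less_le_trans)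
  show "fps_nth (hyp_series \<nu> e) k \<ge> 0" for k
    using e(2)[of k] hyp_coeff_pos[OF \<nu>, of k] by (simp add: hyp_series_def)
  show "fps_nth (hyp_series \<nu> e) i > 0"
    using e(3) hyp_coeff_pos[OF \<nu>, of i] by (simp add: hyp_series_def)
qed (use y in auto)

lemma eval_hyp_series_deriv_pos:
  assumes \<nu>: "0 < \<nu>" and e: "convergent e" "\<And>k. k > 0 \<Longrightarrow> e k \<ge> 0" "e 1 > 0" and y: "0 < y" "y < 4"
  shows "hyp_fun' \<nu> e y > 0"
proof (rule eval_fps_nonneg_coeffs)
  have "ereal (norm y) < 4" using y by simp
  thus "ereal (norm y) < fps_conv_radius (fps_deriv (hyp_series \<nu> e))"
    using conv_radius_hyp_series[OF \<nu> e(1)] fps_conv_radius_deriv by (metis less_le_trans)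
  show "fps_nth (fps_deriv (hyp_series \<nu> e)) k \<ge> 0" for k
    using e(2)[of "Suc k"] hyp_coeff_pos[OF \<nu>, of "Suc k"] by (simp add: hyp_series_def)
  show "fps_nth (fps_deriv (hyp_series \<nu> e)) 0 > 0"
    using e(3) hyp_coeff_pos[OF \<nu>, of 1] by (simp add: hyp_series_def)
qed (use y in auto)

lemma hyp_num_real_LIMSEQ: "hyp_num ((u::real)\<^sup>2) \<longlonglongrightarrow> cos (pi * u)"
proof -
  have "(\<lambda>k. Re (hyp_num ((of_real u)\<^sup>2) k)) \<longlonglongrightarrow> Re (cos (of_real pi * of_real u))"
    by (intro tendsto_Re hyp_num_LIMSEQ)
  thus ?thesis
    by (simp add: of_real_hyp_num[symmetric] flip: of_real_power of_real_mult cos_of_real)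
qed

text \<open>For w < 1/4 all factors of \<open>hyp_num w\<close> are positive, and so is their limit,
  which is the flux at 4. At w = 1/4 the limit is cos (pi / 2) = 0; this case is reached only by
  approximation.\<close>

lemma single_factor_alternates:
  assumes \<nu>: "0 < \<nu>" "\<nu> < 2" and w: "w < 1 / 4"
    and f: "sign_alternates (Suc n) (poly f)" "poly f 4 > 0"
  shows "sign_alternates (Suc n) (poly (jacobi_op \<nu> f - smult (w - 1 / 4) f))"
proof -
  define e where "e = hyp_num w"
  obtain l where l: "e \<longlonglongrightarrow> l" "l > 0"
  proof (cases "w \<ge> 0")
    case True
    have "e \<longlonglongrightarrow> cos (pi * sqrt w)"
      unfolding e_def using hyp_num_real_LIMSEQ[of "sqrt w"] True by simp
    moreover have "sqrt w < 1 / 2" using w True by (intro real_less_lsqrt) (auto simp: power2_eq_square)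
    hence "cos (pi * sqrt w) > 0" using True by (intro cos_gt_zero_pi) (auto intro: less_le_trans[of _ 0])
    ultimately show ?thesis using that by blast
  next
    case False
    have "(\<lambda>k. Re (hyp_num ((\<i> * of_real (sqrt (-w)))\<^sup>2) k)) \<longlonglongrightarrow> Re (cos (of_real pi * (\<i> * of_real (sqrt (-w)))))"
      by (intro tendsto_Re hyp_num_LIMSEQ)
    moreover have "(\<i> * complex_of_real (sqrt (-w)))\<^sup>2 = of_real w"
      using False by (simp add: power_mult_distrib flip: of_real_power)
    ultimately have lim: "e \<longlonglongrightarrow> Re (cos (of_real pi * (\<i> * of_real (sqrt (-w)))))"
      by (simp add: e_def of_real_hyp_num[symmetric])
    have "e k \<ge> 1" for k
      unfolding e_def hyp_num_def using False by (intro prod_ge_1) (auto simp: divide_nonpos_nonneg)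
    hence "Re (cos (of_real pi * (\<i> * of_real (sqrt (-w))))) \<ge> 1"
      by (intro LIMSEQ_le_const[OF lim]) auto
    thus ?thesis using that[OF lim] by linarith
  qed
  have conv: "convergent e" using l(1) by (rule convergentI)
  have pos: "e k > 0" for k
    unfolding e_def hyp_num_def
  proof (intro prod_pos)
    fix j
    have "w < (real j + 1 / 2)\<^sup>2" using w
      by (intro less_le_trans[OF w]) (simp add: power2_eq_square algebra_simps)
    thus "0 < 1 - w / (real j + 1 / 2)\<^sup>2" by (simp add: divide_less_eq)
  qed
  have "jacobi_image \<nu> (hyp_fun \<nu> e) (hyp_fun' \<nu> e)
      (hyp_fun \<nu> (\<lambda>k. (w - 1 / 4) * e k + 0 * e k))"
  proof (rule jacobi_image_hyp_series[OF \<nu>(1) conv])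
    fix k
    show "(w - 1 / 4) * e k + 0 * e k = real k * (real k + 1) * e k - (real k + 1 / 2)\<^sup>2 * e (Suc k)"
      unfolding e_def using hyp_num_Suc[of k w] by (simp add: algebra_simps power2_eq_square)
  qed
  hence img: "jacobi_image \<nu> (hyp_fun \<nu> e) (hyp_fun' \<nu> e)
      (\<lambda>y. (w - 1 / 4) * hyp_fun \<nu> e y)"
    unfolding jacobi_image_def using eval_hyp_series_linear(1)[OF \<nu>(1) conv conv, of _ "w - 1/4" 0] by simp
  show ?thesis
  proof (rule single_step_alternates[OF img \<nu>])
    show "hyp_fun \<nu> e y > 0" if "0 < y" "y < 4" for y
      using pos by (intro eval_hyp_series_pos[OF \<nu>(1) conv _ pos[of 0] that]) (auto intro: less_imp_le)
    show "flux_const \<nu> * l > 0" using flux_const_pos[OF \<nu>] l(2) by simp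
  qed (rule hyp_series_at_0[OF \<nu>(1) conv] hyp_series_at_4[OF \<nu> l(1)] f)+
qed

section \<open>Conjugate pairs of zeros\<close>

text \<open>The argument of the product lies strictly between -pi and 0. Every factor turns
  clockwise, and by monotonicity in \<sigma> the total turn is less than for \<sigma> = 1. There the
  points x_j - 1 and x_j + 1 lie on one lattice, the sum of the arguments telescopes, and at most pi
  is used up.\<close>

lemma hyp_num_tail_Im_neg:
  fixes \<sigma> \<tau> :: real
  assumes "0 < \<sigma>" "\<sigma> < 1" "0 < \<tau>" "k < m"
  shows "Im (\<Prod>j\<in>{k..<m}. 1 - (Complex \<sigma> \<tau>)\<^sup>2 / (of_nat j + 1 / 2)\<^sup>2) < 0"
proof -
  \<comment> \<open>pi / 2 - A t is the argument of t + i \<tau> in the upper half plane. Working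
    with the arctangent keeps the arguments additive, without a branch cut.\<close>
  define A where "A t = arctan (t / \<tau>)" for t
  have A_less: "A s < A t" if "s < t" for s t
    using that assms by (simp add: A_def arctan_monotone divide_strict_right_mono)
  have A_minus: "A (- t) = - A t" for t by (simp add: A_def arctan_minus)
  have A_bound: "A t < pi / 2" for t using arctan_bounded[of "t / \<tau>"] by (simp add: A_def)
  have polar: "\<exists>\<rho>>0. Complex t \<tau> = of_real \<rho> * cis (pi / 2 - A t)" for t
  proof -
    have s: "sqrt (1 + (t / \<tau>)\<^sup>2) > 0" by (simp add: add_pos_nonneg)
    have "cis (pi / 2 - A t) = Complex (t / \<tau> / sqrt (1 + (t / \<tau>)\<^sup>2)) (1 / sqrt (1 + (t / \<tau>)\<^sup>2))"
      by (simp add: complex_eq_iff A_def cos_diff sin_diff cos_arctan sin_arctan)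
    hence "Complex t \<tau> = of_real (\<tau> * sqrt (1 + (t / \<tau>)\<^sup>2)) * cis (pi / 2 - A t)"
      using s assms by (simp add: complex_eq_iff)
    moreover have "\<tau> * sqrt (1 + (t / \<tau>)\<^sup>2) > 0" using s assms by simp
    ultimately show ?thesis by blast
  qed
  define x where "x j = real j + 1 / 2" for j
  define \<theta> where "\<theta> j = A (x j - \<sigma>) - A (x j + \<sigma>)" for j
  have "\<exists>\<rho>>0. 1 - (Complex \<sigma> \<tau>)\<^sup>2 / (of_nat j + 1 / 2)\<^sup>2 = of_real \<rho> * cis (\<theta> j)" for j
  proof -
    have xj: "x j > 0" by (simp add: x_def add_nonneg_pos)
    have x: "(of_nat j + 1 / 2 :: complex) = of_real (x j)" by (simp add: x_def)
    obtain r s where r: "r > 0" "Complex (x j + \<sigma>) \<tau> = of_real r * cis (pi / 2 - A (x j + \<sigma>))"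
      and s: "s > 0" "Complex (x j - \<sigma>) \<tau> = of_real s * cis (pi / 2 - A (x j - \<sigma>))"
      using polar by meson
    have "1 - (Complex \<sigma> \<tau>)\<^sup>2 / (of_real (x j))\<^sup>2 = (of_real (x j) + Complex \<sigma> \<tau>) * (of_real (x j) - Complex \<sigma> \<tau>) / of_real ((x j)\<^sup>2)"
      using xj by (simp add: field_simps power2_eq_square)
    also have "of_real (x j) + Complex \<sigma> \<tau> = Complex (x j + \<sigma>) \<tau>" by (simp add: complex_eq_iff)
    also have "of_real (x j) - Complex \<sigma> \<tau> = cnj (Complex (x j - \<sigma>) \<tau>)" by (simp add: complex_eq_iff)
    also have "Complex (x j + \<sigma>) \<tau> * cnj (Complex (x j - \<sigma>) \<tau>) / of_real ((x j)\<^sup>2) =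
        of_real (r * s / (x j)\<^sup>2) * (cis (pi / 2 - A (x j + \<sigma>)) * cis (- (pi / 2 - A (x j - \<sigma>))))"
      unfolding r(2) s(2) by (simp add: cis_cnj)
    also have "cis (pi / 2 - A (x j + \<sigma>)) * cis (- (pi / 2 - A (x j - \<sigma>))) = cis (\<theta> j)"
      by (simp add: cis_mult \<theta>_def)
    finally show ?thesis unfolding x using r(1) s(1) xj by (intro exI[of _ "r * s / (x j)\<^sup>2"]) auto
  qed
  then obtain \<rho> where \<rho>: "\<And>j. \<rho> j > 0"
    "\<And>j. 1 - (Complex \<sigma> \<tau>)\<^sup>2 / (of_nat j + 1 / 2)\<^sup>2 = of_real (\<rho> j) * cis (\<theta> j)" by metis
  have cs: "(\<Prod>j\<in>S. cis (\<theta> j)) = cis (\<Sum>j\<in>S. \<theta> j)" if "finite S" for S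
    using that by (induction S rule: finite_induct) (auto simp: cis_mult)
  have "(\<Prod>j\<in>{k..<m}. 1 - (Complex \<sigma> \<tau>)\<^sup>2 / (of_nat j + 1 / 2)\<^sup>2) =
      of_real (\<Prod>j\<in>{k..<m}. \<rho> j) * cis (\<Sum>j\<in>{k..<m}. \<theta> j)"
    by (simp add: \<rho>(2) prod.distrib cs)
  hence Im: "Im (\<Prod>j\<in>{k..<m}. 1 - (Complex \<sigma> \<tau>)\<^sup>2 / (of_nat j + 1 / 2)\<^sup>2) =
      (\<Prod>j\<in>{k..<m}. \<rho> j) * sin (\<Sum>j\<in>{k..<m}. \<theta> j)"
    by (simp del: of_real_prod)
  have "(\<Sum>j\<in>{k..<m}. \<theta> j) < (\<Sum>j\<in>{k..<m}. 0)"
    using assms by (intro sum_strict_mono) (auto simp: \<theta>_def intro!: A_less)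
  moreover have "(\<Sum>j\<in>{k..<m}. \<theta> j) > - pi"
  proof -
    have tele: "(\<Sum>j\<in>{k..<m}. A (real j - 1/2) - A (real j + 3/2)) =
        A (real k - 1/2) + A (real k + 1/2) - A (real m - 1/2) - A (real m + 1/2)"
      using less_imp_le[OF assms(4)]
    proof (induction m rule: dec_induct)
      case (step n)
      thus ?case by (simp add: add.commute)
    qed simp
    \<comment> \<open>The two terms at the lower end add up to at least A (1/2) + A (-1/2) = 0, with
      equality for k = 0; each of the two terms at the upper end stays below pi / 2.\<close>
    have "A (real k + 1/2) \<ge> A (1/2)" using A_less[of "1/2" "real k + 1/2"] by (cases "k = 0") auto
    moreover have "A (real k - 1/2) \<ge> A (- (1/2))" using A_less[of "-(1/2)" "real k - 1/2"] by (cases "k = 0") auto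
    ultimately have "- pi < A (real k - 1/2) + A (real k + 1/2) - A (real m - 1/2) - A (real m + 1/2)"
      using A_bound[of "real m - 1/2"] A_bound[of "real m + 1/2"] A_minus[of "1/2"] by linarith
    also have "\<dots> = (\<Sum>j\<in>{k..<m}. A (real j - 1/2) - A (real j + 3/2))" using tele ..
    also have "\<dots> \<le> (\<Sum>j\<in>{k..<m}. \<theta> j)"
    proof (rule sum_mono)
      fix j
      have "A (real j - 1/2) < A (x j - \<sigma>)" "A (x j + \<sigma>) < A (real j + 3/2)"
        using assms by (auto simp: x_def intro!: A_less)
      thus "A (real j - 1/2) - A (real j + 3/2) \<le> \<theta> j" by (simp add: \<theta>_def)
    qed
    finally show ?thesis .
  qed
  ultimately have "sin (- (\<Sum>j\<in>{k..<m}. \<theta> j)) > 0" by (intro sin_gt_zero) auto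
  moreover have "(\<Prod>j\<in>{k..<m}. \<rho> j) > 0" using \<rho>(1) by (intro prod_pos) auto
  ultimately show ?thesis unfolding Im by (simp add: mult_pos_neg)
qed

text \<open>The common frame of both kinds of pairs: what remains for each is the nonnegativity of
  the numerators p and the positivity of the flux. The limit 0 of p is the vanishing flux of \<phi>
  at 4, and the limit 1 of s is the positive flux of \<psi>.\<close>

lemma pair_alternates:
  assumes \<nu>: "0 < \<nu>" "\<nu> < 2"
    and p: "p \<longlonglongrightarrow> 0" "\<And>k. p k \<ge> 0" "p 0 > 0"
    and s: "s \<longlonglongrightarrow> 1" "\<And>k. s k = real k * (real k + 1) * p k - (real k + 1 / 2)\<^sup>2 * p (Suc k)"
    and rec: "\<And>k. a * s k - m * p k = real k * (real k + 1) * s k - (real k + 1 / 2)\<^sup>2 * s (Suc k)"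
    and wronskian: "\<And>y. 0 < y \<Longrightarrow> y < 4 \<Longrightarrow>
       hyp_flux \<nu> s p y > 0"
    and bound: "c > 0" "eventually (\<lambda>y. hyp_flux \<nu> s p y \<ge> c) (at_left 4)"
    and f: "sign_alternates (Suc n) (poly f)" "poly f 4 > 0"
  shows "sign_alternates (Suc n)
           (poly (jacobi_op \<nu> (jacobi_op \<nu> f) - smult a (jacobi_op \<nu> f) + smult m f))"
proof -
  have conv: "convergent p" "convergent s" using p(1) s(1) by (auto intro: convergentI)
  have \<phi>: "jacobi_image \<nu> (hyp_fun \<nu> p) (hyp_fun' \<nu> p)
      (hyp_fun \<nu> s)"
    by (rule jacobi_image_hyp_series[OF \<nu>(1) conv(1) s(2)])
  have "jacobi_image \<nu> (hyp_fun \<nu> s) (hyp_fun' \<nu> s)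
      (hyp_fun \<nu> (\<lambda>k. a * s k + (- m) * p k))"
    by (rule jacobi_image_hyp_series[OF \<nu>(1) conv(2)]) (simp add: rec[symmetric])
  hence \<psi>: "jacobi_image \<nu> (hyp_fun \<nu> s) (hyp_fun' \<nu> s)
      (\<lambda>y. a * hyp_fun \<nu> s y - m * hyp_fun \<nu> p y)"
    unfolding jacobi_image_def using eval_hyp_series_linear(1)[OF \<nu>(1) conv(2,1), of _ a "-m"] by simp
  show ?thesis
  proof (rule pair_step_alternates[OF \<phi> \<psi> \<nu>])
    show "hyp_fun \<nu> p y > 0" if "0 < y" "y < 4" for y
      by (rule eval_hyp_series_pos[OF \<nu>(1) conv(1) p(2,3) that])
    show "hyp_fun' \<nu> s y * hyp_fun \<nu> p y -
        hyp_fun \<nu> s y * hyp_fun' \<nu> p y > 0" if "0 < y" "y < 4" for y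
      using wronskian[OF that] weight_pos[OF that, of \<nu>] by (simp add: flux_def zero_less_mult_iff)
    show "((\<lambda>y. weight \<nu> y * hyp_fun' \<nu> p y) \<longlongrightarrow> 0) (at_left 4)"
      using hyp_series_at_4(2)[OF \<nu> p(1)] by simp
    show "((\<lambda>y. weight \<nu> y * hyp_fun' \<nu> s y) \<longlongrightarrow> flux_const \<nu>) (at_left 4)"
      using hyp_series_at_4(2)[OF \<nu> s(1)] by simp
    show "\<forall>\<^sub>F y in at_left 4. c \<le> weight \<nu> y * (hyp_fun' \<nu> s y * hyp_fun \<nu> p y -
        hyp_fun \<nu> s y * hyp_fun' \<nu> p y)"
      using bound(2) by (simp add: flux_def)
  qed (rule hyp_series_at_0[OF \<nu>(1) conv(1)] hyp_series_at_0[OF \<nu>(1) conv(2)] p(3) f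
        hyp_series_at_4(1)[OF \<nu> p(1)] hyp_series_at_4(1)[OF \<nu> s(1)] bound(1) flux_const_pos[OF \<nu>])+
qed

lemma flux_tendsto_0_right:
  assumes \<nu>: "0 < \<nu>" and e: "convergent e" "convergent f"
  shows "(hyp_flux \<nu> e f \<longlongrightarrow> 0) (at_right 0)"
proof -
  have "(hyp_flux \<nu> e f \<longlongrightarrow>
       0 * (hyp_fun' \<nu> e 0 * f 0 - e 0 * hyp_fun' \<nu> f 0)) (at_right 0)"
    unfolding flux_def[abs_def]
    by (intro tendsto_intros weight_tendsto_0_right[OF \<nu>] hyp_series_at_0[OF \<nu> e(1)] hyp_series_at_0[OF \<nu> e(2)])
  thus ?thesis by simp
qed

lemma pos_if_deriv_pos:
  fixes g g' :: "real \<Rightarrow> real"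
  assumes der: "\<And>t. 0 < t \<Longrightarrow> t < y \<Longrightarrow> (g has_real_derivative g' t) (at t) \<and> g' t \<ge> 0"
    and strict: "\<And>t. 0 < t \<Longrightarrow> t < y \<Longrightarrow> g' t > 0" and cont: "isCont g y"
    and lim: "(g \<longlongrightarrow> 0) (at_right 0)" and y: "0 < y"
  shows "g y > 0"
proof -
  have mono: "g s < g t" if "0 < s" "s < t" "t \<le> y" for s t
  proof (rule DERIV_pos_imp_increasing_open[OF that(2)])
    show "\<exists>d. (g has_real_derivative d) (at x) \<and> 0 < d" if "s < x" "x < t" for x
      using der[of x] strict[of x] that \<open>0 < s\<close> \<open>t \<le> y\<close> by force
    show "continuous_on {s..t} g"
    proof (rule continuous_at_imp_continuous_on, rule ballI)
      fix x assume "x \<in> {s..t}"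
      thus "isCont g x" using der[of x] cont that DERIV_isCont[of g _ x] by (cases "x = y") auto
    qed
  qed
  have "0 \<le> g (y / 2)"
  proof (rule tendsto_upperbound[OF lim])
    have "eventually (\<lambda>t. t \<in> {0<..<y / 2}) (at_right 0)"
      using y by (intro eventually_at_right_real) simp
    thus "eventually (\<lambda>t. g t \<le> g (y / 2)) (at_right 0)"
      by eventually_elim (use mono y in \<open>force intro: less_imp_le\<close>)
  qed simp
  also have "\<dots> < g y" using mono[of "y / 2" y] y by simp
  finally show ?thesis .
qed

text \<open>At conjugate nodes the divided difference is the quotient of imaginary parts; p is that
  of the normalised numerators e, and s that of (w - 1/4) * e, the numerators of the image under the
  Jacobi operator. The flux increases because its derivative is a definite quadratic form in \<phi>
  and \<psi>.\<close>

lemma complex_pair_alternates: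
  fixes \<sigma> \<tau> :: real
  defines "w \<equiv> (Complex \<sigma> \<tau>)\<^sup>2"
  assumes \<nu>: "0 < \<nu>" "\<nu> < 2" and \<sigma>: "0 < \<sigma>" "\<sigma> < 1" and \<tau>: "0 < \<tau>"
    and f: "sign_alternates (Suc n) (poly f)" "poly f 4 > 0"
  shows "sign_alternates (Suc n) (poly (jacobi_op \<nu> (jacobi_op \<nu> f) -
           smult (2 * Re (w - 1 / 4)) (jacobi_op \<nu> f) + smult ((cmod (w - 1 / 4))\<^sup>2) f))"
proof -
  define u where "u = Complex \<sigma> \<tau>"
  define z where "z = cos (of_real pi * u)"
  have w: "w = u\<^sup>2" by (simp add: w_def u_def)
  have Imw: "Im w > 0" using \<sigma> \<tau> by (simp add: w u_def power2_eq_square)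
  have Imz: "Im z < 0"
  proof -
    have "Im z = sin (pi * \<sigma>) * (exp (- (pi * \<tau>)) - exp (pi * \<tau>)) / 2"
      by (simp add: z_def u_def Im_cos)
    moreover have "sin (pi * \<sigma>) > 0" using \<sigma> by (intro sin_gt_zero) auto
    moreover have "exp (- (pi * \<tau>)) < exp (pi * \<tau>)" using \<tau> by simp
    ultimately have "sin (pi * \<sigma>) * (exp (- (pi * \<tau>)) - exp (pi * \<tau>)) < 0"
      by (intro mult_pos_neg) auto
    thus ?thesis using \<open>Im z = _\<close> by linarith
  qed
  hence z0: "z \<noteq> 0" by auto
  have lim: "hyp_num w \<longlonglongrightarrow> z" unfolding w z_def by (rule hyp_num_LIMSEQ)
  define e where "e k = hyp_num w k / z" for k
  have elim: "e \<longlonglongrightarrow> 1" using tendsto_divide[OF lim tendsto_const z0] z0 by (simp add: e_def[abs_def])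
  have erec: "(w - 1 / 4) * e k = of_nat k * (of_nat k + 1) * e k - (of_nat k + 1 / 2)\<^sup>2 * e (Suc k)" for k
  proof -
    have "(of_nat k + 1 / 2)\<^sup>2 * e (Suc k) = ((of_nat k + 1 / 2)\<^sup>2 - w) * e k"
      using hyp_num_Suc[of k w] by (simp add: e_def)
    thus ?thesis by (simp add: algebra_simps power2_eq_square)
  qed
  have Imrec: "Im ((w - 1 / 4) * (c * e k)) = real k * (real k + 1) * Im (c * e k) - (real k + 1 / 2)\<^sup>2 * Im (c * e (Suc k))"
    for c k
  proof -
    have *: "(w - 1 / 4) * (c * e k) = of_real (real k * (real k + 1)) * (c * e k) - of_real ((real k + 1 / 2)\<^sup>2) * (c * e (Suc k))"
    proof -
      have "(w - 1 / 4) * (c * e k) = c * ((w - 1 / 4) * e k)" by (simp only: mult_ac)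
      thus ?thesis unfolding erec by (simp add: algebra_simps)
    qed
    have "Im (of_real x * a - of_real y * b) = x * Im a - y * Im b" for x y a b by simp
    thus ?thesis unfolding * .
  qed
  \<comment> \<open>Dividing by the limit z leaves the reciprocal of the infinite tail from k on.
    The finite tails have negative imaginary part, so their reciprocals have positive imaginary
    part.\<close>
  have e_nonneg: "Im (e k) \<ge> 0" for k
  proof -
    have nz: "hyp_num w m \<noteq> 0" for m
      unfolding hyp_num_def
    proof (subst prod_zero_iff; safe?)
      fix j assume "1 - w / (of_nat j + 1 / 2)\<^sup>2 = 0"
      hence "w = of_real ((real j + 1 / 2)\<^sup>2)" using of_nat_plus_half_nonzero[of j, where 'a=complex] by simp
      thus False using Imw by (simp only: Im_complex_of_real)
    qed
    have "(\<lambda>m. hyp_num w k / hyp_num w m) \<longlonglongrightarrow> hyp_num w k / z"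
      by (intro tendsto_intros lim z0)
    hence "(\<lambda>m. Im (hyp_num w k / hyp_num w m)) \<longlonglongrightarrow> Im (e k)"
      unfolding e_def by (rule tendsto_Im)
    moreover have "\<exists>N. \<forall>m\<ge>N. 0 \<le> Im (hyp_num w k / hyp_num w m)"
    proof (intro exI allI impI)
      fix m assume m: "m \<ge> Suc k"
      define T where "T = (\<Prod>j\<in>{k..<m}. 1 - w / (of_nat j + 1 / 2)\<^sup>2)"
      have "Im T < 0" unfolding T_def w_def using hyp_num_tail_Im_neg[OF \<sigma> \<tau>] m by simp
      moreover have "hyp_num w k / hyp_num w m = 1 / T"
        unfolding hyp_num_split[of k m w, OF Suc_leD[OF m]] T_def using nz[of k] by simp
      ultimately show "0 \<le> Im (hyp_num w k / hyp_num w m)" by (simp add: Im_divide divide_nonpos_nonneg)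
    qed
    ultimately show ?thesis by (rule LIMSEQ_le_const)
  qed
  define p where "p k = Im (e k) / Im w" for k
  define s where "s k = Im ((w - 1 / 4) * e k) / Im w" for k
  define a where "a = 2 * Re (w - 1 / 4)"
  define m where "m = (cmod (w - 1 / 4))\<^sup>2"
  have cm: "(cmod (w - 1 / 4))\<^sup>2 = (Re (w - 1 / 4))\<^sup>2 + (Im w)\<^sup>2" by (simp add: cmod_power2)
  have sq: "(w - 1 / 4) * (w - 1 / 4) = of_real a * (w - 1 / 4) - of_real m"
    unfolding a_def m_def cm by (simp add: complex_eq_iff power2_eq_square algebra_simps)
  have p: "p \<longlonglongrightarrow> 0"
    using tendsto_divide[OF tendsto_Im[OF elim] tendsto_const[of "Im w"]] Imw by (simp add: p_def[abs_def])
  have s: "s \<longlonglongrightarrow> 1"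
  proof -
    have "s \<longlonglongrightarrow> Im ((w - 1 / 4) * 1) / Im w"
      unfolding s_def[abs_def] by (intro tendsto_intros elim) (use Imw in auto)
    thus ?thesis using Imw by simp
  qed
  have conv: "convergent p" "convergent s" using p s by (auto intro: convergentI)
  define X where "X = hyp_flux \<nu> s p"
  have prec: "s k = real k * (real k + 1) * p k - (real k + 1 / 2)\<^sup>2 * p (Suc k)" for k
  proof -
    have "Im ((w - 1 / 4) * e k) = real k * (real k + 1) * Im (e k) - (real k + 1 / 2)\<^sup>2 * Im (e (Suc k))"
      using Imrec[of 1 k] by (simp only: mult_1)
    thus ?thesis by (simp only: s_def p_def times_divide_eq_right diff_divide_distrib)
  qed
  have srec: "a * s k - m * p k = real k * (real k + 1) * s k - (real k + 1 / 2)\<^sup>2 * s (Suc k)" for k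
  proof -
    have "Im ((w - 1 / 4) * ((w - 1 / 4) * e k)) = a * Im ((w - 1 / 4) * e k) - m * Im (e k)"
    proof -
      have "(w - 1 / 4) * ((w - 1 / 4) * e k) = of_real a * ((w - 1 / 4) * e k) - of_real m * e k"
        unfolding mult.assoc[symmetric] sq by (simp add: algebra_simps)
      also have "Im \<dots> = a * Im ((w - 1 / 4) * e k) - m * Im (e k)"
        by (simp only: minus_complex.simps Im_complex_of_real Re_complex_of_real times_complex.simps)
      finally show ?thesis .
    qed
    with Imrec[of "w - 1/4" k] show ?thesis
      by (simp only: s_def p_def times_divide_eq_right diff_divide_distrib[symmetric])
  qed
  have p0: "p 0 > 0"
  proof -
    have "Im (e 0) > 0" using Imz z0 by (simp add: e_def Im_divide divide_neg_pos cmod_power2[symmetric])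
    thus ?thesis using Imw by (simp add: p_def)
  qed
  have pnn: "p k \<ge> 0" for k using e_nonneg[of k] Imw by (simp add: p_def)
  have img: "jacobi_image \<nu> (hyp_fun \<nu> p) (hyp_fun' \<nu> p)
      (hyp_fun \<nu> s)"
    by (rule jacobi_image_hyp_series[OF \<nu>(1) conv(1) prec])
  have img': "jacobi_image \<nu> (hyp_fun \<nu> s) (hyp_fun' \<nu> s)
      (hyp_fun \<nu> (\<lambda>k. a * s k + (- m) * p k))"
    by (rule jacobi_image_hyp_series[OF \<nu>(1) conv(2)]) (simp add: srec[symmetric])
  define D where "D y = density \<nu> y * ((hyp_fun \<nu> s y)\<^sup>2
      - a * hyp_fun \<nu> s y * hyp_fun \<nu> p y + m * (hyp_fun \<nu> p y)\<^sup>2)" for y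
  have dX: "(X has_real_derivative D y) (at y)" if y: "0 < y" "y < 4" for y
    using has_derivative_flux[OF img' img y] unfolding X_def[symmetric] D_def
      eval_hyp_series_linear(1)[OF \<nu>(1) conv(2,1) y]
    by (rule DERIV_cong) (simp add: algebra_simps power2_eq_square)
  \<comment> \<open>The form has the roots w - 1/4 and its conjugate; they are not real, so
    completing the square leaves the positive term (Im w)^2 * \<phi>^2.\<close>
  have Dpos: "D y > 0" if y: "0 < y" "y < 4" for y
  proof -
    define \<phi> where "\<phi> = hyp_fun \<nu> p y"
    define \<psi> where "\<psi> = hyp_fun \<nu> s y"
    have \<phi>: "\<phi> > 0" unfolding \<phi>_def by (rule eval_hyp_series_pos[OF \<nu>(1) conv(1) pnn p0 y])
    have m: "m = (Re (w - 1 / 4))\<^sup>2 + (Im w)\<^sup>2" unfolding m_def by (rule cm)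
    have "\<psi>\<^sup>2 - a * \<psi> * \<phi> + m * \<phi>\<^sup>2 = (\<psi> - Re (w - 1 / 4) * \<phi>)\<^sup>2 + (Im w)\<^sup>2 * \<phi>\<^sup>2"
      unfolding m a_def by (simp add: power2_eq_square algebra_simps)
    also have "\<dots> > 0" using \<phi> Imw by (intro add_nonneg_pos mult_pos_pos zero_less_power) auto
    finally show ?thesis using density_pos[OF y, of \<nu>] by (simp add: D_def \<phi>_def \<psi>_def)
  qed
  have Xpos: "X y > 0" if y: "0 < y" "y < 4" for y
  proof (rule pos_if_deriv_pos[where g = X and g' = D and y = y])
    show "(X \<longlongrightarrow> 0) (at_right 0)" unfolding X_def by (rule flux_tendsto_0_right[OF \<nu>(1) conv(2,1)])
    show "isCont X y" using dX[OF y] by (rule DERIV_isCont)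
  qed (use dX Dpos y in \<open>auto intro: less_imp_le\<close>)
  show ?thesis unfolding a_def[symmetric] m_def[symmetric]
  proof (rule pair_alternates[OF \<nu> p pnn p0 s prec srec _ _ _ f])
    \<comment> \<open>Since X increases on the whole interval, its value at any interior point
      bounds it from below near 4.\<close>
    show "X 2 > 0" by (rule Xpos) auto
    have "eventually (\<lambda>y. y \<in> {2<..<4}) (at_left (4::real))" by (rule eventually_at_left_real) simp
    thus "\<forall>\<^sub>F y in at_left 4. X 2 \<le> hyp_flux \<nu> s p y"
      unfolding X_def[symmetric]
    proof eventually_elim
      case (elim y)
      have "X 2 < X y"
      proof (rule DERIV_pos_imp_increasing[where f = X])
        show "\<exists>d. (X has_real_derivative d) (at x) \<and> 0 < d" if "2 \<le> x" "x \<le> y" for x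
          by (rule exI[of _ "D x"]) (use that elim dX[of x] Dpos[of x] in auto)
      qed (use elim in auto)
      thus ?case by simp
    qed
  qed (use Xpos in \<open>simp add: X_def\<close>)
qed

section \<open>Pairs of real zeros\<close>

text \<open>For real nodes the quadratic form is indefinite: the derivative of the flux Y has the
  sign of E u1 * E u2. Both solutions increase from a negative value at 0, with E u2 below E u1, so
  their signs pass at most from both negative through mixed to both positive. Y grows in the first
  and last phase; in the mixed phase it is positive because both terms of the Wronskian have the
  right sign.\<close>

lemma real_pair_alternates:
  fixes u1 u2 :: real
  assumes \<nu>: "0 < \<nu>" "\<nu> < 2" and u: "1 / 2 < u2" "u2 < u1" "u1 < 1"
    and f: "sign_alternates (Suc n) (poly f)" "poly f 4 > 0"
  shows "sign_alternates (Suc n) (poly (jacobi_op \<nu> (jacobi_op \<nu> f) -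
           smult ((u1\<^sup>2 - 1 / 4) + (u2\<^sup>2 - 1 / 4)) (jacobi_op \<nu> f) +
           smult ((u1\<^sup>2 - 1 / 4) * (u2\<^sup>2 - 1 / 4)) f))"
proof -
  define z where "z u = cos (pi * u)" for u
  define e where "e u k = hyp_num (u\<^sup>2) k / z u" for u :: real and k
  define \<omega> where "\<omega> u = u\<^sup>2 - 1 / 4" for u :: real
  define E where "E u = hyp_fun \<nu> (e u)" for u
  define E' where "E' u = hyp_fun' \<nu> (e u)" for u
  have zneg: "z u < 0" if "1 / 2 < u" "u < 1" for u
  proof -
    have "cos (pi * u) < cos (pi * (1 / 2))"
      using that by (intro cos_monotone_0_pi) auto
    thus ?thesis by (simp add: z_def)
  qed
  have elim: "e u \<longlonglongrightarrow> 1" if "1 / 2 < u" "u < 1" for u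
    using tendsto_divide[OF hyp_num_real_LIMSEQ[of u] tendsto_const[of "z u"]] zneg[OF that]
    by (simp add: e_def[abs_def] z_def)
  have conv: "convergent (e u)" if "1 / 2 < u" "u < 1" for u
    using elim[OF that] by (rule convergentI)
  have erec: "\<omega> u * e u k = real k * (real k + 1) * e u k - (real k + 1 / 2)\<^sup>2 * e u (Suc k)" for u k
  proof -
    have "(real k + 1 / 2)\<^sup>2 * e u (Suc k) = ((real k + 1 / 2)\<^sup>2 - u\<^sup>2) * e u k"
      using hyp_num_Suc[of k "u\<^sup>2"] by (simp add: e_def)
    thus ?thesis by (simp add: \<omega>_def algebra_simps power2_eq_square)
  qed
  have sq_bounds: "1 / 4 < u\<^sup>2" "u\<^sup>2 < 1" if "1 / 2 < u" "u < 1" for u :: real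
    using power_strict_mono[of "1/2" u 2] power_strict_mono[of u 1 2] that by (auto simp: power2_eq_square)
  define tail where "tail u k m = (\<Prod>j\<in>{k..<m}. 1 - u\<^sup>2 / (real j + 1 / 2)\<^sup>2)" for u :: real and k m
  \<comment> \<open>For 1/2 < u < 1 the factor with j = 0 is the only negative one. Hence the
    numerators with k >= 1, being reciprocals of infinite tails, are positive, while that with k = 0
    is negative.\<close>
  have factor_pos: "1 - u\<^sup>2 / (real j + 1 / 2)\<^sup>2 > 0" if "1 / 2 < u" "u < 1" "j \<ge> 1" for u :: real and j
  proof -
    have "u\<^sup>2 < (real j + 1 / 2)\<^sup>2" using that by (intro power_strict_mono) auto
    thus ?thesis using that by simp
  qed
  have tail_pos: "tail u k m > 0" if "1 / 2 < u" "u < 1" "k \<ge> 1" for u :: real and k m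
    unfolding tail_def using that by (intro prod_pos factor_pos) auto
  have split: "hyp_num (u\<^sup>2) m = hyp_num (u\<^sup>2) k * tail u k m" if "k \<le> m" for u :: real and k m
    unfolding tail_def using hyp_num_split[OF that, of "u\<^sup>2"] by simp
  have nz: "hyp_num (u\<^sup>2) m \<noteq> 0" if "1 / 2 < u" "u < 1" for u :: real and m
  proof (cases "m = 0")
    case False
    have "hyp_num (u\<^sup>2) 1 = 1 - 4 * u\<^sup>2" by (simp add: hyp_num_def power2_eq_square)
    moreover have "hyp_num (u\<^sup>2) m = hyp_num (u\<^sup>2) 1 * tail u 1 m" using False by (intro split) simp
    ultimately show ?thesis using tail_pos[OF that, of 1 m] sq_bounds[OF that] by auto
  qed auto
  have elim_tail: "(\<lambda>m. 1 / tail u k m) \<longlonglongrightarrow> e u k" if "1 / 2 < u" "u < 1" for u k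
  proof -
    have "(\<lambda>m. hyp_num (u\<^sup>2) k / hyp_num (u\<^sup>2) m) \<longlonglongrightarrow> e u k"
      unfolding e_def z_def using zneg[OF that] by (intro tendsto_intros hyp_num_real_LIMSEQ) (simp add: z_def)
    moreover have "eventually (\<lambda>m. hyp_num (u\<^sup>2) k / hyp_num (u\<^sup>2) m = 1 / tail u k m) sequentially"
      using eventually_ge_at_top[of k]
    proof eventually_elim
      case (elim m)
      show ?case unfolding split[OF elim, of u] using nz[OF that, of k] by simp
    qed
    ultimately show ?thesis by (rule Lim_transform_eventually)
  qed
  have e_pos: "e u k > 0" if "1 / 2 < u" "u < 1" "k \<ge> 1" for u k
  proof -
    have "hyp_num (u\<^sup>2) 1 < 0"
      using sq_bounds[OF that(1,2)] by (simp add: hyp_num_def power2_eq_square)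
    hence "hyp_num (u\<^sup>2) k < 0" unfolding split[OF that(3), of u] using tail_pos[OF that(1,2), of 1 k]
      by (simp add: mult_neg_pos)
    thus ?thesis using zneg[OF that(1,2)] by (simp add: e_def divide_neg_neg)
  qed
  have e0: "e u 0 < 0" if "1 / 2 < u" "u < 1" for u
    using zneg[OF that] by (simp add: e_def)
  note b1 = less_trans[OF u(1,2)] u(3) and b2 = u(1) less_trans[OF u(2,3)]
  have z12: "z u1 < z u2" unfolding z_def using u by (intro cos_monotone_0_pi) auto
  have e_mono0: "e u2 0 < e u1 0"
    using z12 zneg[OF b1] zneg[OF b2] by (simp add: e_def divide_simps)
  \<comment> \<open>A larger u makes every tail factor smaller and the reciprocal larger. For k = 0
    the negative factor spoils this comparison, and the monotonicity of the cosine takes its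
    place.\<close>
  have e_mono: "e u2 k \<le> e u1 k" for k
  proof (cases "k = 0")
    case False
    show ?thesis
    proof (rule LIMSEQ_le[OF elim_tail[OF b2] elim_tail[OF b1]], intro exI allI impI)
      fix m
      have "tail u1 k m \<le> tail u2 k m"
        unfolding tail_def
      proof (intro prod_mono conjI)
        fix j assume j: "j \<in> {k..<m}"
        show "0 \<le> 1 - u1\<^sup>2 / (real j + 1 / 2)\<^sup>2"
          using factor_pos[OF b1, of j] j False by auto
        have "u2\<^sup>2 \<le> u1\<^sup>2" using u by (intro power_mono) auto
        thus "1 - u1\<^sup>2 / (real j + 1 / 2)\<^sup>2 \<le> 1 - u2\<^sup>2 / (real j + 1 / 2)\<^sup>2"
          by (simp add: divide_right_mono)
      qed
      thus "1 / tail u2 k m \<le> 1 / tail u1 k m"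
        using tail_pos[OF b1, of k m] tail_pos[OF b2, of k m] False by (intro divide_left_mono) auto
    qed
  qed (use e_mono0 in simp)
  define \<delta> where "\<delta> = u1\<^sup>2 - u2\<^sup>2"
  have \<delta>: "\<delta> > 0" using u power_strict_mono[of u2 u1 2] by (simp add: \<delta>_def)
  have \<omega>\<delta>: "\<omega> u1 - \<omega> u2 = \<delta>" by (simp add: \<omega>_def \<delta>_def)
  \<comment> \<open>Divided differences of e and of \<omega> * e. The common limit 1 of the
    numerators cancels in p and leaves 1 in s.\<close>
  define p where "p k = (1 / \<delta>) * e u1 k + (- 1 / \<delta>) * e u2 k" for k
  define s where "s k = (\<omega> u1 / \<delta>) * e u1 k + (- \<omega> u2 / \<delta>) * e u2 k" for k
  have p: "p \<longlonglongrightarrow> 0"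
  proof -
    have "p \<longlonglongrightarrow> (1 / \<delta>) * 1 + (- 1 / \<delta>) * 1"
      unfolding p_def[abs_def] by (intro tendsto_intros elim b1 b2)
    thus ?thesis by simp
  qed
  have s: "s \<longlonglongrightarrow> 1"
  proof -
    have "s \<longlonglongrightarrow> (\<omega> u1 / \<delta>) * 1 + (- \<omega> u2 / \<delta>) * 1"
      unfolding s_def[abs_def] by (intro tendsto_intros elim b1 b2)
    moreover have "(\<omega> u1 / \<delta>) * 1 + (- \<omega> u2 / \<delta>) * 1 = 1" using \<omega>\<delta> \<delta> by (simp add: field_simps)
    ultimately show ?thesis by simp
  qed
  have pnn: "p k \<ge> 0" for k
  proof -
    have "p k = (e u1 k - e u2 k) / \<delta>" by (simp add: p_def diff_divide_distrib)
    thus ?thesis using e_mono[of k] \<delta> by simp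
  qed
  have p0: "p 0 > 0"
  proof -
    have "p 0 = (e u1 0 - e u2 0) / \<delta>" by (simp add: p_def diff_divide_distrib)
    thus ?thesis using e_mono0 \<delta> by simp
  qed
  have lin: "a * (\<omega> u1 * e u1 k) + b * (\<omega> u2 * e u2 k) =
      real k * (real k + 1) * (a * e u1 k + b * e u2 k) - (real k + 1 / 2)\<^sup>2 * (a * e u1 (Suc k) + b * e u2 (Suc k))"
    for a b k unfolding erec by (simp add: algebra_simps)
  have prec: "s k = real k * (real k + 1) * p k - (real k + 1 / 2)\<^sup>2 * p (Suc k)" for k
    using lin[of "1 / \<delta>" k "- 1 / \<delta>"] by (simp add: s_def p_def)
  have srec: "(\<omega> u1 + \<omega> u2) * s k - (\<omega> u1 * \<omega> u2) * p k =
      real k * (real k + 1) * s k - (real k + 1 / 2)\<^sup>2 * s (Suc k)" for k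
  proof -
    have "(\<omega> u1 + \<omega> u2) * s k - (\<omega> u1 * \<omega> u2) * p k =
        (\<omega> u1 / \<delta>) * (\<omega> u1 * e u1 k) + (- \<omega> u2 / \<delta>) * (\<omega> u2 * e u2 k)"
      using \<delta> by (simp add: s_def p_def field_simps)
    thus ?thesis unfolding lin s_def .
  qed
  have img: "jacobi_image \<nu> (E u) (E' u) (\<lambda>y. \<omega> u * E u y)" if "1 / 2 < u" "u < 1" for u
  proof -
    have "jacobi_image \<nu> (E u) (E' u) (hyp_fun \<nu> (\<lambda>k. \<omega> u * e u k + 0 * e u k))"
      unfolding E_def E'_def by (rule jacobi_image_hyp_series[OF \<nu>(1) conv[OF that]]) (simp add: erec)
    thus ?thesis
      unfolding jacobi_image_def E_def
      using eval_hyp_series_linear(1)[OF \<nu>(1) conv[OF that] conv[OF that], of _ "\<omega> u" 0] by simp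
  qed
  have dE: "(E u has_real_derivative E' u y) (at y)" if "1 / 2 < u" "u < 1" "0 < y" "y < 4" for u y
    using img[OF that(1,2)] that(3,4) unfolding jacobi_image_def by blast
  have E'pos: "E' u y > 0" if "1 / 2 < u" "u < 1" "0 < y" "y < 4" for u y
    unfolding E'_def
    by (rule eval_hyp_series_deriv_pos[OF \<nu>(1) conv[OF that(1,2)] _ _ that(3,4)])
       (use e_pos[OF that(1,2)] in \<open>auto intro!: less_imp_le simp: Suc_le_eq\<close>)
  have E_mono: "E u x < E u y" if "1 / 2 < u" "u < 1" "0 < x" "x < y" "y < 4" for u x y
  proof (rule DERIV_pos_imp_increasing[OF that(4)])
    show "\<exists>d. (E u has_real_derivative d) (at t) \<and> 0 < d" if "x \<le> t" "t \<le> y" for t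
      by (rule exI[of _ "E' u t"]) (use that dE[of u t] E'pos[of u t] \<open>1 / 2 < u\<close> \<open>u < 1\<close> \<open>0 < x\<close> \<open>y < 4\<close> in auto)
  qed
  have E12: "E u2 y < E u1 y" if "0 < y" "y < 4" for y
  proof -
    have "hyp_fun \<nu> p y > 0"
      by (rule eval_hyp_series_pos[OF \<nu>(1) convergentI[OF p] pnn p0 that])
    also have "hyp_fun \<nu> p y = (E u1 y - E u2 y) / \<delta>"
      unfolding p_def eval_hyp_series_linear(1)[OF \<nu>(1) conv[OF b1] conv[OF b2] that] E_def
      by (simp add: diff_divide_distrib)
    finally show ?thesis using \<delta> by (simp add: zero_less_divide_iff)
  qed
  define Y where "Y = flux \<nu> (E u2) (E' u2) (E u1) (E' u1)"
  define D where "D y = \<delta> * density \<nu> y * (E u1 y * E u2 y)" for y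
  have dY: "(Y has_real_derivative D y) (at y)" if y: "0 < y" "y < 4" for y
    using has_derivative_flux[OF img[OF b2] img[OF b1] y] unfolding Y_def[symmetric]
  proof (rule DERIV_cong)
    show "- density \<nu> y * (E u1 y * (\<omega> u2 * E u2 y) - E u2 y * (\<omega> u1 * E u1 y)) = D y"
      unfolding D_def \<omega>\<delta>[symmetric] by (simp add: algebra_simps)
  qed
  have Dpos: "D y > 0" if y: "0 < y" "y < 4" and "E u1 y < 0 \<or> E u2 y > 0" for y
  proof -
    have "E u1 y * E u2 y > 0"
      using that(3) E12[OF y] by (auto intro: mult_neg_neg mult_pos_pos)
    thus ?thesis using \<delta> density_pos[OF y, of \<nu>] by (simp add: D_def)
  qed
  \<comment> \<open>The mixed phase: the term with E u2 <= 0 and the increasing E u1 can only add to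
    the flux.\<close>
  have Y_ge: "Y y \<ge> weight \<nu> y * E' u2 y * E u1 y" if y: "0 < y" "y < 4" and "E u2 y \<le> 0" for y
  proof -
    have "E u2 y * E' u1 y \<le> 0" using that E'pos[OF b1 y] by (simp add: mult_nonpos_nonneg)
    hence "weight \<nu> y * (E u2 y * E' u1 y) \<le> 0" using weight_pos[OF y, of \<nu>] by (simp add: mult_nonneg_nonpos)
    thus ?thesis by (simp add: Y_def flux_def algebra_simps)
  qed
  have Ypos1: "Y y > 0" if y: "0 < y" "y < 4" and "E u1 y \<le> 0" for y
  proof (rule pos_if_deriv_pos[where g = Y and g' = D and y = y])
    show "(Y \<longlongrightarrow> 0) (at_right 0)" unfolding Y_def E_def E'_def
      by (rule flux_tendsto_0_right[OF \<nu>(1) conv[OF b2] conv[OF b1]])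
    show "isCont Y y" using dY[OF y] by (rule DERIV_isCont)
    have *: "D t > 0" if "0 < t" "t < y" for t
      using that y E_mono[OF b1 that] \<open>E u1 y \<le> 0\<close> by (intro Dpos) auto
    show "D t > 0" if "0 < t" "t < y" for t using *[OF that] .
    show "(Y has_real_derivative D t) (at t) \<and> 0 \<le> D t" if "0 < t" "t < y" for t
      using *[OF that] dY[of t] that y by auto
  qed (rule y)
  have Ypos2: "Y y > 0" if y: "0 < y" "y < 4" and "E u2 y \<le> 0" for y
  proof (cases "E u1 y \<le> 0")
    case False
    hence "weight \<nu> y * E' u2 y * E u1 y > 0"
      using weight_pos[OF y, of \<nu>] E'pos[OF b2 y] by simp
    with Y_ge[OF that] show ?thesis by linarith
  qed (rule Ypos1[OF y])
  have Y_mono: "Y x < Y y" if "0 < x" "x < y" "y < 4" "\<And>t. x < t \<Longrightarrow> t < y \<Longrightarrow> D t > 0" for x y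
  proof (rule DERIV_pos_imp_increasing_open[OF that(2)])
    show "\<exists>d. (Y has_real_derivative d) (at t) \<and> 0 < d" if "x < t" "t < y" for t
      using dY[of t] \<open>\<And>t. x < t \<Longrightarrow> t < y \<Longrightarrow> D t > 0\<close>[OF that] that \<open>0 < x\<close> \<open>y < 4\<close> by force
    show "continuous_on {x..y} Y"
      by (rule continuous_at_imp_continuous_on, rule ballI, rule DERIV_isCont, rule dY) (use that in auto)
  qed
  \<comment> \<open>When E u2 is already positive, one goes back to its zero x, where the preceding
    case applies, and the flux grows from x on.\<close>
  have Ypos: "Y y > 0" if y: "0 < y" "y < 4" for y
  proof (cases "E u2 y \<le> 0")
    case False
    have lim: "(E u2 \<longlongrightarrow> e u2 0) (at_right 0)"
      unfolding E_def by (rule hyp_series_at_0(1)[OF \<nu>(1) conv[OF b2]])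
    have "eventually (\<lambda>t. E u2 t < 0) (at_right 0)"
      by (rule order_tendstoD(2)[OF lim e0[OF b2]])
    moreover have "eventually (\<lambda>t. t \<in> {0<..<y}) (at_right 0)"
      using y(1) by (rule eventually_at_right_real)
    ultimately have "eventually (\<lambda>t. E u2 t < 0 \<and> t \<in> {0<..<y}) (at_right 0)"
      by eventually_elim auto
    then obtain t0 where t0: "E u2 t0 < 0" "0 < t0" "t0 < y"
      using eventually_happens[of _ "at_right (0::real)"] trivial_limit_at_right_real by force
    have "\<exists>x\<ge>t0. x \<le> y \<and> E u2 x = 0"
    proof (rule IVT)
      show "\<forall>x. t0 \<le> x \<and> x \<le> y \<longrightarrow> isCont (E u2) x"
        using t0 y by (auto intro!: DERIV_isCont dE[OF b2])
    qed (use t0 False in auto)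
    then obtain x where x: "t0 \<le> x" "x \<le> y" "E u2 x = 0" by blast
    have xy: "x < y" using x False by (cases "x = y") auto
    have x0: "0 < x" using x t0 by simp
    have "Y x > 0" using x xy x0 y by (intro Ypos2) auto
    also have "Y x < Y y"
      using E_mono[OF b2 x0] x xy x0 y by (intro Y_mono Dpos) auto
    finally show ?thesis .
  qed (rule Ypos2[OF y])
  have Ybound: "\<exists>c>0. eventually (\<lambda>y. Y y \<ge> c) (at_left 4)"
  proof -
    have grow: ?thesis if y0: "0 < y0" "y0 < 4" and D: "\<And>t. y0 < t \<Longrightarrow> t < 4 \<Longrightarrow> D t > 0" for y0
    proof (intro exI conjI)
      show "Y y0 > 0" by (rule Ypos[OF y0])
      have "eventually (\<lambda>y. y \<in> {y0<..<4}) (at_left (4::real))" using y0(2) by (rule eventually_at_left_real)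
      thus "eventually (\<lambda>y. Y y \<ge> Y y0) (at_left 4)"
        by eventually_elim (use D y0 in \<open>force intro!: less_imp_le Y_mono\<close>)
    qed
    \<comment> \<open>Which phase is the last one before 4 is left open. In the first two cases Y
      still increases up to 4; in the third the flux of E u2 has a positive limit and E u1 is
      bounded away from 0.\<close>
    consider (pos) y0 where "0 < y0" "y0 < 4" "E u2 y0 > 0" | (neg) "\<And>t. 0 < t \<Longrightarrow> t < 4 \<Longrightarrow> E u1 t < 0"
      | (mixed) y0 where "0 < y0" "y0 < 4" "E u1 y0 \<ge> 0" "\<And>t. 0 < t \<Longrightarrow> t < 4 \<Longrightarrow> E u2 t \<le> 0"
      by (meson not_le)
    thus ?thesis
    proof cases
      case pos
      show ?thesis
      proof (rule grow[OF pos(1,2)], rule Dpos)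
        fix t assume t: "y0 < t" "t < 4"
        show "E u1 t < 0 \<or> E u2 t > 0" using E_mono[OF b2 pos(1) t] pos(3) by simp
      qed (use pos in auto)
    next
      case neg
      show ?thesis by (rule grow[of 2]) (use neg Dpos in auto)
    next
      case mixed
      define y1 where "y1 = (y0 + 4) / 2"
      have y1: "y0 < y1" "y1 < 4" "0 < y1" using mixed by (auto simp: y1_def)
      have Ey1: "E u1 y1 > 0" using E_mono[OF b1 mixed(1) y1(1,2)] mixed(3) by simp
      have "((\<lambda>y. weight \<nu> y * E' u2 y) \<longlongrightarrow> flux_const \<nu> * 1) (at_left 4)"
        unfolding E'_def by (rule hyp_series_at_4(2)[OF \<nu> elim[OF b2]])
      hence "eventually (\<lambda>y. weight \<nu> y * E' u2 y > flux_const \<nu> / 2) (at_left 4)"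
        using flux_const_pos[OF \<nu>] by (intro order_tendstoD(1)) auto
      moreover have "eventually (\<lambda>y. y \<in> {y1<..<4}) (at_left (4::real))" using y1(2) by (rule eventually_at_left_real)
      ultimately have "eventually (\<lambda>y. Y y \<ge> flux_const \<nu> / 2 * E u1 y1) (at_left 4)"
      proof eventually_elim
        case (elim y)
        have "E u1 y1 < E u1 y" using elim y1 by (intro E_mono[OF b1]) auto
        hence "flux_const \<nu> / 2 * E u1 y1 \<le> weight \<nu> y * E' u2 y * E u1 y"
          using elim Ey1 flux_const_pos[OF \<nu>] by (intro mult_mono) auto
        also have "\<dots> \<le> Y y" using elim y1 mixed(4) by (intro Y_ge) auto
        finally show ?case .
      qed
      thus ?thesis using Ey1 flux_const_pos[OF \<nu>] by (intro exI[of _ "flux_const \<nu> / 2 * E u1 y1"]) auto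
    qed
  qed
  have XY: "hyp_flux \<nu> s p y = Y y / \<delta>"
    if y: "0 < y" "y < 4" for y
  proof -
    \<comment> \<open>A change of basis multiplies a Wronskian by its determinant, here (o1 - o2) /
      d^2 = 1 / d up to orientation.\<close>
    have id: "(o1 / d * a' + - o2 / d * b') * (1 / d * a + - 1 / d * b) -
        (o1 / d * a + - o2 / d * b) * (1 / d * a' + - 1 / d * b') = (b' * a - b * a') / d"
      if "o1 - o2 = d" "d > 0" for o1 o2 d a a' b b' :: real
    proof -
      have "(o1 / d * a' + - o2 / d * b') * (1 / d * a + - 1 / d * b) -
        (o1 / d * a + - o2 / d * b) * (1 / d * a' + - 1 / d * b') = (o1 - o2) * (b' * a - b * a') / (d * d)"
        using that(2) by (simp add: field_simps)
      thus ?thesis using that by simp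
    qed
    show ?thesis
      unfolding flux_def p_def s_def eval_hyp_series_linear[OF \<nu>(1) conv[OF b1] conv[OF b2] y]
        E_def[symmetric] E'_def[symmetric] id[OF \<omega>\<delta> \<delta>] Y_def by simp
  qed
  obtain c where c: "c > 0" "eventually (\<lambda>y. Y y \<ge> c) (at_left 4)" using Ybound by blast
  show ?thesis unfolding \<omega>_def[symmetric]
  proof (rule pair_alternates[OF \<nu> p pnn p0 s prec srec _ _ _ f])
    show "c / \<delta> > 0" using c \<delta> by simp
    have "eventually (\<lambda>y. y \<in> {0<..<4}) (at_left (4::real))" by (rule eventually_at_left_real) simp
    with c(2) show "\<forall>\<^sub>F y in at_left 4. c / \<delta> \<le> hyp_flux \<nu> s p y"
      by eventually_elim (use \<delta> in \<open>auto simp: XY divide_right_mono\<close>)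
  qed (use Ypos \<delta> in \<open>simp add: XY\<close>)
qed

subsection \<open>Polynomials with at most one zero outside the interval\<close>

definition linear_factors :: "real multiset \<Rightarrow> real poly" where
  "linear_factors Y = (\<Prod>y\<in>#Y. [:- y, 1:])"

text \<open>An explicit factorization with a bound m independent of the degree, so that
  coefficientwise limits stay in the class even if the degree drops or the limit is 0. The free
  factor l holds the possible defect, or one further zero inside the interval.\<close>

definition one_defect_form :: "nat \<Rightarrow> real poly \<Rightarrow> bool" where
  "one_defect_form m f \<longleftrightarrow>
     (\<exists>l Y. degree l \<le> 1 \<and> set_mset Y \<subseteq> {0..4} \<and> size Y \<le> m \<and> f = l * linear_factors Y)"

lemma linear_factors_empty [simp]: "linear_factors {#} = 1"
  by (simp add: linear_factors_def)

lemma linear_factors_add [simp]: "linear_factors (add_mset y Y) = [:- y, 1:] * linear_factors Y"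
  by (simp add: linear_factors_def)

lemma linear_factors_nonzero [simp]: "linear_factors Y \<noteq> 0"
  unfolding linear_factors_def by (auto simp: prod_mset_zero_iff)

lemma degree_linear_factors [simp]: "degree (linear_factors Y) = size Y"
  by (induction Y) (simp_all add: degree_mult_eq del: mult_pCons_left)

lemma degree_one_defect_form: "one_defect_form m f \<Longrightarrow> degree f \<le> m + 1"
proof -
  assume "one_defect_form m f"
  then obtain l Y where "degree l \<le> 1" "size Y \<le> m" "f = l * linear_factors Y"
    unfolding one_defect_form_def by blast
  thus "degree f \<le> m + 1" using degree_mult_le[of l "linear_factors Y"] by simp
qed

lemma one_defect_form_0 [simp]: "one_defect_form m 0"
  unfolding one_defect_form_def by (intro exI[of _ 0] exI[of _ "{#}"]) auto

lemma one_defect_form_linear: "degree f \<le> 1 \<Longrightarrow> one_defect_form m f"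
  unfolding one_defect_form_def by (intro exI[of _ f] exI[of _ "{#}"]) auto

lemma one_defect_form_Suc:
  "one_defect_form (Suc m) f \<longleftrightarrow>
     degree f \<le> 1 \<or> (\<exists>y g. 0 \<le> y \<and> y \<le> 4 \<and> one_defect_form m g \<and> f = [:- y, 1:] * g)"
proof
  assume "one_defect_form (Suc m) f"
  then obtain l Y where lY: "degree l \<le> 1" "set_mset Y \<subseteq> {0..4}" "size Y \<le> Suc m" "f = l * linear_factors Y"
    unfolding one_defect_form_def by blast
  show "degree f \<le> 1 \<or> (\<exists>y g. 0 \<le> y \<and> y \<le> 4 \<and> one_defect_form m g \<and> f = [:- y, 1:] * g)"
  proof (cases Y)
    case empty thus ?thesis using lY by simp
  next
    case (add y Z)
    have "one_defect_form m (l * linear_factors Z)"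
      unfolding one_defect_form_def using lY add by (intro exI[of _ l] exI[of _ Z]) auto
    moreover have "f = [:- y, 1:] * (l * linear_factors Z)"
      using lY(4) add by (simp only: linear_factors_add mult.left_commute)
    ultimately show ?thesis using lY(2) add by auto
  qed
next
  assume "degree f \<le> 1 \<or> (\<exists>y g. 0 \<le> y \<and> y \<le> 4 \<and> one_defect_form m g \<and> f = [:- y, 1:] * g)"
  thus "one_defect_form (Suc m) f"
  proof
    assume "\<exists>y g. 0 \<le> y \<and> y \<le> 4 \<and> one_defect_form m g \<and> f = [:- y, 1:] * g"
    then obtain y l Y where *: "0 \<le> y" "y \<le> 4" "degree l \<le> 1" "set_mset Y \<subseteq> {0..4}" "size Y \<le> m"
      "f = [:- y, 1:] * (l * linear_factors Y)" unfolding one_defect_form_def by blast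
    have "f = l * linear_factors (add_mset y Y)"
      unfolding *(6) by (simp only: linear_factors_add mult.left_commute)
    thus ?thesis unfolding one_defect_form_def using * by (intro exI[of _ l] exI[of _ "add_mset y Y"]) auto
  qed (rule one_defect_form_linear)
qed

lemma one_defect_form_smult: "one_defect_form m f \<Longrightarrow> one_defect_form m (smult c f)"
  unfolding one_defect_form_def using degree_smult_le by (metis mult_smult_left order_trans)

lemma coeff_linear_mult: "coeff ([:- a, 1:] * p) i = (case i of 0 \<Rightarrow> 0 | Suc j \<Rightarrow> coeff p j) - a * coeff p i"
  for a :: "'a::comm_ring_1"
  by (simp add: coeff_pCons split: nat.split)

text \<open>By compactness of [0, 4] one zero of each member converges along a subsequence. The
  quotients then converge coefficientwise and the induction hypothesis applies to them. Members of
  degree at most 1 need not offer a zero to split off, hence the case distinction.\<close>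

lemma one_defect_form_closed:
  assumes "\<And>k. one_defect_form m (F k)" "\<And>i. (\<lambda>k. coeff (F k) i) \<longlonglongrightarrow> coeff f i"
  shows "one_defect_form m f"
  using assms
proof (induction m arbitrary: F f)
  case 0
  have "coeff f i = 0" if "i > 1" for i
  proof -
    have "coeff (F k) i = 0" for k using degree_one_defect_form[OF 0(1)[of k]] that by (intro coeff_eq_0) auto
    thus ?thesis using 0(2)[of i] LIMSEQ_unique[OF tendsto_const[of 0]] by simp
  qed
  hence "degree f \<le> 1" by (intro degree_le) auto
  thus ?case by (rule one_defect_form_linear)
next
  case (Suc m)
  show ?case
  proof (cases "\<exists>\<^sub>\<infinity>k. degree (F k) \<le> 1")
    case True
    have "infinite {k. degree (F k) \<le> 1}" using True by (simp add: INFM_iff_infinite)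
    from infinite_enumerate[OF this] obtain r :: "nat \<Rightarrow> nat" where r: "strict_mono r" "\<And>k. degree (F (r k)) \<le> 1"
      unfolding mem_Collect_eq by metis
    have "coeff f i = 0" if "i > 1" for i
    proof -
      have "(\<lambda>k. coeff (F (r k)) i) \<longlonglongrightarrow> coeff f i"
        using LIMSEQ_subseq_LIMSEQ[OF Suc.prems(2) r(1)] by (simp add: o_def)
      moreover have "coeff (F (r k)) i = 0" for k using r(2)[of k] that by (intro coeff_eq_0) auto
      ultimately show ?thesis using LIMSEQ_unique[OF tendsto_const[of 0]] by simp
    qed
    hence "degree f \<le> 1" by (intro degree_le) auto
    thus ?thesis by (rule one_defect_form_linear)
  next
    case False
    then obtain N where N: "\<And>k. k \<ge> N \<Longrightarrow> \<not> degree (F k) \<le> 1"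
      unfolding INFM_nat_le by blast
    have "\<forall>k. \<exists>y g. y \<in> {0..4} \<and> one_defect_form m g \<and> F (k + N) = [:- y, 1:] * g"
    proof
      fix k
      show "\<exists>y g. y \<in> {0..4} \<and> one_defect_form m g \<and> F (k + N) = [:- y, 1:] * g"
        using disjE[OF Suc.prems(1)[of "k + N", unfolded one_defect_form_Suc]] N[OF le_add2, of k]
        unfolding atLeastAtMost_iff conj_assoc by metis
    qed
    then obtain y G where yG: "\<And>k. y k \<in> {0..4}" "\<And>k. one_defect_form m (G k)"
      "\<And>k. F (k + N) = [:- y k, 1:] * G k" by metis
    obtain z r where r: "strict_mono r" "(y \<circ> r) \<longlonglongrightarrow> z" "z \<in> {0..4}"
      using compact_Icc[of "0::real" 4] yG(1) unfolding compact_def by meson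
    have F_lim: "(\<lambda>k. coeff (F (r k + N)) i) \<longlonglongrightarrow> coeff f i" for i
      using LIMSEQ_subseq_LIMSEQ[OF LIMSEQ_ignore_initial_segment[OF Suc.prems(2)[of i], of N] r(1)] by (simp add: o_def)
    have y_lim: "(\<lambda>k. y (r k)) \<longlonglongrightarrow> z" using r(2) by (simp add: o_def)
    \<comment> \<open>Synthetic division read from the top. Convergence of the coefficients descends
      from index m + 2, where all of them vanish.\<close>
    have Gc: "coeff (G k) i = coeff (F (k + N)) (Suc i) + y k * coeff (G k) (Suc i)" for k i
      unfolding yG(3) coeff_linear_mult by simp
    have deg: "coeff (G k) i = 0" if "i > m + 1" for k i
      using degree_one_defect_form[OF yG(2)[of k]] that by (intro coeff_eq_0) auto
    have "\<exists>L. (\<lambda>k. coeff (G (r k)) i) \<longlonglongrightarrow> L" for i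
    proof (cases "i \<le> m + 2")
      case True
      thus ?thesis
      proof (induction rule: inc_induct)
        case base show ?case using deg[of "m + 2"] by (intro exI[of _ 0]) simp
      next
        case (step i)
        then obtain L where L: "(\<lambda>k. coeff (G (r k)) (Suc i)) \<longlonglongrightarrow> L" by blast
        show ?case unfolding Gc[of _ i] by (rule exI, rule tendsto_add[OF F_lim tendsto_mult[OF y_lim L]])
      qed
    next
      case False
      thus ?thesis using deg[of i] by (intro exI[of _ 0]) simp
    qed
    then obtain L where L: "\<And>i. (\<lambda>k. coeff (G (r k)) i) \<longlonglongrightarrow> L i" by metis
    have L0: "L i = 0" if "i > m + 1" for i using L[of i] deg[OF that] LIMSEQ_unique[OF tendsto_const[of 0]] by simp
    define g where "g = (\<Sum>i\<le>m+1. monom (L i) i)"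
    have cg: "coeff g i = L i" for i
      using L0[of i] by (auto simp: g_def coeff_sum if_distrib[of "\<lambda>x. coeff x _"] sum.delta)
    have "one_defect_form m g" by (rule Suc.IH[of "G \<circ> r"]) (use yG(2) L cg in auto)
    moreover have "f = [:- z, 1:] * g"
    proof (rule poly_eqI)
      fix i
      have "(\<lambda>k. coeff (F (r k + N)) i) \<longlonglongrightarrow> coeff ([:- z, 1:] * g) i"
        unfolding yG(3) coeff_linear_mult cg by (cases i) (auto intro!: tendsto_eq_intros L y_lim)
      thus "coeff f i = coeff ([:- z, 1:] * g) i" using F_lim LIMSEQ_unique by blast
    qed
    ultimately show ?thesis unfolding one_defect_form_Suc using r(3) by auto
  qed
qed

lemma sign_alternates_mono:
  assumes "sign_alternates n g" "k \<le> n"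
  shows "sign_alternates k g"
proof -
  obtain a where "\<And>i. i \<le> n \<Longrightarrow> 0 < a i \<and> a i < 4 \<and> (-1) ^ i * g (a i) > 0"
     "\<And>i. i < n \<Longrightarrow> a (Suc i) < a i"
    using assms(1) unfolding sign_alternates_def by blast
  thus ?thesis unfolding sign_alternates_def using assms(2) by (intro exI[of _ a]) auto
qed

lemma factor_distinct_roots:
  fixes g :: "real poly"
  assumes "finite S" "\<And>x. x \<in> S \<Longrightarrow> poly g x = 0"
  shows "\<exists>h. g = h * linear_factors (mset_set S)"
  using assms
proof (induction S rule: finite_induct)
  case (insert x S)
  then obtain h where h: "g = h * linear_factors (mset_set S)" by auto
  have nz: "poly (linear_factors (mset_set S)) x \<noteq> 0"
    unfolding linear_factors_def using insert.hyps
    by (simp add: poly_prod_mset prod_mset_zero_iff image_iff)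
  have "poly h x = 0" using insert.prems[of x] nz unfolding h by simp
  then obtain h' where h': "h = [:- x, 1:] * h'" unfolding poly_eq_0_iff_dvd dvd_def by blast
  hence "g = h' * linear_factors (mset_set (insert x S))"
    unfolding h h' mset_set.insert[OF insert.hyps] by (simp only: linear_factors_add mult_ac)
  thus ?case ..
qed simp

text \<open>The n sign changes give n distinct zeros inside, which is all but one of the possible n
  + 1; the quotient is the free factor.\<close>

lemma one_defect_form_if_sign_alternates:
  assumes "sign_alternates n (poly g)" "degree g \<le> n + 1" "n \<le> m"
  shows "one_defect_form m g"
proof -
  obtain a where a: "\<And>i. i \<le> n \<Longrightarrow> 0 < a i \<and> a i < 4 \<and> (-1) ^ i * poly g (a i) > 0"
    and dec: "\<And>i. i < n \<Longrightarrow> a (Suc i) < a i"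
    using assms(1) unfolding sign_alternates_def by blast
  have "\<exists>x. a (Suc i) < x \<and> x < a i \<and> poly g x = 0" if "i < n" for i
  proof -
    have "(-1) ^ i * poly g (a i) > 0" "(-1) ^ Suc i * poly g (a (Suc i)) > 0"
      using a[of i] a[of "Suc i"] that by auto
    hence "0 < ((-1) ^ i * poly g (a i)) * ((-1) ^ Suc i * poly g (a (Suc i)))" by (rule mult_pos_pos)
    also have "\<dots> = - (poly g (a (Suc i)) * poly g (a i))"
      by (simp add: mult_ac flip: power_mult_distrib)
    finally show ?thesis using poly_IVT[OF dec[OF that], of g] by auto
  qed
  then obtain x where x: "\<And>i. i < n \<Longrightarrow> a (Suc i) < x i \<and> x i < a i \<and> poly g (x i) = 0" by metis
  have dec': "a j \<le> a i" if "i \<le> j" "j \<le> n" for i j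
    using that
  proof (induction j rule: dec_induct)
    case (step k)
    thus ?case using dec[of k] by simp
  qed simp
  have "x j < x i" if "i < j" "j < n" for i j
    using x[of i] x[of j] dec'[of "Suc i" j] that by force
  hence inj: "inj_on x {..<n}" by (intro linorder_inj_onI) (auto, metis less_irrefl)
  define S where "S = x ` {..<n}"
  have S: "finite S" "card S = n" using inj by (auto simp: S_def card_image)
  obtain h where h: "g = h * linear_factors (mset_set S)"
    using factor_distinct_roots[OF S(1), of g] x by (auto simp: S_def)
  have "degree h \<le> 1"
  proof (cases "h = 0")
    case False
    have "degree g = degree h + n" unfolding h using False S by (simp add: degree_mult_eq)
    thus ?thesis using assms(2) by simp
  qed simp
  moreover have "0 \<le> x i \<and> x i \<le> 4" if "i < n" for i
    using x[OF that] a[of i] a[of "Suc i"] that by simp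
  hence "S \<subseteq> {0..4}" by (auto simp: S_def)
  ultimately show ?thesis unfolding one_defect_form_def
    using S assms(3) h by (intro exI[of _ h] exI[of _ "mset_set S"]) auto
qed

section \<open>From sign changes to the class of polynomials with one defect\<close>

lemma tendsto_coeff_mult:
  fixes F :: "nat \<Rightarrow> real poly"
  assumes "\<And>i. (\<lambda>k. coeff (F k) i) \<longlonglongrightarrow> coeff f i" "\<And>i. (\<lambda>k. coeff (G k) i) \<longlonglongrightarrow> coeff g i"
  shows "(\<lambda>k. coeff (F k * G k) i) \<longlonglongrightarrow> coeff (f * g) i"
  unfolding coeff_mult by (intro tendsto_intros assms)

lemma tendsto_coeff_prod_linear:
  fixes Y :: "nat \<Rightarrow> nat \<Rightarrow> real"
  assumes "\<And>j. j < d \<Longrightarrow> (\<lambda>k. Y k j) \<longlonglongrightarrow> y j"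
  shows "(\<lambda>k. coeff (\<Prod>j<d. [:- Y k j, 1:]) i) \<longlonglongrightarrow> coeff (\<Prod>j<d. [:- y j, 1:]) i"
  using assms
proof (induction d arbitrary: i)
  case (Suc d)
  have "(\<lambda>k. coeff [:- Y k d, 1:] i) \<longlonglongrightarrow> coeff [:- y d, 1:] i" for i
    unfolding coeff_pCons using Suc.prems[of d] by (auto split: nat.split intro!: tendsto_intros)
  thus ?case unfolding prod.lessThan_Suc by (intro tendsto_coeff_mult Suc.IH Suc.prems) auto
qed simp

lemma sign_alternates_prod_linear:
  fixes l :: "real poly"
  assumes Y: "\<And>i. i < d \<Longrightarrow> 0 < Y i \<and> Y i < 4" "\<And>i j. i < j \<Longrightarrow> j < d \<Longrightarrow> Y i < Y j"
    and l: "\<And>x. 0 \<le> x \<Longrightarrow> x \<le> 4 \<Longrightarrow> poly l x > 0"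
  shows "sign_alternates d (poly (l * (\<Prod>i<d. [:- Y i, 1:])))"
    and "poly (l * (\<Prod>i<d. [:- Y i, 1:])) 4 > 0"
proof -
  have ev: "poly (l * (\<Prod>i<d. [:- Y i, 1:])) x = poly l x * (\<Prod>i<d. x - Y i)" for x
    by (simp add: poly_prod)
  show "poly (l * (\<Prod>i<d. [:- Y i, 1:])) 4 > 0"
    unfolding ev using Y(1) l by (intro mult_pos_pos prod_pos) auto
  \<comment> \<open>The zeros padded by the endpoints 0 and 4, which shifts the indices by one. The
    sample points are the midpoints of neighbours, read from right to left by the definition of
    a.\<close>
  define Z where "Z i = (if i = 0 then 0 else if i = d + 1 then 4 else Y (i - 1))" for i
  have Z: "Z i < Z j" if "i < j" "j \<le> d + 1" for i j
    using that Y(1)[of "i - 1"] Y(1)[of "j - 1"] Y(2)[of "i - 1" "j - 1"] by (auto simp: Z_def)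
  have Z0: "Z 0 = 0" "Z (d + 1) = 4" by (simp_all add: Z_def)
  define b where "b i = (Z i + Z (Suc i)) / 2" for i
  have b: "Z i < b i" "b i < Z (Suc i)" if "i \<le> d" for i
    using Z[of i "Suc i"] that by (auto simp: b_def)
  define a where "a j = b (d - j)" for j
  have "0 < a j \<and> a j < 4 \<and> (-1) ^ j * poly (l * (\<Prod>i<d. [:- Y i, 1:])) (a j) > 0" if j: "j \<le> d" for j
  proof (intro conjI)
    have "0 \<le> Z (d - j)" using Z[of 0 "d - j"] Z0 by (cases "d - j = 0") (auto intro!: less_imp_le)
    thus a0: "0 < a j" using b(1)[of "d - j"] by (simp add: a_def)
    have "Z (Suc (d - j)) \<le> 4" using Z[of "Suc (d - j)" "d + 1"] Z0 by (cases "Suc (d - j) = d + 1") auto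
    thus a4: "a j < 4" using b(2)[of "d - j"] by (simp add: a_def)
    have lo: "Y i < a j" if "i < d - j" for i
    proof -
      have "i < d" using that by simp
      hence "Y i = Z (Suc i)" by (simp add: Z_def)
      also have "\<dots> \<le> Z (d - j)" using Z[of "Suc i" "d - j"] that
        by (cases "Suc i = d - j") (auto intro!: less_imp_le)
      also have "\<dots> < a j" using b(1)[of "d - j"] by (simp add: a_def)
      finally show ?thesis .
    qed
    have hi: "a j < Y i" if "d - j \<le> i" "i < d" for i
    proof -
      have "a j < Z (Suc (d - j))" using b(2)[of "d - j"] by (simp add: a_def)
      also have "\<dots> \<le> Z (Suc i)" using Z[of "Suc (d - j)" "Suc i"] that by (cases "d - j = i") auto
      also have "\<dots> = Y i" using that by (simp add: Z_def)
      finally show ?thesis .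
    qed
    have "(\<Prod>i<d. a j - Y i) = (\<Prod>i<d - j. a j - Y i) * (\<Prod>i\<in>{d - j..<d}. a j - Y i)"
      by (simp add: lessThan_atLeast0 prod.atLeastLessThan_concat)
    also have "(\<Prod>i\<in>{d - j..<d}. a j - Y i) = (\<Prod>i\<in>{d - j..<d}. (-1) * (Y i - a j))" by simp
    also have "\<dots> = (-1) ^ j * (\<Prod>i\<in>{d - j..<d}. Y i - a j)"
      using j by (simp only: prod.distrib prod_constant card_atLeastLessThan) simp
    finally have "(-1) ^ j * poly (l * (\<Prod>i<d. [:- Y i, 1:])) (a j) =
        ((-1) ^ j * (-1) ^ j) * (poly l (a j) * (\<Prod>i<d - j. a j - Y i) * (\<Prod>i\<in>{d - j..<d}. Y i - a j))"
      unfolding ev by (simp only: mult_ac)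
    also have "(-1) ^ j * (-1) ^ j = (1::real)" by (simp flip: power_mult_distrib)
    finally have *: "(-1) ^ j * poly (l * (\<Prod>i<d. [:- Y i, 1:])) (a j) =
        1 * (poly l (a j) * (\<Prod>i<d - j. a j - Y i) * (\<Prod>i\<in>{d - j..<d}. Y i - a j))" .
    show "(-1) ^ j * poly (l * (\<Prod>i<d. [:- Y i, 1:])) (a j) > 0"
      unfolding * using lo hi l[of "a j"] a0 a4 by (intro mult_pos_pos prod_pos) auto
  qed
  moreover have "a (Suc j) < a j" if "j < d" for j
  proof -
    have "Suc (d - Suc j) = d - j" using that by simp
    thus ?thesis using b(2)[of "d - Suc j"] b(1)[of "d - j"] that by (simp add: a_def)
  qed
  ultimately show "sign_alternates d (poly (l * (\<Prod>i<d. [:- Y i, 1:])))"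
    unfolding sign_alternates_def by (intro exI[of _ a]) auto
qed

lemma linear_factors_sorted:
  "\<exists>y. linear_factors Y = (\<Prod>i<size Y. [:- y i, 1:]) \<and> (\<forall>i<size Y. y i \<in># Y) \<and>
       (\<forall>i j. i \<le> j \<longrightarrow> j < size Y \<longrightarrow> y i \<le> y j)"
proof -
  define ys where "ys = sorted_list_of_multiset Y"
  have ys: "mset ys = Y" "sorted ys" "length ys = size Y"
    by (simp_all add: ys_def size_mset[symmetric] del: size_mset)
  have "linear_factors Y = prod_list (map (\<lambda>y. [:- y, 1:]) ys)"
    unfolding linear_factors_def ys(1)[symmetric] by (simp add: prod_mset_prod_list flip: mset_map)
  also have "\<dots> = (\<Prod>i<size Y. [:- (ys ! i), 1:])"
    using ys(3) by (simp add: prod.list_conv_set_nth lessThan_atLeast0)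
  finally have "linear_factors Y = (\<Prod>i<size Y. [:- (ys ! i), 1:])" .
  moreover have "\<forall>i<size Y. ys ! i \<in># Y"
    using ys by (metis nth_mem set_mset_mset)
  moreover have "\<forall>i j. i \<le> j \<longrightarrow> j < size Y \<longrightarrow> ys ! i \<le> ys ! j"
    using ys sorted_nth_mono by metis
  ultimately show ?thesis by (intro exI[of _ "\<lambda>i. ys ! i"]) auto
qed

text \<open>Perturbing the zeros to be simple and interior makes the sign change count of the
  hypothesis applicable; the class of polynomials in one-defect form is closed.\<close>

lemma one_defect_form_preserved:
  fixes T :: "real poly \<Rightarrow> real poly"
  assumes alt: "\<And>n f. sign_alternates (Suc n) (poly f) \<Longrightarrow> poly f 4 > 0 \<Longrightarrow> sign_alternates (Suc n) (poly (T f))"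
    and neg: "\<And>f. T (- f) = - T f" and deg: "\<And>f. degree (T f) \<le> degree f"
    and cont: "\<And>F f i. (\<And>i. (\<lambda>k. coeff (F k) i) \<longlonglongrightarrow> coeff f i) \<Longrightarrow> (\<lambda>k. coeff (T (F k)) i) \<longlonglongrightarrow> coeff (T f) i"
    and f: "one_defect_form m f"
  shows "one_defect_form m (T f)"
proof (cases "f = 0")
  case True
  have "T 0 = 0" using neg[of 0] by simp
  thus ?thesis using True by simp
next
  case False
  \<comment> \<open>The multiset may have m + 1 entries here: if the free factor vanishes inside the
    interval, its zero is moved into Y and a constant remains. The bound on the total degree covers
    both cases.\<close>
  have main: "one_defect_form m (T f)"
    if l: "degree l \<le> 1" "\<And>x. 0 \<le> x \<Longrightarrow> x \<le> 4 \<Longrightarrow> poly l x > 0"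
      and Y: "set_mset Y \<subseteq> {0..4}" "size Y \<le> m + 1" "degree l + size Y \<le> m + 1"
      and f: "f = l * linear_factors Y" for l Y f
  proof -
    define d where "d = size Y"
    obtain y where y: "linear_factors Y = (\<Prod>i<d. [:- y i, 1:])" "\<And>i. i < d \<Longrightarrow> y i \<in># Y"
      "\<And>i j. i \<le> j \<Longrightarrow> j < d \<Longrightarrow> y i \<le> y j"
      using linear_factors_sorted[of Y] unfolding d_def by blast
    define \<epsilon> where "\<epsilon> k = 1 / (real k + 1)" for k
    have \<epsilon>: "0 < \<epsilon> k" "\<epsilon> k \<le> 1" for k by (auto simp: \<epsilon>_def)
    have \<epsilon>0: "\<epsilon> \<longlonglongrightarrow> 0" unfolding \<epsilon>_def[abs_def] by real_asymp
    \<comment> \<open>Equally spaced interior points. A convex combination with them separates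
      coinciding zeros and moves zeros off the endpoints.\<close>
    define c where "c i = 4 * (real i + 1) / (real d + 1)" for i
    have c: "0 < c i" "c i < 4" if "i < d" for i using that by (auto simp: c_def divide_less_eq)
    have c_mono: "c i < c j" if "i < j" for i j using that by (simp add: c_def divide_strict_right_mono)
    define Z where "Z k i = (1 - \<epsilon> k) * y i + \<epsilon> k * c i" for k i
    define F where "F k = l * (\<Prod>i<d. [:- Z k i, 1:])" for k
    have Z1: "0 < Z k i \<and> Z k i < 4" if "i < d" for k i
    proof -
      have yi: "0 \<le> y i" "y i \<le> 4" using y(2)[OF that] Y(1) by auto
      have "0 \<le> (1 - \<epsilon> k) * y i" "(1 - \<epsilon> k) * y i \<le> (1 - \<epsilon> k) * 4"
        using yi \<epsilon>[of k] by (intro mult_nonneg_nonneg mult_left_mono; simp)+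
      moreover have "0 < \<epsilon> k * c i" "\<epsilon> k * c i < \<epsilon> k * 4" using c[OF that] \<epsilon>[of k] by auto
      ultimately show ?thesis unfolding Z_def by argo
    qed
    have Z2: "Z k i < Z k j" if "i < j" "j < d" for k i j
      unfolding Z_def using y(3)[of i j] c_mono[of i j] \<epsilon>[of k] that
      by (intro add_le_less_mono mult_left_mono mult_strict_left_mono) auto
    have Flim: "(\<lambda>k. coeff (F k) i) \<longlonglongrightarrow> coeff f i" for i
      unfolding F_def f y(1)
    proof (intro tendsto_coeff_mult tendsto_coeff_prod_linear tendsto_const)
      fix j
      have "(\<lambda>k. Z k j) \<longlonglongrightarrow> (1 - 0) * y j + 0 * c j"
        unfolding Z_def by (intro tendsto_intros \<epsilon>0)
      thus "(\<lambda>k. Z k j) \<longlonglongrightarrow> y j" by simp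
    qed
    have "one_defect_form m (T (F k))" for k
    proof (cases d)
      \<comment> \<open>The sign change hypothesis starts at one sign change, so a polynomial
        without listed zeros is settled by its degree.\<close>
      case 0
      thus ?thesis using l(1) deg[of "F k"] by (intro one_defect_form_linear) (simp add: F_def)
    next
      case (Suc n)
      have "sign_alternates d (poly (F k))" "poly (F k) 4 > 0"
        unfolding F_def using sign_alternates_prod_linear[of d "Z k" l] Z1 Z2 l(2) by auto
      hence alt': "sign_alternates d (poly (T (F k)))" using alt unfolding Suc by blast
      have "degree (F k) \<le> degree l + d"
      proof -
        have "degree (\<Prod>i<d. [:- Z k i, 1:]) \<le> (\<Sum>i<d. degree [:- Z k i, 1:])"
          using degree_prod_sum_le[of "{..<d}" "\<lambda>i. [:- Z k i, 1:]"] by (simp add: o_def)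
        thus ?thesis unfolding F_def by (intro order_trans[OF degree_mult_le]) simp
      qed
      hence dT: "degree (T (F k)) \<le> degree l + d" using deg[of "F k"] by simp
      show ?thesis
      proof (rule one_defect_form_if_sign_alternates)
        \<comment> \<open>If d = m + 1, the factor l is constant, the degree is at most m + 1, and m
          sign changes are enough.\<close>
        show "sign_alternates (min d m) (poly (T (F k)))" by (rule sign_alternates_mono[OF alt']) simp
        show "degree (T (F k)) \<le> min d m + 1" using dT Y(2,3) l(1) unfolding d_def by auto
      qed simp
    qed
    thus ?thesis by (rule one_defect_form_closed) (rule cont, rule Flim)
  qed
  have main': "one_defect_form m (T f)"
    if l: "degree l \<le> 1" "\<And>x. 0 \<le> x \<Longrightarrow> x \<le> 4 \<Longrightarrow> poly l x \<noteq> 0"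
      and Y: "set_mset Y \<subseteq> {0..4}" "size Y \<le> m + 1" "degree l + size Y \<le> m + 1"
      and f: "f = l * linear_factors Y" for l Y
  proof (cases "poly l 4 > 0")
    case True
    have "poly l x > 0" if x: "0 \<le> x" "x \<le> 4" for x
    proof (rule ccontr)
      assume "\<not> poly l x > 0"
      hence "poly l x < 0" using l(2)[OF x] by simp
      moreover have "x < 4" using x \<open>\<not> poly l x > 0\<close> True by (cases "x = 4") auto
      ultimately obtain t where "x < t" "t < 4" "poly l t = 0" using poly_IVT_pos[of x 4 l] True by blast
      thus False using l(2)[of t] x by auto
    qed
    thus ?thesis using main[OF l(1) _ Y f] by blast
  next
    case False
    hence l4: "poly l 4 < 0" using l(2)[of 4] by simp
    have "poly (- l) x > 0" if x: "0 \<le> x" "x \<le> 4" for x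
    proof (rule ccontr)
      assume *: "\<not> poly (- l) x > 0"
      hence "poly l x > 0" using l(2)[OF x] by simp
      moreover have "x < 4" using x * l4 by (cases "x = 4") auto
      ultimately obtain t where "x < t" "t < 4" "poly l t = 0" using poly_IVT_neg[of x 4 l] l4 by blast
      thus False using l(2)[of t] x by auto
    qed
    hence "one_defect_form m (T (- f))" using l(1) Y f by (intro main[of "- l" Y]) auto
    hence "one_defect_form m (smult (-1) (T (- f)))" by (rule one_defect_form_smult)
    thus ?thesis by (simp add: neg)
  qed
  obtain l Y where lY: "degree l \<le> 1" "set_mset Y \<subseteq> {0..4}" "size Y \<le> m" "f = l * linear_factors Y"
    using f unfolding one_defect_form_def by blast
  show ?thesis
  proof (cases "\<exists>x. 0 \<le> x \<and> x \<le> 4 \<and> poly l x = 0")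
    case False
    thus ?thesis using lY by (intro main'[of l Y]) auto
  next
    case True
    then obtain x where x: "0 \<le> x" "x \<le> 4" "poly l x = 0" by blast
    then obtain c where c: "l = [:- x, 1:] * c" by (auto simp: poly_eq_0_iff_dvd dvd_def)
    have c0: "c \<noteq> 0" using False lY(4) c by auto
    hence "degree l = Suc (degree c)" unfolding c by (simp add: degree_mult_eq del: mult_pCons_left)
    hence dc: "degree c = 0" using lY(1) by simp
    have f': "f = c * linear_factors (add_mset x Y)"
      unfolding lY(4) c by (simp only: linear_factors_add mult_ac)
    show ?thesis
    proof (rule main'[OF _ _ _ _ _ f'])
      show "poly c t \<noteq> 0" for t using dc c0 by (elim degree_eq_zeroE) auto
    qed (use lY dc x in auto)
  qed
qed

lemma map_poly_of_real_mult:
  "map_poly (of_real :: real \<Rightarrow> 'a::real_field) (p * q) = map_poly of_real p * map_poly of_real q"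
  by (intro poly_eqI) (simp add: coeff_map_poly coeff_mult)

lemma one_defect_form_imp_one_defect:
  assumes "one_defect_form n f"
  shows "f \<in> one_defect (n + 1)"
proof (cases "f = 0")
  case False
  obtain l Y where lY: "degree l \<le> 1" "set_mset Y \<subseteq> {0..4}" "size Y \<le> n" "f = l * linear_factors Y"
    using assms unfolding one_defect_form_def by blast
  have l0: "l \<noteq> 0" using False lY by auto
  define c where "c p = size {# z \<in># proots (map_poly complex_of_real p). z \<notin> complex_of_real ` {0..4} #}" for p
  have nz: "map_poly complex_of_real p \<noteq> 0" if "p \<noteq> 0" for p
    using that by (metis map_poly_0 of_real_0 coeff_map_poly of_real_eq_0_iff poly_eq_iff coeff_0)
  have "c (l * linear_factors Y) = c l" using lY(2)
  proof (induction Y)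
    case (add y Y)
    have eq: "map_poly complex_of_real (l * linear_factors (add_mset y Y)) =
        [:- complex_of_real y, 1:] * map_poly complex_of_real (l * linear_factors Y)"
    proof -
      have "l * linear_factors (add_mset y Y) = [:- y, 1:] * (l * linear_factors Y)"
        by (simp only: linear_factors_add mult.left_commute)
      thus ?thesis by (simp only: map_poly_of_real_mult) (simp add: map_poly_pCons)
    qed
    have "proots (map_poly complex_of_real (l * linear_factors (add_mset y Y))) =
        add_mset (complex_of_real y) (proots (map_poly complex_of_real (l * linear_factors Y)))"
      unfolding eq using nz[of "l * linear_factors Y"] l0
      by (subst proots_mult) (simp_all del: mult_pCons_left)
    thus ?case using add by (simp add: c_def)
  qed simp
  also have "c l \<le> size (proots (map_poly complex_of_real l))"
    unfolding c_def by (intro size_mset_mono) simp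
  also have "\<dots> \<le> degree (map_poly complex_of_real l)" by (rule size_proots_le)
  also have "\<dots> = degree l" by (rule degree_map_poly) simp
  also have "\<dots> \<le> 1" by (rule lY(1))
  finally show ?thesis
    using degree_one_defect_form[OF assms] unfolding one_defect_def c_def lY(4) by auto
qed (simp add: one_defect_def)

subsection \<open>Factors of a multiplier\<close>

lemma jacobi_op_add: "jacobi_op \<nu> (p + q) = jacobi_op \<nu> p + jacobi_op \<nu> q"
  by (rule poly_eqI) (simp add: coeff_jacobi_op algebra_simps)

lemma jacobi_op_smult: "jacobi_op \<nu> (smult c p) = smult c (jacobi_op \<nu> p)"
  by (rule poly_eqI) (simp add: coeff_jacobi_op algebra_simps)

lemma degree_jacobi_op_le: "degree (jacobi_op \<nu> p) \<le> degree p"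
  by (rule degree_le) (simp add: coeff_jacobi_op coeff_eq_0)

lemma tendsto_coeff_jacobi_op:
  assumes "\<And>i. (\<lambda>k. coeff (F k) i) \<longlonglongrightarrow> coeff f i"
  shows "(\<lambda>k. coeff (jacobi_op \<nu> (F k)) i) \<longlonglongrightarrow> coeff (jacobi_op \<nu> f) i"
  unfolding coeff_jacobi_op by (intro tendsto_intros assms)

definition pair_op :: "real \<Rightarrow> real \<Rightarrow> real \<Rightarrow> real poly \<Rightarrow> real poly" where
  "pair_op \<nu> a m f = jacobi_op \<nu> (jacobi_op \<nu> f) - smult a (jacobi_op \<nu> f) + smult m f"

lemma tendsto_coeff_pair_op:
  assumes "a \<longlonglongrightarrow> a'" "m \<longlonglongrightarrow> m'" "\<And>i. (\<lambda>k. coeff (F k) i) \<longlonglongrightarrow> coeff f i"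
  shows "(\<lambda>k. coeff (pair_op \<nu> (a k) (m k) (F k)) i) \<longlonglongrightarrow> coeff (pair_op \<nu> a' m' f) i"
  unfolding pair_op_def coeff_add coeff_diff coeff_smult
  by (intro tendsto_intros tendsto_coeff_jacobi_op assms)

lemma one_defect_form_pair_op_aux:
  assumes "\<And>n f. sign_alternates (Suc n) (poly f) \<Longrightarrow> poly f 4 > 0 \<Longrightarrow> sign_alternates (Suc n) (poly (pair_op \<nu> a m f))"
    and "one_defect_form d f"
  shows "one_defect_form d (pair_op \<nu> a m f)"
proof (rule one_defect_form_preserved[OF assms(1) _ _ _ assms(2)])
  show "pair_op \<nu> a m (- f) = - pair_op \<nu> a m f" for f
    using jacobi_op_smult[of \<nu> "-1"] by (simp add: pair_op_def)
  show "degree (pair_op \<nu> a m f) \<le> degree f" for f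
    unfolding pair_op_def
    by (intro degree_add_le degree_diff_le order_trans[OF degree_smult_le] order_trans[OF degree_jacobi_op_le])
       (auto intro: degree_jacobi_op_le)
qed (auto intro: tendsto_coeff_pair_op[OF tendsto_const tendsto_const])

text \<open>Approaching w from below reaches the boundary case w = 1/4, where the flux at 4
  degenerates.\<close>

lemma one_defect_form_single_factor:
  assumes \<nu>: "0 < \<nu>" "\<nu> < 2" and w: "w \<le> 1 / 4" and f: "one_defect_form d f"
  shows "one_defect_form d (jacobi_op \<nu> f - smult (w - 1 / 4) f)"
proof -
  have strict: "one_defect_form d (jacobi_op \<nu> f - smult (w - 1 / 4) f)" if w: "w < 1 / 4" for w
  proof (rule one_defect_form_preserved[OF single_factor_alternates[OF \<nu> w] _ _ _ f])
    show "jacobi_op \<nu> (- f) - smult (w - 1 / 4) (- f) = - (jacobi_op \<nu> f - smult (w - 1 / 4) f)" for f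
      using jacobi_op_smult[of \<nu> "-1"] by simp
    show "degree (jacobi_op \<nu> f - smult (w - 1 / 4) f) \<le> degree f" for f
      by (intro degree_diff_le order_trans[OF degree_smult_le] degree_jacobi_op_le) auto
    show "(\<lambda>k. coeff (jacobi_op \<nu> (F k) - smult (w - 1 / 4) (F k)) i) \<longlonglongrightarrow>
        coeff (jacobi_op \<nu> f - smult (w - 1 / 4) f) i"
      if "\<And>i. (\<lambda>k. coeff (F k) i) \<longlonglongrightarrow> coeff f i" for F f i
      unfolding coeff_diff coeff_smult by (intro tendsto_intros tendsto_coeff_jacobi_op that)
  qed
  show ?thesis
  proof (rule one_defect_form_closed)
    show "one_defect_form d (jacobi_op \<nu> f - smult ((w - 1 / real (Suc k)) - 1 / 4) f)" for k
    proof (rule strict)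
      have "1 / real (Suc k) > 0" by simp
      thus "w - 1 / real (Suc k) < 1 / 4" using w by linarith
    qed
    have "(\<lambda>k. 1 / real (Suc k)) \<longlonglongrightarrow> 0" by real_asymp
    from tendsto_diff[OF tendsto_const this] have "(\<lambda>k. w - 1 / real (Suc k)) \<longlonglongrightarrow> w" by simp
    thus "(\<lambda>k. coeff (jacobi_op \<nu> f - smult ((w - 1 / real (Suc k)) - 1 / 4) f) i) \<longlonglongrightarrow>
       coeff (jacobi_op \<nu> f - smult (w - 1 / 4) f) i" for i
      unfolding coeff_diff coeff_smult by (intro tendsto_intros)
  qed
qed

text \<open>The operator depends on u^2 only up to conjugation, so u may be moved to the open first
  quadrant. Shrinking its real part slightly makes it less than 1 and covers the boundary of the
  strip.\<close>

lemma one_defect_form_complex_pair: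
  assumes \<nu>: "0 < \<nu>" "\<nu> < 2" and u: "\<bar>Re u\<bar> \<le> 1" "Re u \<noteq> 0" "Im u \<noteq> 0" and f: "one_defect_form d f"
  shows "one_defect_form d (pair_op \<nu> (2 * Re (u\<^sup>2 - 1 / 4)) ((cmod (u\<^sup>2 - 1 / 4))\<^sup>2) f)"
proof -
  define a where "a \<sigma> = 2 * Re ((Complex \<sigma> \<bar>Im u\<bar>)\<^sup>2 - 1 / 4)" for \<sigma>
  define m where "m \<sigma> = (cmod ((Complex \<sigma> \<bar>Im u\<bar>)\<^sup>2 - 1 / 4))\<^sup>2" for \<sigma>
  have strict: "one_defect_form d (pair_op \<nu> (a \<sigma>) (m \<sigma>) f)" if "0 < \<sigma>" "\<sigma> < 1" for \<sigma>
    using complex_pair_alternates[OF \<nu> that, of "\<bar>Im u\<bar>"] u(3)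
    by (intro one_defect_form_pair_op_aux f) (auto simp: pair_op_def a_def m_def)
  define s where "s k = \<bar>Re u\<bar> * (1 - 1 / (real k + 2))" for k
  have "s \<longlonglongrightarrow> \<bar>Re u\<bar> * 1" unfolding s_def[abs_def] by (intro tendsto_mult tendsto_const) real_asymp
  hence s: "s \<longlonglongrightarrow> \<bar>Re u\<bar>" by simp
  have "one_defect_form d (pair_op \<nu> (a \<bar>Re u\<bar>) (m \<bar>Re u\<bar>) f)"
  proof (rule one_defect_form_closed)
    show "one_defect_form d (pair_op \<nu> (a (s k)) (m (s k)) f)" for k
    proof (rule strict)
      show "0 < s k" using u by (simp add: s_def)
      have "s k < \<bar>Re u\<bar>" using u by (simp add: s_def mult_less_cancel_left2)
      thus "s k < 1" using u by linarith
    qed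
    have C: "(\<lambda>k. Complex (s k) \<bar>Im u\<bar>) \<longlonglongrightarrow> Complex \<bar>Re u\<bar> \<bar>Im u\<bar>"
      by (intro tendsto_Complex s tendsto_const)
    show "(\<lambda>k. coeff (pair_op \<nu> (a (s k)) (m (s k)) f) i) \<longlonglongrightarrow> coeff (pair_op \<nu> (a \<bar>Re u\<bar>) (m \<bar>Re u\<bar>) f) i" for i
      unfolding a_def m_def by (intro tendsto_coeff_pair_op tendsto_intros C)
  qed
  moreover have "a \<bar>Re u\<bar> = 2 * Re (u\<^sup>2 - 1 / 4)" by (simp add: a_def power2_eq_square)
  moreover have "m \<bar>Re u\<bar> = (cmod (u\<^sup>2 - 1 / 4))\<^sup>2"
  proof -
    have "(\<bar>Re u\<bar> * \<bar>Im u\<bar> + \<bar>Im u\<bar> * \<bar>Re u\<bar>)\<^sup>2 = (Re u * Im u + Im u * Re u)\<^sup>2"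
      by (metis abs_mult abs_mult_self_eq mult.commute mult_2 power2_abs power_mult_distrib)
    thus ?thesis unfolding m_def cmod_power2 by (simp add: power2_eq_square)
  qed
  ultimately show ?thesis by simp
qed

lemma one_defect_form_real_pair:
  assumes \<nu>: "0 < \<nu>" "\<nu> < 2" and w: "1 / 4 < w1" "w1 \<le> 1" "1 / 4 < w2" "w2 \<le> 1" and f: "one_defect_form d f"
  shows "one_defect_form d (pair_op \<nu> ((w1 - 1 / 4) + (w2 - 1 / 4)) ((w1 - 1 / 4) * (w2 - 1 / 4)) f)"
proof -
  have *: "one_defect_form d (pair_op \<nu> ((w1 - 1 / 4) + (w2 - 1 / 4)) ((w1 - 1 / 4) * (w2 - 1 / 4)) f)"
    if w: "1 / 4 < w2" "w2 \<le> w1" "w1 \<le> 1" for w1 w2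
  proof -
    define u1 where "u1 = sqrt w1"
    define u2 where "u2 = sqrt w2"
    have "1 / 2 < u2" unfolding u2_def using w by (intro real_less_rsqrt) (simp add: power2_eq_square)
    hence u: "1 / 2 < u2" "u2 \<le> u1" "u1 \<le> 1" "u1\<^sup>2 = w1" "u2\<^sup>2 = w2"
      using w by (auto simp: u1_def u2_def)
    define q where "q k = 1 - 1 / (real k + 2)" for k
    have q: "0 < q k" "q k < 1" for k by (auto simp: q_def)
    have qlim: "q \<longlonglongrightarrow> 1" unfolding q_def[abs_def] by real_asymp
    \<comment> \<open>Moving v1 with \<open>q k\<close> and v2 with its square keeps v2 < v1 even
      when the two roots coincide, and keeps both strictly between 1/2 and 1.\<close>
    define v1 where "v1 k = 1 / 2 + (u1 - 1 / 2) * q k" for k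
    define v2 where "v2 k = 1 / 2 + (u2 - 1 / 2) * (q k * q k)" for k
    have "v1 \<longlonglongrightarrow> 1 / 2 + (u1 - 1 / 2) * 1" "v2 \<longlonglongrightarrow> 1 / 2 + (u2 - 1 / 2) * (1 * 1)"
      unfolding v1_def[abs_def] v2_def[abs_def] by (intro tendsto_intros qlim)+
    hence vlim: "v1 \<longlonglongrightarrow> u1" "v2 \<longlonglongrightarrow> u2" by simp_all
    show ?thesis unfolding u(4,5)[symmetric]
    proof (rule one_defect_form_closed)
      fix k
      have "(u2 - 1 / 2) * (q k * q k) \<le> (u1 - 1 / 2) * (q k * q k)"
        using u q[of k] by (intro mult_right_mono) auto
      also have "q k * q k < q k * 1" using q[of k] by (intro mult_strict_left_mono) auto
      hence "(u1 - 1 / 2) * (q k * q k) < (u1 - 1 / 2) * q k" using u by (intro mult_strict_left_mono) auto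
      finally have "v2 k < v1 k" by (simp add: v1_def v2_def)
      moreover have "1 / 2 < v2 k" using u q[of k] by (simp add: v2_def)
      moreover have "v1 k < 1"
      proof -
        have "(u1 - 1 / 2) * q k < (u1 - 1 / 2) * 1" using u q[of k] by (intro mult_strict_left_mono) auto
        also have "(u1 - 1 / 2) * 1 \<le> 1 / 2" using u(3) by simp
        finally show ?thesis by (simp add: v1_def)
      qed
      ultimately show "one_defect_form d (pair_op \<nu> (((v1 k)\<^sup>2 - 1 / 4) + ((v2 k)\<^sup>2 - 1 / 4))
          (((v1 k)\<^sup>2 - 1 / 4) * ((v2 k)\<^sup>2 - 1 / 4)) f)"
        using real_pair_alternates[OF \<nu>, of "v2 k" "v1 k"]
        by (intro one_defect_form_pair_op_aux f) (auto simp: pair_op_def)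
    next
      show "(\<lambda>k. coeff (pair_op \<nu> (((v1 k)\<^sup>2 - 1 / 4) + ((v2 k)\<^sup>2 - 1 / 4))
          (((v1 k)\<^sup>2 - 1 / 4) * ((v2 k)\<^sup>2 - 1 / 4)) f) i) \<longlonglongrightarrow>
        coeff (pair_op \<nu> ((u1\<^sup>2 - 1 / 4) + (u2\<^sup>2 - 1 / 4)) ((u1\<^sup>2 - 1 / 4) * (u2\<^sup>2 - 1 / 4)) f) i" for i
        by (intro tendsto_coeff_pair_op tendsto_intros vlim)
    qed
  qed
  show ?thesis
  proof (cases "w2 \<le> w1")
    case False
    thus ?thesis using *[of w1 w2] w by (simp add: add.commute mult.commute)
  qed (use * w in auto)
qed

section \<open>Operators diagonal in the Jacobi polynomials\<close>

text \<open>An arbitrary sequence of eigenvalues is presented as a multiplier of a step function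
  with value \<open>c r\<close> at r + 1/2. Existence and uniqueness are thereby inherited from
  \<open>multiplier\<close>.\<close>

definition diag_op :: "real \<Rightarrow> (nat \<Rightarrow> real) \<Rightarrow> real poly \<Rightarrow> real poly" where
  "diag_op \<nu> c = multiplier (\<lambda>s. of_real (c (nat \<lfloor>Re s\<rfloor>))) \<nu>"

lemma floor_of_nat_half: "nat \<lfloor>Re (of_nat r + 1 / 2)\<rfloor> = r"
proof -
  have "\<lfloor>real r + 1 / 2\<rfloor> = int r" by (rule floor_unique) auto
  thus ?thesis by simp
qed

lemma is_multiplier_diag_op:
  "is_multiplier F \<nu> M \<longleftrightarrow>
     is_multiplier (\<lambda>s. of_real ((\<lambda>r. Re (F (of_nat r + 1 / 2))) (nat \<lfloor>Re s\<rfloor>))) \<nu> M"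
  unfolding is_multiplier_def floor_of_nat_half by simp

lemma multiplier_eq_diag_op: "multiplier F \<nu> = diag_op \<nu> (\<lambda>r. Re (F (of_nat r + 1 / 2)))"
proof -
  have "is_multiplier F \<nu> = is_multiplier (\<lambda>s. of_real ((\<lambda>r. Re (F (of_nat r + 1 / 2))) (nat \<lfloor>Re s\<rfloor>))) \<nu>"
    by (rule ext) (rule is_multiplier_diag_op)
  thus ?thesis unfolding diag_op_def multiplier_def by (rule arg_cong)
qed

lemma diag_op_linear:
  shows diag_op_add: "diag_op \<nu> c (p + q) = diag_op \<nu> c p + diag_op \<nu> c q"
    and diag_op_smult: "diag_op \<nu> c (smult a p) = smult a (diag_op \<nu> c p)"
    and diag_op_jacobi_poly: "diag_op \<nu> c (jacobi_poly \<nu> r) = smult (c r) (jacobi_poly \<nu> r)"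
  using is_multiplier_multiplier[of "\<lambda>s. of_real (c (nat \<lfloor>Re s\<rfloor>))" \<nu>]
  unfolding diag_op_def is_multiplier_def linear_smult_iff floor_of_nat_half by simp_all

lemma diag_op_unique:
  assumes "\<And>p q. M (p + q) = M p + M q" "\<And>a p. M (smult a p) = smult a (M p)"
    and "\<And>r. M (jacobi_poly \<nu> r) = smult (c r) (jacobi_poly \<nu> r)"
  shows "diag_op \<nu> c = M"
proof -
  have "is_multiplier (\<lambda>s. of_real (c (nat \<lfloor>Re s\<rfloor>))) \<nu> M"
    unfolding is_multiplier_def linear_smult_iff floor_of_nat_half using assms by simp
  thus ?thesis unfolding diag_op_def using is_multiplier_multiplier ex1_multiplier by blast
qed

lemma diag_op_mult: "diag_op \<nu> (\<lambda>r. a r * b r) p = diag_op \<nu> a (diag_op \<nu> b p)"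
proof -
  have "diag_op \<nu> (\<lambda>r. a r * b r) = (\<lambda>p. diag_op \<nu> a (diag_op \<nu> b p))"
    by (rule diag_op_unique) (simp_all add: diag_op_linear mult.commute)
  thus ?thesis by simp
qed

lemma diag_op_const: "diag_op \<nu> (\<lambda>_. a) p = smult a p"
proof -
  have "diag_op \<nu> (\<lambda>_. a) = smult a" by (rule diag_op_unique) (simp_all add: smult_add_right mult.commute)
  thus ?thesis by simp
qed

text \<open>The shift by 1/4 comes from r (r + 1) = (r + 1/2)^2 - 1/4.\<close>

lemma diag_op_linear_factor:
  "diag_op \<nu> (\<lambda>r. (real r + 1 / 2)\<^sup>2 - w) p = jacobi_op \<nu> p - smult (w - 1 / 4) p"
proof -
  have "diag_op \<nu> (\<lambda>r. (real r + 1 / 2)\<^sup>2 - w) = (\<lambda>p. jacobi_op \<nu> p - smult (w - 1 / 4) p)"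
  proof (rule diag_op_unique)
    fix r
    have "jacobi_op \<nu> (jacobi_poly \<nu> r) = smult (real r * (real r + 1)) (jacobi_poly \<nu> r)"
      using is_jacobi_poly_jacobi_poly[of \<nu> r] unfolding is_jacobi_poly_def by simp
    thus "jacobi_op \<nu> (jacobi_poly \<nu> r) - smult (w - 1 / 4) (jacobi_poly \<nu> r) =
        smult ((real r + 1 / 2)\<^sup>2 - w) (jacobi_poly \<nu> r)"
      by (simp add: power2_eq_square algebra_simps flip: smult_diff_left)
  qed (simp_all add: jacobi_op_add jacobi_op_smult smult_add_right smult_diff_right mult.commute)
  thus ?thesis by simp
qed

lemma diag_op_quadratic_factor:
  "diag_op \<nu> (\<lambda>r. ((real r + 1 / 2)\<^sup>2 - 1 / 4)\<^sup>2 - a * ((real r + 1 / 2)\<^sup>2 - 1 / 4) + m) p = pair_op \<nu> a m p"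
proof -
  have "diag_op \<nu> (\<lambda>r. ((real r + 1 / 2)\<^sup>2 - 1 / 4)\<^sup>2 - a * ((real r + 1 / 2)\<^sup>2 - 1 / 4) + m) = pair_op \<nu> a m"
  proof (rule diag_op_unique)
    fix r
    have J: "jacobi_op \<nu> (jacobi_poly \<nu> r) = smult ((real r + 1 / 2)\<^sup>2 - 1 / 4) (jacobi_poly \<nu> r)"
      using is_jacobi_poly_jacobi_poly[of \<nu> r] unfolding is_jacobi_poly_def
      by (simp add: power2_eq_square algebra_simps)
    show "pair_op \<nu> a m (jacobi_poly \<nu> r) =
        smult (((real r + 1 / 2)\<^sup>2 - 1 / 4)\<^sup>2 - a * ((real r + 1 / 2)\<^sup>2 - 1 / 4) + m) (jacobi_poly \<nu> r)"
      unfolding pair_op_def J jacobi_op_smult smult_smult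
      by (simp only: smult_diff_left smult_add_left power2_eq_square)
  qed (simp_all add: pair_op_def jacobi_op_add jacobi_op_smult smult_add_right smult_diff_right mult.commute)
  thus ?thesis by simp
qed

lemma jacobi_expansion: "\<exists>a. p = (\<Sum>r\<le>n. smult (a r) (jacobi_poly \<nu> r))" if "degree p \<le> n"
  using that
proof (induction n arbitrary: p)
  have P: "degree (jacobi_poly \<nu> r) = r" "coeff (jacobi_poly \<nu> r) r = 1" for r
    using is_jacobi_poly_jacobi_poly[of \<nu> r] unfolding is_jacobi_poly_def by auto
  {
    case 0
    have "jacobi_poly \<nu> 0 = 1" using P[of 0] by (metis degree_0_id of_nat_1 one_poly_eq_simps(1) coeff_pCons_0 degree_eq_zeroE)
    moreover have "p = smult (coeff p 0) 1" using 0 by (metis degree_eq_zeroE coeff_pCons_0 le_zero_eq smult_one)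
    ultimately show ?case by (intro exI[of _ "\<lambda>_. coeff p 0"]) simp
  next
    case (Suc n)
    define q where "q = p - smult (coeff p (Suc n)) (jacobi_poly \<nu> (Suc n))"
    have "degree q \<le> n"
    proof (rule degree_le, intro allI impI)
      fix i assume "n < i"
      thus "coeff q i = 0" using Suc.prems P[of "Suc n"] by (cases "i = Suc n") (auto simp: q_def coeff_eq_0)
    qed
    then obtain a where a: "q = (\<Sum>r\<le>n. smult (a r) (jacobi_poly \<nu> r))" using Suc.IH by blast
    have "p = q + smult (coeff p (Suc n)) (jacobi_poly \<nu> (Suc n))" by (simp add: q_def)
    also have "\<dots> = (\<Sum>r\<le>Suc n. smult ((a(Suc n := coeff p (Suc n))) r) (jacobi_poly \<nu> r))"
      unfolding a by simp
    finally show ?case by blast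
  }
qed

lemma diag_op_expansion:
  "diag_op \<nu> c (\<Sum>r\<le>n. smult (a r) (jacobi_poly \<nu> r)) = (\<Sum>r\<le>n. smult (a r * c r) (jacobi_poly \<nu> r))"
proof (induction n)
  case 0 show ?case by (simp add: diag_op_linear)
next
  case (Suc n) thus ?case by (simp add: diag_op_linear)
qed

text \<open>On a fixed polynomial only finitely many eigenvalues act, so F has to be approximated
  only pointwise, at the points r + 1/2.\<close>

lemma tendsto_coeff_diag_op:
  assumes "\<And>r. (\<lambda>k. c k r) \<longlonglongrightarrow> c' r"
  shows "(\<lambda>k. coeff (diag_op \<nu> (c k) p) i) \<longlonglongrightarrow> coeff (diag_op \<nu> c' p) i"
proof -
  obtain a where a: "p = (\<Sum>r\<le>degree p. smult (a r) (jacobi_poly \<nu> r))"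
    using jacobi_expansion[of p "degree p" \<nu>] by blast
  show ?thesis
    by (subst (1 2) a) (auto simp: diag_op_expansion coeff_sum intro!: tendsto_intros assms)
qed

lemma degree_diag_op_le: "degree (diag_op \<nu> c p) \<le> degree p"
proof -
  obtain a where a: "p = (\<Sum>r\<le>degree p. smult (a r) (jacobi_poly \<nu> r))"
    using jacobi_expansion[of p "degree p" \<nu>] by blast
  have "degree (\<Sum>r\<le>degree p. smult (a r * c r) (jacobi_poly \<nu> r)) \<le> degree p"
  proof (rule degree_sum_le)
    fix r assume "r \<in> {..degree p}"
    moreover have "degree (jacobi_poly \<nu> r) = r"
      using is_jacobi_poly_jacobi_poly[of \<nu> r] unfolding is_jacobi_poly_def by auto
    ultimately show "degree (smult (a r * c r) (jacobi_poly \<nu> r)) \<le> degree p"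
      using degree_smult_le[of "a r * c r" "jacobi_poly \<nu> r"] by simp
  qed simp
  thus ?thesis using diag_op_expansion[of \<nu> c a "degree p"] a by metis
qed

section \<open>Splitting a polynomial multiplier into factors\<close>

text \<open>The place of the zeros of G, where G(u^2) = F(u), when those of F lie in the strip: the
  closed region inside a parabola. Its real points are at most h^2.\<close>

definition parabola_region :: "real \<Rightarrow> complex set" where
  "parabola_region h = {u\<^sup>2 |u. \<bar>Re u\<bar> \<le> h}"

definition in_parabola :: "real \<Rightarrow> real poly \<Rightarrow> bool" where
  "in_parabola h g \<longleftrightarrow> g \<noteq> 0 \<and> (\<forall>z. poly (map_poly of_real g) z = 0 \<longrightarrow> z \<in> parabola_region h)"

lemma real_in_parabola:
  assumes "complex_of_real w \<in> parabola_region h"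
  shows "w \<le> h\<^sup>2"
proof -
  obtain u where u: "of_real w = u\<^sup>2" "\<bar>Re u\<bar> \<le> h" using assms unfolding parabola_region_def by auto
  have "w = Re (u\<^sup>2)" using u(1) by (metis Re_complex_of_real)
  also have "\<dots> \<le> (Re u)\<^sup>2" by (simp add: power2_eq_square)
  also have "\<dots> = \<bar>Re u\<bar>\<^sup>2" by simp
  also have "\<dots> \<le> h\<^sup>2" using u(2) by (intro power_mono) auto
  finally show ?thesis .
qed

definition poly_diag_op :: "real \<Rightarrow> real poly \<Rightarrow> real poly \<Rightarrow> real poly" where
  "poly_diag_op \<nu> g = diag_op \<nu> (\<lambda>r. poly g ((real r + 1 / 2)\<^sup>2))"

lemma poly_diag_op_mult: "poly_diag_op \<nu> (p * q) f = poly_diag_op \<nu> p (poly_diag_op \<nu> q f)"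
  unfolding poly_diag_op_def poly_mult by (rule diag_op_mult)

lemma poly_diag_op_linear_factor:
  "poly_diag_op \<nu> [:- w, 1:] f = jacobi_op \<nu> f - smult (w - 1 / 4) f"
  using diag_op_linear_factor[of \<nu> w f] by (simp add: poly_diag_op_def)

lemma poly_diag_op_real_pair:
  "poly_diag_op \<nu> ([:- w1, 1:] * [:- w2, 1:]) f =
     pair_op \<nu> ((w1 - 1 / 4) + (w2 - 1 / 4)) ((w1 - 1 / 4) * (w2 - 1 / 4)) f"
proof -
  have "poly ([:- w1, 1:] * [:- w2, 1:]) x = (x - 1 / 4)\<^sup>2 - ((w1 - 1 / 4) + (w2 - 1 / 4)) * (x - 1 / 4) +
      (w1 - 1 / 4) * (w2 - 1 / 4)" for x
    unfolding poly_mult by (simp add: algebra_simps power2_eq_square)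
  thus ?thesis unfolding poly_diag_op_def by (simp only: diag_op_quadratic_factor)
qed

lemma poly_diag_op_complex_pair:
  "poly_diag_op \<nu> [:(cmod z)\<^sup>2, - (2 * Re z), 1:] f =
     pair_op \<nu> (2 * Re (z - 1 / 4)) ((cmod (z - 1 / 4))\<^sup>2) f"
proof -
  have "poly [:(cmod z)\<^sup>2, - (2 * Re z), 1:] x = (x - 1 / 4)\<^sup>2 - (2 * Re (z - 1 / 4)) * (x - 1 / 4) +
      (cmod (z - 1 / 4))\<^sup>2" for x
    unfolding cmod_power2 by (simp add: algebra_simps power2_eq_square)
  thus ?thesis unfolding poly_diag_op_def by (simp only: diag_op_quadratic_factor)
qed

text \<open>The remainder is real, has degree at most 1 and vanishes at a nonreal point, so it is
  0.\<close>

lemma conj_pair_dvd: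
  fixes g :: "real poly"
  assumes "poly (map_poly of_real g) z = 0" "Im z \<noteq> 0"
  shows "[:(cmod z)\<^sup>2, - (2 * Re z), 1:] dvd g"
proof -
  define q where "q = [:(cmod z)\<^sup>2, - (2 * Re z), 1:]"
  define r where "r = g mod q"
  have q0: "poly (map_poly of_real q) z = 0"
    unfolding q_def cmod_power2 by (simp add: map_poly_pCons complex_eq_iff power2_eq_square algebra_simps)
  have "g = g div q * q + r" unfolding r_def by simp
  hence "poly (map_poly of_real (g div q * q + r)) z = 0" using assms(1) by simp
  moreover have "map_poly complex_of_real (a + b) = map_poly of_real a + map_poly of_real b" for a b
    by (rule poly_eqI) (simp add: coeff_map_poly)
  ultimately have r0: "poly (map_poly of_real r) z = 0"
    using q0 by (simp add: map_poly_of_real_mult)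
  have "degree r \<le> 1"
    using degree_mod_less[of q g] unfolding r_def by (auto simp: q_def)
  define a where "a = coeff r 1"
  define b where "b = coeff r 0"
  have r: "r = [:b, a:]"
    by (rule poly_eqI) (use \<open>degree r \<le> 1\<close> in \<open>auto simp: a_def b_def coeff_pCons coeff_eq_0 split: nat.split\<close>)
  have "of_real b + z * of_real a = 0" using r0 unfolding r by (simp add: map_poly_pCons split: if_splits)
  hence "Im z * a = 0" "b + Re z * a = 0" by (auto simp: complex_eq_iff)
  hence "r = 0" using assms(2) by (simp add: r)
  thus ?thesis unfolding q_def[symmetric] r_def by (simp add: mod_eq_0_iff_dvd)
qed

text \<open>The invariant of the induction: at most one real root above 1/4 is waiting for a
  partner. The next such root is paired with it, and all other factors join the part that preserves
  the class.\<close>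

lemma one_defect_form_poly_diag_op_aux:
  assumes \<nu>: "0 < \<nu>" "\<nu> < 2" and h: "0 \<le> h" "h \<le> 1"
  shows "in_parabola h g \<Longrightarrow>
     (\<forall>d f. one_defect_form d f \<longrightarrow> one_defect_form d (poly_diag_op \<nu> g f)) \<or>
     (\<exists>w g1. 1 / 4 < w \<and> w \<le> h\<^sup>2 \<and> g = [:- w, 1:] * g1 \<and>
        (\<forall>d f. one_defect_form d f \<longrightarrow> one_defect_form d (poly_diag_op \<nu> g1 f)))"
proof (induction "degree g" arbitrary: g rule: less_induct)
  case less
  have h2: "h\<^sup>2 \<le> 1" using h by (simp add: power_le_one)
  show ?case
  proof (cases "degree g = 0")
    case True
    then obtain c where "g = [:c:]" by (rule degree_eq_zeroE)
    thus ?thesis by (simp add: poly_diag_op_def diag_op_const one_defect_form_smult)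
  next
    case False
    have "degree (map_poly complex_of_real g) = degree g" by (rule degree_map_poly) simp
    hence "\<not> constant (poly (map_poly complex_of_real g))" using False by (simp add: constant_degree)
    then obtain z where z: "poly (map_poly complex_of_real g) z = 0"
      using fundamental_theorem_of_algebra by blast
    have zr: "z \<in> parabola_region h" using less.prems z unfolding in_parabola_def by blast
    have sub: "in_parabola h g1" if "g = q * g1" for q g1
      using less.prems that unfolding in_parabola_def by (auto simp: map_poly_of_real_mult)
    show ?thesis
    proof (cases "Im z = 0")
      case True
      define w where "w = Re z"
      have zw: "z = of_real w" using True by (simp add: w_def complex_eq_iff)
      have wh: "w \<le> h\<^sup>2" using zr unfolding zw by (rule real_in_parabola)
      have "of_real (poly g w) = poly (map_poly complex_of_real g) (of_real w)"
        by (induction g) (auto simp: map_poly_pCons)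
      hence "poly g w = 0" using z unfolding zw by simp
      then obtain g1 where g1: "g = [:- w, 1:] * g1" unfolding poly_eq_0_iff_dvd dvd_def by blast
      have par: "in_parabola h g1" by (rule sub[OF g1])
      have "degree g = degree [:- w, 1:] + degree g1"
        unfolding g1 using par by (intro degree_mult_eq) (auto simp: in_parabola_def)
      hence deg: "degree g1 < degree g" by simp
      note IH = less.hyps[OF deg par]
      show ?thesis
      proof (cases "w \<le> 1 / 4")
        case w: True
        have step: "one_defect_form d (poly_diag_op \<nu> ([:- w, 1:] * p) f)"
          if "\<forall>d f. one_defect_form d f \<longrightarrow> one_defect_form d (poly_diag_op \<nu> p f)" "one_defect_form d f" for p d f
          unfolding poly_diag_op_mult poly_diag_op_linear_factor
          using that by (intro one_defect_form_single_factor[OF \<nu> w]) blast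
        show ?thesis using IH
        proof (elim disjE exE conjE)
          assume "\<forall>d f. one_defect_form d f \<longrightarrow> one_defect_form d (poly_diag_op \<nu> g1 f)"
          thus ?thesis using step unfolding g1 by blast
        next
          fix v g2 assume v: "1 / 4 < v" "v \<le> h\<^sup>2" "g1 = [:- v, 1:] * g2"
            "\<forall>d f. one_defect_form d f \<longrightarrow> one_defect_form d (poly_diag_op \<nu> g2 f)"
          have "g = [:- v, 1:] * ([:- w, 1:] * g2)" unfolding g1 v(3) by (simp only: mult_ac)
          thus ?thesis using v step[OF v(4)] by blast
        qed
      next
        case w: False
        show ?thesis using IH
        proof (elim disjE exE conjE)
          assume "\<forall>d f. one_defect_form d f \<longrightarrow> one_defect_form d (poly_diag_op \<nu> g1 f)"
          thus ?thesis using w wh g1 by (metis not_le)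
        next
          fix v g2 assume v: "1 / 4 < v" "v \<le> h\<^sup>2" "g1 = [:- v, 1:] * g2"
            "\<forall>d f. one_defect_form d f \<longrightarrow> one_defect_form d (poly_diag_op \<nu> g2 f)"
          have "g = ([:- w, 1:] * [:- v, 1:]) * g2" unfolding g1 v(3) by (simp only: mult_ac)
          moreover have "one_defect_form d (poly_diag_op \<nu> (([:- w, 1:] * [:- v, 1:]) * g2) f)"
            if "one_defect_form d f" for d f
            unfolding poly_diag_op_mult[of \<nu> "[:- w, 1:] * [:- v, 1:]"] poly_diag_op_real_pair
            using v w wh h2 that by (intro one_defect_form_real_pair[OF \<nu>]) auto
          ultimately show ?thesis by blast
        qed
      qed
    next
      case False
      obtain u where u: "z = u\<^sup>2" "\<bar>Re u\<bar> \<le> h" using zr unfolding parabola_region_def by auto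
      have "Im z = 2 * (Re u * Im u)" unfolding u(1) by (simp add: power2_eq_square)
      hence u0: "Re u \<noteq> 0" "Im u \<noteq> 0" using False by auto
      define q where "q = [:(cmod z)\<^sup>2, - (2 * Re z), 1:]"
      obtain g1 where g1: "g = q * g1"
        using conj_pair_dvd[OF z False] unfolding q_def dvd_def by blast
      have par: "in_parabola h g1" by (rule sub[OF g1])
      have "degree g = degree q + degree g1"
        unfolding g1 using par by (intro degree_mult_eq) (auto simp: in_parabola_def q_def)
      hence deg: "degree g1 < degree g" by (simp add: q_def)
      note IH = less.hyps[OF deg par]
      have step: "one_defect_form d (poly_diag_op \<nu> (q * p) f)"
        if "\<forall>d f. one_defect_form d f \<longrightarrow> one_defect_form d (poly_diag_op \<nu> p f)" "one_defect_form d f" for p d f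
      proof -
        have "one_defect_form d (poly_diag_op \<nu> p f)" using that by blast
        from one_defect_form_complex_pair[OF \<nu> _ u0 this] u(2) h(2)
        show ?thesis unfolding poly_diag_op_mult q_def poly_diag_op_complex_pair u(1) by simp
      qed
      show ?thesis using IH
      proof (elim disjE exE conjE)
        assume "\<forall>d f. one_defect_form d f \<longrightarrow> one_defect_form d (poly_diag_op \<nu> g1 f)"
        thus ?thesis using step unfolding g1 by blast
      next
        fix v g2 assume v: "1 / 4 < v" "v \<le> h\<^sup>2" "g1 = [:- v, 1:] * g2"
          "\<forall>d f. one_defect_form d f \<longrightarrow> one_defect_form d (poly_diag_op \<nu> g2 f)"
        have "g = [:- v, 1:] * (q * g2)" unfolding g1 v(3) by (simp only: mult_ac)
        thus ?thesis using v step[OF v(4)] by blast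
      qed
    qed
  qed
qed

section \<open>The unpaired factor acting on the pencil\<close>

definition pencil :: "nat \<Rightarrow> real \<Rightarrow> real poly" where
  "pencil n t = [:0, 1:] ^ n * [:t, 1:]"

text \<open>The Jacobi operator maps a monomial to a combination of itself and its predecessor, so
  two neighbouring monomials yield three.\<close>

lemma pencil_step:
  fixes n :: nat and a t \<nu> :: real
  assumes "n \<ge> 1"
  defines "A \<equiv> real n * (real n + 1) + a" and "B \<equiv> 4 * (real n + 1) * (real n + \<nu>)"
    and "C \<equiv> (real n + 1) * (real n + 2) + a" and "D \<equiv> 4 * real n * (real n - 1 + \<nu>)"
  shows "jacobi_op \<nu> (pencil n t) + smult a (pencil n t) = [:0, 1:] ^ (n - 1) * [:- (D * t), t * A - B, C:]"
proof (rule poly_eqI)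
  fix k
  obtain m where m: "n = Suc m" using assms(1) by (cases n) auto
  have X: "[:0, 1:] ^ i * p = monom 1 i * p" for i and p :: "real poly" by (simp add: monom_altdef)
  show "coeff (jacobi_op \<nu> (pencil n t) + smult a (pencil n t)) k =
      coeff ([:0, 1:] ^ (n - 1) * [:- (D * t), t * A - B, C:]) k"
    unfolding pencil_def coeff_add coeff_smult coeff_jacobi_op X coeff_monom_mult
    by (cases "k < m"; cases "k = m"; cases "k = Suc m"; cases "k = Suc (Suc m)")
       (auto simp: m A_def B_def C_def D_def coeff_pCons algebra_simps split: nat.splits)
qed

text \<open>The origin of \<open>e_const\<close>: A * B - C * D changes sign at a =
  -\<open>e_const n \<nu>\<close>. This difference decides both whether the quadratic has a zero in
  [0, 4] for every t and whether its discriminant can become negative.\<close>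

lemma pencil_coefficients:
  fixes n :: nat and a \<nu> :: real
  assumes \<nu>: "0 < \<nu>" "\<nu> < 2" and n: "n \<ge> 1" and a: "a > - 1"
  defines "A \<equiv> real n * (real n + 1) + a" and "B \<equiv> 4 * (real n + 1) * (real n + \<nu>)"
    and "C \<equiv> (real n + 1) * (real n + 2) + a" and "D \<equiv> 4 * real n * (real n - 1 + \<nu>)"
  shows "A > 0" "C > 0" "D > 0" "2 * real n + \<nu> > 0"
    and "A * B - C * D = 4 * ((a + e_const n \<nu>) * (2 * real n + \<nu>))"
proof -
  have n1: "real n \<ge> 1" using n by simp
  have "real n * (real n + 1) \<ge> 2"
    using mult_mono[of 1 "real n" 2 "real n + 1"] n1 by simp
  thus A: "A > 0" using a by (simp add: A_def)
  have "C = A + 2 * (real n + 1)" by (simp add: A_def C_def algebra_simps)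
  thus "C > 0" using A by simp
  show "D > 0" unfolding D_def using n1 \<nu> by (intro mult_pos_pos) auto
  show den: "2 * real n + \<nu> > 0" using n1 \<nu> by simp
  have e: "e_const n \<nu> * (2 * real n + \<nu>) = real n * (real n + 1) * (2 - \<nu>)"
    using den by (simp add: e_const_def)
  have "A * B - C * D = 4 * (a * (2 * real n + \<nu>) + real n * (real n + 1) * (2 - \<nu>))"
    unfolding A_def B_def C_def D_def by (simp add: algebra_simps)
  thus "A * B - C * D = 4 * ((a + e_const n \<nu>) * (2 * real n + \<nu>))"
    unfolding e[symmetric] by (simp add: algebra_simps)
qed

lemma first_step_one_defect_form:
  assumes \<nu>: "0 < \<nu>" "\<nu> < 2" and n: "n \<ge> 1" and a: "a \<ge> - 3 / 4" "a \<ge> - e_const n \<nu>"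
  shows "one_defect_form n (jacobi_op \<nu> (pencil n t) + smult a (pencil n t))"
proof -
  define A where "A = real n * (real n + 1) + a"
  define B where "B = 4 * (real n + 1) * (real n + \<nu>)"
  define C where "C = (real n + 1) * (real n + 2) + a"
  define D where "D = 4 * real n * (real n - 1 + \<nu>)"
  define Q where "Q = [:- (D * t), t * A - B, C:]"
  have n1: "real n \<ge> 1" using n by simp
  have "a > - 1" using a(1) by simp
  note coeffs = pencil_coefficients[OF \<nu> n this, folded A_def B_def C_def D_def]
  note A = coeffs(1) and D = coeffs(3) and den = coeffs(4)
  have "(a + e_const n \<nu>) * (2 * real n + \<nu>) \<ge> 0" using a(2) den by simp
  hence AB: "C * D \<le> A * B" using coeffs(5) by linarith
  have e: "e_const n \<nu> * (2 * real n + \<nu>) = real n * (real n + 1) * (2 - \<nu>)"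
    using den by (simp add: e_const_def)
  \<comment> \<open>This bound places y0 in the interval and makes the value at 4 nonnegative for t
    > 0.\<close>
  have e_le: "e_const n \<nu> \<le> real n * (2 - \<nu>)"
  proof -
    have "e_const n \<nu> * (2 * real n + \<nu>) \<le> real n * (2 - \<nu>) * (2 * real n + \<nu>)"
    proof -
      have "real n * (2 - \<nu>) * (real n + 1) \<le> real n * (2 - \<nu>) * (2 * real n + \<nu>)"
        using n1 \<nu> by (intro mult_left_mono) auto
      thus ?thesis unfolding e by (simp add: mult_ac)
    qed
    thus ?thesis using den by simp
  qed
  have DA: "D \<le> 4 * A"
  proof -
    have "4 * A - D = 4 * (real n * (2 - \<nu>) + a)" by (simp add: A_def D_def algebra_simps)
    thus ?thesis using e_le a(2) by simp
  qed
  have BC: "B \<le> 4 * C"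
  proof -
    have "4 * C - B = 4 * ((real n * (2 - \<nu>) + a) + (2 - \<nu>))" by (simp add: B_def C_def algebra_simps)
    thus ?thesis using e_le a(2) \<nu> by simp
  qed
  define y0 where "y0 = D / A"
  have y0: "0 < y0" "y0 \<le> 4" using A D DA by (auto simp: y0_def divide_le_eq)
  have Qy0: "poly Q y0 \<le> 0"
  proof -
    have "A * y0 = D" using A by (simp add: y0_def)
    hence "poly Q y0 = y0 * (C * y0 - B) + t * (A * y0 - D)"
      by (simp add: Q_def algebra_simps)
    also have "\<dots> = y0 * (C * y0 - B)" using \<open>A * y0 = D\<close> by simp
    also have "C * y0 - B = (C * D - A * B) / A" using A by (simp add: y0_def field_simps)
    also have "y0 * ((C * D - A * B) / A) \<le> 0"
      using y0 AB A by (intro mult_nonneg_nonpos divide_nonpos_pos) auto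
    finally show ?thesis .
  qed
  have "\<exists>x. 0 \<le> x \<and> x \<le> 4 \<and> poly Q x = 0"
  proof (cases "t \<le> 0")
    case True
    hence "poly Q 0 \<ge> 0" using D by (simp add: Q_def mult_nonneg_nonpos)
    with Qy0 have "\<exists>x\<ge>0. x \<le> y0 \<and> poly Q x = 0"
      using y0 by (intro IVT2) auto
    thus ?thesis using y0 by auto
  next
    case False
    have "poly Q 4 = 4 * (4 * C - B) + t * (4 * A - D)" by (simp add: Q_def algebra_simps)
    also have "\<dots> \<ge> 0" using BC DA False by (intro add_nonneg_nonneg mult_nonneg_nonneg) auto
    finally have "\<exists>x\<ge>y0. x \<le> 4 \<and> poly Q x = 0"
      using Qy0 y0 by (intro IVT) auto
    thus ?thesis using y0 by (meson less_imp_le order_trans)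
  qed
  then obtain x where x: "0 \<le> x" "x \<le> 4" "poly Q x = 0" by blast
  then obtain l where l: "Q = [:- x, 1:] * l" unfolding poly_eq_0_iff_dvd dvd_def by blast
  have "degree l \<le> 1"
  proof (cases "l = 0")
    case False
    have "degree Q = Suc (degree l)" unfolding l using False by (subst degree_mult_eq) auto
    moreover have "degree Q \<le> 2" by (simp add: Q_def)
    ultimately show ?thesis by simp
  qed simp
  moreover have "jacobi_op \<nu> (pencil n t) + smult a (pencil n t) = l * linear_factors (add_mset x (replicate_mset (n - 1) 0))"
  proof -
    have "linear_factors (replicate_mset m 0) = [:0, 1:] ^ m" for m
      by (simp add: linear_factors_def)
    moreover have "jacobi_op \<nu> (pencil n t) + smult a (pencil n t) = [:0, 1:] ^ (n - 1) * Q"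
      using pencil_step[OF n, of \<nu> t a] unfolding Q_def A_def B_def C_def D_def .
    ultimately show ?thesis unfolding linear_factors_add l by (simp only: mult_ac)
  qed
  ultimately show ?thesis unfolding one_defect_form_def using x n
    by (intro exI[of _ l] exI[of _ "add_mset x (replicate_mset (n - 1) 0)"]) (auto split: if_splits)
qed

lemma h_const_nonneg: "0 < \<nu> \<Longrightarrow> \<nu> < 2 \<Longrightarrow> 0 \<le> h_const n \<nu>"
  by (simp add: h_const_def e_const_def)

text \<open>The two terms of the minimum serve different factors: the first bound is what the
  unpaired real factor needs on the pencil, the second is what pairs need.\<close>

lemma h_const_square_le:
  assumes "0 < \<nu>" "\<nu> < 2"
  shows "(h_const n \<nu>)\<^sup>2 \<le> 1 / 4 + e_const n \<nu>" "(h_const n \<nu>)\<^sup>2 \<le> 1"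
proof -
  have e: "e_const n \<nu> \<ge> 0" using assms by (simp add: e_const_def)
  have "(h_const n \<nu>)\<^sup>2 \<le> (sqrt (1 / 4 + e_const n \<nu>))\<^sup>2"
    using h_const_nonneg[OF assms] by (intro power_mono) (auto simp: h_const_def)
  thus "(h_const n \<nu>)\<^sup>2 \<le> 1 / 4 + e_const n \<nu>" using e by simp
  show "(h_const n \<nu>)\<^sup>2 \<le> 1"
    using h_const_nonneg[OF assms] by (intro power_le_one) (auto simp: h_const_def)
qed

lemma one_defect_form_pencil: "one_defect_form n (pencil n t)"
  unfolding one_defect_form_def pencil_def
  by (intro exI[of _ "[:t, 1:]"] exI[of _ "replicate_mset n 0"])
     (auto simp: linear_factors_def mult.commute split: if_splits)

lemma one_defect_form_poly_diag_op:
  assumes \<nu>: "0 < \<nu>" "\<nu> < 2" and n: "n \<ge> 1" and g: "in_parabola (h_const n \<nu>) g"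
  shows "one_defect_form n (poly_diag_op \<nu> g (pencil n t))"
proof -
  have h: "0 \<le> h_const n \<nu>" "h_const n \<nu> \<le> 1" using h_const_nonneg[OF \<nu>] by (auto simp: h_const_def)
  from one_defect_form_poly_diag_op_aux[OF \<nu> h g] show ?thesis
  proof (elim disjE exE conjE)
    fix w g1 assume w: "1 / 4 < w" "w \<le> (h_const n \<nu>)\<^sup>2" "g = [:- w, 1:] * g1"
      "\<forall>d f. one_defect_form d f \<longrightarrow> one_defect_form d (poly_diag_op \<nu> g1 f)"
    have "one_defect_form n (jacobi_op \<nu> (pencil n t) + smult (1 / 4 - w) (pencil n t))"
      using h_const_square_le[OF \<nu>, of n] w by (intro first_step_one_defect_form[OF \<nu> n]) auto
    moreover have "jacobi_op \<nu> (pencil n t) + smult (1 / 4 - w) (pencil n t) = poly_diag_op \<nu> [:- w, 1:] (pencil n t)"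
      unfolding poly_diag_op_linear_factor by (simp add: smult_diff_left)
    moreover have "poly_diag_op \<nu> g (pencil n t) = poly_diag_op \<nu> g1 (poly_diag_op \<nu> [:- w, 1:] (pencil n t))"
      unfolding w(3) mult.commute[of "[:- w, 1:]"] by (rule poly_diag_op_mult)
    ultimately show ?thesis using w(4) by simp
  qed (use one_defect_form_pencil in blast)
qed

subsection \<open>Entire functions of order at most one\<close>

text \<open>The map k / (2 A - k) takes the half plane Re k < A into the unit disc and fixes 0, so
  the Schwarz lemma applies.\<close>

lemma borel_caratheodory_unit_disc:
  assumes k: "k holomorphic_on ball 0 1" "k 0 = 0" and A: "\<And>z. norm z < 1 \<Longrightarrow> Re (k z) < A"
    and z: "norm z < 1"
  shows "norm (k z) \<le> 2 * A * norm z / (1 - norm z)"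
proof -
  have A0: "A > 0" using A[of 0] k(2) by simp
  define \<phi> where "\<phi> w = k w / (2 * of_real A - k w)" for w
  have less: "norm (k w) < norm (2 * of_real A - k w)" if "norm w < 1" for w
  proof -
    have "(norm (2 * of_real A - k w))\<^sup>2 - (norm (k w))\<^sup>2 = 4 * A * (A - Re (k w))"
      unfolding cmod_power2 by (simp add: power2_eq_square algebra_simps)
    also have "\<dots> > 0" using A[OF that] A0 by simp
    finally show ?thesis by (simp add: power_less_imp_less_base)
  qed
  have nz: "2 * of_real A - k w \<noteq> 0" if "norm w < 1" for w
    using less[OF that] by (metis norm_zero norm_ge_zero not_less)
  have "\<phi> holomorphic_on ball 0 1"
    unfolding \<phi>_def[abs_def] using nz by (intro holomorphic_intros k(1)) auto
  moreover have "\<phi> 0 = 0" by (simp add: \<phi>_def k(2))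
  moreover have "norm (\<phi> w) < 1" if "norm w < 1" for w
    using less[OF that] nz[OF that] by (simp add: \<phi>_def norm_divide divide_less_eq)
  ultimately have "norm (\<phi> z) \<le> norm z" using z by (intro Schwarz_Lemma(1)) auto
  hence "norm (k z) \<le> norm z * norm (2 * of_real A - k z)"
    using nz[OF z] by (simp add: \<phi>_def norm_divide divide_le_eq)
  also have "\<dots> \<le> norm z * (2 * A + norm (k z))"
    using norm_triangle_ineq4[of "2 * of_real A" "k z"] A0 by (intro mult_left_mono) (auto simp: norm_mult)
  finally have "norm (k z) * (1 - norm z) \<le> 2 * A * norm z" by (simp add: algebra_simps)
  thus ?thesis using z by (simp add: le_divide_eq)
qed

lemma entire_divide_zero:
  assumes "g holomorphic_on UNIV" "g z = 0"
  shows "\<exists>g1. g1 holomorphic_on UNIV \<and> (\<forall>w. g w = (w - z) * g1 w)"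
proof -
  have "(\<lambda>w. if w = z then deriv g z else (g w - g z) / (w - z)) holomorphic_on UNIV"
    by (rule pole_lemma_open[OF assms(1)]) simp
  thus ?thesis using assms(2) by (intro exI conjI) auto
qed

text \<open>The approximants must act as real multipliers, so q is real; the complex zeros are kept
  as a multiset for the norm estimates.\<close>

definition real_zero_poly :: "complex multiset \<Rightarrow> real poly \<Rightarrow> bool" where
  "real_zero_poly Z q \<longleftrightarrow> map_poly of_real q = (\<Prod>z\<in>#Z. [:- z, 1:])"

lemma poly_real_zero_poly:
  "real_zero_poly Z q \<Longrightarrow> poly (map_poly of_real q) w = (\<Prod>z\<in>#Z. w - z)"
  unfolding real_zero_poly_def by (simp add: poly_prod_mset image_mset.compositionality o_def)

lemma norm_prod_mset_bounds:
  fixes w :: complex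
  assumes "\<And>z. z \<in># Z \<Longrightarrow> norm z \<le> R"
  shows "norm w \<ge> R \<Longrightarrow> norm (\<Prod>z\<in>#Z. w - z) \<ge> (norm w - R) ^ size Z"
    and "norm (\<Prod>z\<in>#Z. w - z) \<le> (norm w + R) ^ size Z"
proof -
  show "norm (\<Prod>z\<in>#Z. w - z) \<ge> (norm w - R) ^ size Z" if w: "norm w \<ge> R" using assms
  proof (induction Z)
    case (add z Z)
    have "norm w - R \<le> norm (w - z)" using norm_triangle_ineq2[of w z] add.prems[of z] by simp
    thus ?case using add w by (simp add: norm_mult mult_mono)
  qed simp
  show "norm (\<Prod>z\<in>#Z. w - z) \<le> (norm w + R) ^ size Z" using assms
  proof (induction Z)
    case (add z Z)
    have "norm (w - z) \<le> norm w + R" using norm_triangle_ineq4[of w z] add.prems[of z] by simp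
    moreover have "0 \<le> norm w + R" using add.prems[of z] norm_ge_zero[of z] norm_ge_zero[of w] by (simp del: norm_ge_zero)
    ultimately show ?case using add by (simp add: norm_mult mult_mono)
  qed simp
qed

lemma entire_max_modulus:
  assumes g: "g holomorphic_on UNIV" and B: "\<And>w. norm w = r \<Longrightarrow> norm (g w) \<le> B"
    and w: "norm w \<le> r" and r: "r > 0"
  shows "norm (g w) \<le> B"
proof (rule maximum_modulus_frontier[of g "cball 0 r"])
  show "norm (g z) \<le> B" if "z \<in> frontier (cball 0 r)" for z
    using that r by (intro B) (simp add: frontier_cball)
  show "continuous_on (closure (cball 0 r)) g"
    using g by (intro holomorphic_on_imp_continuous_on) (auto intro: holomorphic_on_subset)
qed (use w g in \<open>auto intro: holomorphic_on_subset\<close>)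

text \<open>Zeros in the disc are split off, real ones singly and nonreal ones with their
  conjugates. A Jensen type estimate bounds how many can be removed, and a factorization with the
  largest number leaves a cofactor without zeros in the disc.\<close>

lemma real_entire_factorization:
  assumes G: "G holomorphic_on UNIV" and real: "\<And>w. G (cnj w) = cnj (G w)"
    and nz: "norm w0 \<le> R" "G w0 \<noteq> 0" and R: "R > 0"
  shows "\<exists>Z q g. real_zero_poly Z q \<and> (\<forall>z\<in>#Z. norm z \<le> R) \<and> g holomorphic_on UNIV \<and>
     (\<forall>w. G w = poly (map_poly of_real q) w * g w) \<and> (\<forall>w. norm w \<le> R \<longrightarrow> g w \<noteq> 0)"
proof -
  define P where "P d \<longleftrightarrow> (\<exists>Z q g. size Z = d \<and> real_zero_poly Z q \<and> (\<forall>z\<in>#Z. norm z \<le> R) \<and> g holomorphic_on UNIV \<and>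
     (\<forall>w. G w = poly (map_poly of_real q) w * g w))" for d
  have "P 0" unfolding P_def
    by (intro exI[of _ "{#}"] exI[of _ 1] exI[of _ G]) (simp add: real_zero_poly_def G)
  obtain M where M: "\<And>w. norm w \<le> 5 * R \<Longrightarrow> norm (G w) \<le> M" "M > 0"
  proof -
    have "compact (G ` cball 0 (5 * R))"
      by (intro compact_continuous_image holomorphic_on_imp_continuous_on holomorphic_on_subset[OF G]) auto
    hence "bounded (G ` cball 0 (5 * R))" by (rule compact_imp_bounded)
    then obtain M where "M > 0" "\<forall>x\<in>G ` cball 0 (5 * R). norm x \<le> M" unfolding bounded_pos by blast
    thus ?thesis using that[of M] by auto
  qed
  obtain K where K: "M / norm (G w0) < 2 ^ K" using real_arch_pow[of 2 "M / norm (G w0)"] by auto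
  have bound: "d \<le> K" if Pd: "P d" for d
  proof -
    obtain Z q g where Z: "size Z = d" "real_zero_poly Z q" "\<forall>z\<in>#Z. norm z \<le> R" "g holomorphic_on UNIV"
      "\<forall>w. G w = poly (map_poly of_real q) w * g w" using Pd unfolding P_def by blast
    note ev = poly_real_zero_poly[OF Z(2)]
    have "norm (g w0) \<le> M / (4 * R) ^ d"
    proof (rule entire_max_modulus[OF Z(4)])
      \<comment> \<open>On this circle every zero is at distance at least 4 R, while the distance to
        w0 is at most 2 R. Each zero thus costs a factor 2 in the bound for G at w0.\<close>
      fix w :: complex assume w: "norm w = 5 * R"
      have "(norm w - R) ^ size Z \<le> norm (\<Prod>z\<in>#Z. w - z)"
        using Z(3) w R by (intro norm_prod_mset_bounds) auto
      hence "(4 * R) ^ d * norm (g w) \<le> norm (\<Prod>z\<in>#Z. w - z) * norm (g w)"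
        using w Z(1) by (intro mult_right_mono) auto
      also have "\<dots> = norm (G w)" using Z(5) ev by (simp add: norm_mult)
      also have "\<dots> \<le> M" using w by (intro M(1)) simp
      finally show "norm (g w) \<le> M / (4 * R) ^ d" using R by (simp add: le_divide_eq mult.commute)
    qed (use nz R in auto)
    have "norm (\<Prod>z\<in>#Z. w0 - z) \<le> (norm w0 + R) ^ size Z"
      using Z(3) by (intro norm_prod_mset_bounds) auto
    also have "\<dots> \<le> (2 * R) ^ d" unfolding Z(1) using nz R by (intro power_mono) auto
    finally have "norm (\<Prod>z\<in>#Z. w0 - z) * norm (g w0) \<le> (2 * R) ^ d * (M / (4 * R) ^ d)"
      using \<open>norm (g w0) \<le> _\<close> R by (intro mult_mono) auto
    also have "norm (\<Prod>z\<in>#Z. w0 - z) * norm (g w0) = norm (G w0)" using Z(5) ev by (simp add: norm_mult)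
    also have "(2 * R) ^ d * (M / (4 * R) ^ d) = M / 2 ^ d"
    proof -
      have "(4 * R) ^ d = (2 * (2 * R)) ^ d" by simp
      also have "\<dots> = 2 ^ d * (2 * R) ^ d" by (rule power_mult_distrib)
      finally have "(4 * R) ^ d = 2 ^ d * (2 * R) ^ d" .
      thus ?thesis using R by simp
    qed
    finally have "2 ^ d \<le> M / norm (G w0)" using nz(2) by (simp add: le_divide_eq mult.commute)
    also have "\<dots> < 2 ^ K" by (rule K)
    finally show ?thesis by simp
  qed
  define d where "d = (GREATEST d. P d)"
  have "P d" unfolding d_def using GreatestI_nat[of P 0 K] \<open>P 0\<close> bound by blast
  have dmax: "e \<le> d" if "P e" for e unfolding d_def using Greatest_le_nat[of P e K] that bound by blast
  obtain Z q g where Z: "size Z = d" "real_zero_poly Z q" "\<forall>z\<in>#Z. norm z \<le> R" "g holomorphic_on UNIV"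
      "\<forall>w. G w = poly (map_poly of_real q) w * g w" using \<open>P d\<close> unfolding P_def by blast
  note ev = poly_real_zero_poly[OF Z(2)]
  have q0: "map_poly complex_of_real q \<noteq> 0"
    using Z(2) unfolding real_zero_poly_def by (auto simp: prod_mset_zero_iff)
  have "g w \<noteq> 0" if w: "norm w \<le> R" for w
  proof
    assume gw: "g w = 0"
    then obtain g1 where g1: "g1 holomorphic_on UNIV" "\<And>v. g v = (v - w) * g1 v"
      using entire_divide_zero[OF Z(4)] by blast
    show False
    proof (cases "Im w = 0")
      case True
      have m0: "map_poly of_real ([:- Re w, 1:] * q) = [:- w, 1:] * map_poly of_real q"
        using True by (simp add: map_poly_of_real_mult map_poly_pCons complex_eq_iff del: mult_pCons_left)
      have m: "map_poly of_real ([:- Re w, 1:] * q) = (\<Prod>z\<in>#add_mset w Z. [:- z, 1:])"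
        using Z(2) unfolding m0 by (simp add: real_zero_poly_def del: mult_pCons_left)
      have "P (Suc d)" unfolding P_def
      proof (intro exI conjI)
        show "size (add_mset w Z) = Suc d" using Z(1) by simp
        show "real_zero_poly (add_mset w Z) ([:- Re w, 1:] * q)" using m by (simp only: real_zero_poly_def)
        show "\<forall>z\<in>#add_mset w Z. norm z \<le> R" using Z(3) w by auto
        show "\<forall>v. G v = poly (map_poly of_real ([:- Re w, 1:] * q)) v * g1 v"
        proof
          fix v
          have "G v = poly (map_poly of_real q) v * ((v - w) * g1 v)" using Z(5) g1(2)[of v] by simp
          also have "\<dots> = poly ([:- w, 1:] * map_poly of_real q) v * g1 v" unfolding poly_mult by simp
          finally show "G v = poly (map_poly of_real ([:- Re w, 1:] * q)) v * g1 v"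
            unfolding m0 .
        qed
      qed (rule g1(1))
      thus False using dmax[of "Suc d"] by simp
    next
      case False
      have qreal: "poly (map_poly complex_of_real q) (cnj v) = cnj (poly (map_poly complex_of_real q) v)" for v
        by (induction q) (auto simp: map_poly_pCons)
      \<comment> \<open>Off the zeros of q the cofactor is G / q and therefore real. The point w may
        itself be a zero of q, so the symmetry is carried over to w by continuity.\<close>
      have "g (cnj w) = 0"
      proof -
        have fin: "finite {v. poly (map_poly complex_of_real q) v = 0}" using q0 by (rule poly_roots_finite)
        have "eventually (\<lambda>v. v \<notin> {v. poly (map_poly complex_of_real q) v = 0} - {w}) (at w)"
        proof -
          define S where "S = {v. poly (map_poly complex_of_real q) v = 0} - {w}"
          have "closed S" unfolding S_def by (intro finite_imp_closed finite_Diff fin)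
          hence "eventually (\<lambda>v. v \<in> - S) (at w)"
            by (intro eventually_at_in_open' open_Compl) (simp_all add: S_def)
          thus ?thesis unfolding S_def[symmetric] by simp
        qed
        hence "eventually (\<lambda>v. cnj (g (cnj v)) = g v) (at w)"
          using eventually_neq_at_within[of w w UNIV]
        proof eventually_elim
          case (elim v)
          hence "poly (map_poly complex_of_real q) v \<noteq> 0" by (auto)
          moreover have "poly (map_poly complex_of_real q) v * g v = poly (map_poly complex_of_real q) v * cnj (g (cnj v))"
          proof -
            have "cnj (G (cnj v)) = G v" using real[of v] by simp
            thus ?thesis using Z(5)[rule_format, of v] Z(5)[rule_format, of "cnj v"] qreal[of v] by auto
          qed
          ultimately show ?case by auto
        qed
        moreover have cont: "isCont g v" for v
          using Z(4) by (metis holomorphic_on_imp_continuous_on continuous_on_eq_continuous_at open_UNIV UNIV_I)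
        have "((\<lambda>v. cnj (g (cnj v))) \<longlongrightarrow> cnj (g (cnj w))) (at w)"
          by (intro tendsto_intros isCont_tendsto_compose[OF cont])
        ultimately have "(g \<longlongrightarrow> cnj (g (cnj w))) (at w)" by (rule Lim_transform_eventually[rotated])
        moreover have "(g \<longlongrightarrow> g w) (at w)" using cont[of w] by (simp add: isCont_def)
        ultimately have "cnj (g (cnj w)) = g w" by (intro tendsto_unique[of "at w"]) auto
        thus ?thesis using gw by simp
      qed
      moreover have "cnj w \<noteq> w" using False by (auto simp: complex_eq_iff)
      ultimately have "g1 (cnj w) = 0" using g1(2)[of "cnj w"] by simp
      then obtain g2 where g2: "g2 holomorphic_on UNIV" "\<And>v. g1 v = (v - cnj w) * g2 v"
        using entire_divide_zero[OF g1(1)] by blast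
      define p where "p = [:(cmod w)\<^sup>2, - (2 * Re w), 1:]"
      have p: "map_poly complex_of_real p = [:- w, 1:] * [:- cnj w, 1:]"
        unfolding p_def cmod_power2 by (simp add: map_poly_pCons complex_eq_iff power2_eq_square)
      have pq: "map_poly complex_of_real (p * q) = [:- w, 1:] * ([:- cnj w, 1:] * map_poly of_real q)"
        by (simp only: map_poly_of_real_mult p mult.assoc)
      have m: "map_poly of_real (p * q) = (\<Prod>z\<in>#add_mset w (add_mset (cnj w) Z). [:- z, 1:])"
        using Z(2) unfolding pq by (simp add: real_zero_poly_def del: mult_pCons_left)
      have "P (Suc (Suc d))" unfolding P_def
      proof (intro exI conjI)
        show "size (add_mset w (add_mset (cnj w) Z)) = Suc (Suc d)" using Z(1) by simp
        show "real_zero_poly (add_mset w (add_mset (cnj w) Z)) (p * q)" using m by (simp only: real_zero_poly_def)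
        show "\<forall>z\<in>#add_mset w (add_mset (cnj w) Z). norm z \<le> R" using Z(3) w by auto
        show "\<forall>v. G v = poly (map_poly of_real (p * q)) v * g2 v"
        proof
          fix v
          have "G v = poly (map_poly of_real q) v * ((v - w) * ((v - cnj w) * g2 v))"
            using Z(5) g1(2)[of v] g2(2)[of v] by simp
          also have "\<dots> = poly ([:- w, 1:] * ([:- cnj w, 1:] * map_poly of_real q)) v * g2 v" unfolding poly_mult by simp
          finally show "G v = poly (map_poly of_real (p * q)) v * g2 v" unfolding pq .
        qed
      qed (rule g2(1))
      thus False using dmax[of "Suc (Suc d)"] by simp
    qed
  qed
  thus ?thesis using Z by blast
qed

lemma entire_even_square:
  assumes F: "F holomorphic_on UNIV" and even: "even_fun F"
  shows "\<exists>G. G holomorphic_on UNIV \<and> (\<forall>z. G (z\<^sup>2) = F z)"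
proof -
  define a where "a n = (deriv ^^ n) F 0 / fact n" for n
  have Fs: "(\<lambda>n. a n * z ^ n) sums F z" for z
    using holomorphic_power_series[of F 0 "norm z + 1" z] F
    by (auto simp: a_def intro: holomorphic_on_subset)
  have Gs: "(\<lambda>m. a (2 * m) * (z\<^sup>2) ^ m) sums F z" for z
  proof -
    have "(\<lambda>n. (a n * z ^ n + a n * (- z) ^ n) / 2) sums ((F z + F (- z)) / 2)"
      by (intro sums_divide sums_add Fs)
    moreover have "(F z + F (- z)) / 2 = F z" using even by (simp add: even_fun_def)
    ultimately have "(\<lambda>n. (a n * z ^ n + a n * (- z) ^ n) / 2) sums F z" by simp
    hence "(\<lambda>m. (a (2 * m) * z ^ (2 * m) + a (2 * m) * (- z) ^ (2 * m)) / 2) sums F z"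
    proof (subst sums_mono_reindex[of "\<lambda>m. 2 * m" "\<lambda>n. (a n * z ^ n + a n * (- z) ^ n) / 2"])
      show "(a n * z ^ n + a n * (- z) ^ n) / 2 = 0" if "n \<notin> range (\<lambda>m. 2 * m)" for n
      proof -
        have "odd n" using that by (auto elim: evenE)
        thus ?thesis by simp
      qed
    qed (auto simp: strict_mono_def)
    thus ?thesis by (simp add: power_mult)
  qed
  define G where "G w = (\<Sum>m. a (2 * m) * w ^ m)" for w
  have sG: "(\<lambda>m. a (2 * m) * w ^ m) sums G w" for w
    using Gs[of "csqrt w"] unfolding G_def by (simp add: sums_iff)
  have "G (z\<^sup>2) = F z" for z using Gs[of z] unfolding G_def by (simp add: sums_iff)
  moreover have "G holomorphic_on UNIV"
  proof -
    have "G field_differentiable (at w)" for w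
    proof -
      have "G holomorphic_on ball 0 (norm w + 1)"
        by (rule power_series_holomorphic[where a = "\<lambda>m. a (2 * m)"]) (use sG in simp)
      thus ?thesis by (rule holomorphic_on_imp_differentiable_at) auto
    qed
    thus ?thesis by (simp add: holomorphic_on_def field_differentiable_at_within)
  qed
  ultimately show ?thesis by blast
qed

text \<open>The exponent 3/2 is one choice between 1 and 2. Halving it yields the exponent s < 1 for
  G, since G(z^2) = F(z).\<close>

lemma order_le_one_growth:
  assumes "growth_order F \<le> 1"
  shows "\<exists>c b s. c > 0 \<and> 0 \<le> s \<and> s < 1 \<and> (\<forall>z. norm z \<ge> b \<longrightarrow> norm (F z) \<le> c * exp ((norm z)\<^sup>2 powr s))"
proof -
  have "growth_order F < ereal (3 / 2)" using assms by (rule order_le_less_trans) simp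
  then obtain \<rho> where \<rho>: "0 \<le> \<rho>" "\<rho> < 3 / 2"
    "(\<lambda>z. norm (F z)) \<in> O[at_infinity](\<lambda>z. exp (norm z powr \<rho>))"
    unfolding growth_order_def Inf_less_iff by auto
  from \<rho>(3) obtain c where c: "c > 0" "eventually (\<lambda>z. norm (norm (F z)) \<le> c * norm (exp (norm z powr \<rho>))) at_infinity"
    by (rule landau_o.bigE)
  then obtain b where b: "\<And>z. norm z \<ge> b \<Longrightarrow> norm (F z) \<le> c * exp (norm z powr \<rho>)"
    unfolding eventually_at_infinity by auto
  have "(norm z)\<^sup>2 powr (\<rho> / 2) = norm z powr \<rho>" for z :: complex
    by (simp add: powr_powr flip: powr_numeral)
  thus ?thesis using \<rho> b c(1)
    by (intro exI[of _ c] exI[of _ b] exI[of _ "\<rho> / 2"]) auto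
qed

lemma of_real_poly: "complex_of_real (poly p x) = poly (map_poly of_real p) (of_real x)"
  by (induction p) (auto simp: map_poly_pCons)

lemma poly_map_smult: "poly (map_poly complex_of_real (smult c q)) w = of_real c * poly (map_poly of_real q) w"
  by (simp add: map_poly_smult)

text \<open>If \<open>q\<close> collects the zeros of \<open>G\<close> in the disc of radius \<open>R\<close>, normalised by
  \<open>q(w0) = 1\<close>, then \<open>|q| \<ge> 1\<close> on the circle of radius \<open>3R\<close>, so \<open>G / q\<close> inherits the growth
  bound and has no zeros in the disc; as the order of \<open>G\<close> is less than one, Borel--Caratheodory forces
  \<open>G / q\<close> to converge to the constant \<open>G(w0)\<close>.\<close>

lemma entire_approx_by_zero_polys:
  assumes G: "G holomorphic_on UNIV" and real: "\<And>w. G (cnj w) = cnj (G w)" and nz: "G v \<noteq> 0"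
    and growth: "c > 0" "0 \<le> s" "s < 1" "\<And>w. norm w \<ge> b \<Longrightarrow> norm (G w) \<le> c * exp (norm w powr s)"
  shows "\<exists>p :: nat \<Rightarrow> real poly. (\<forall>k. p k \<noteq> 0 \<and> (\<forall>z. poly (map_poly of_real (p k)) z = 0 \<longrightarrow> G z = 0)) \<and>
           (\<forall>w. (\<lambda>k. poly (map_poly of_real (p k)) w) \<longlonglongrightarrow> G w)"
proof -
  \<comment> \<open>A real base point makes the normalising quotient g0 / q0 real, so that the
    approximants are real polynomials.\<close>
  obtain x0 :: real where x0: "G (of_real x0) \<noteq> 0"
  proof (rule ccontr)
    assume "\<not> thesis"
    hence zero: "G (of_real x) = 0" for x using that by blast
    have "(0::complex) islimpt range of_real"
      unfolding islimpt_approachable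
    proof (intro allI impI)
      fix e :: real assume "e > 0"
      thus "\<exists>x'\<in>range complex_of_real. x' \<noteq> 0 \<and> dist x' 0 < e"
        by (intro bexI[of _ "of_real (e / 2)"] rangeI) auto
    qed
    hence "G v = 0" using G zero by (intro analytic_continuation[of G UNIV "range of_real" 0 v]) auto
    thus False using nz by simp
  qed
  define w0 where "w0 = complex_of_real x0"
  define g0 where "g0 = Re (G w0)"
  have "G w0 = cnj (G w0)" using real[of w0] by (simp add: w0_def)
  hence g0: "G w0 = of_real g0" by (simp add: g0_def complex_eq_iff)
  have g0nz: "g0 \<noteq> 0" using x0 g0 by (auto simp: w0_def)
  \<comment> \<open>An upper bound for the real part of the logarithm of the normalised cofactor;
    the summand 1 makes it strict.\<close>
  define \<Lambda> where "\<Lambda> R = ln c + (3 * R) powr s - ln \<bar>g0\<bar> + 1" for R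
  have key: "\<exists>p. p \<noteq> 0 \<and> (\<forall>z. poly (map_poly of_real p) z = 0 \<longrightarrow> G z = 0) \<and>
     (\<forall>w. norm (w - w0) < R / 2 \<longrightarrow> (\<exists>k. norm k \<le> 2 * \<Lambda> R * (norm (w - w0) / (R / 2)) / (1 - norm (w - w0) / (R / 2)) \<and>
        poly (map_poly of_real p) w * exp k = G w))"
    if R: "R > 0" "R \<ge> 2 * norm w0" "3 * R \<ge> b" for R
  proof -
    obtain Z q g where Z: "real_zero_poly Z q" "\<forall>z\<in>#Z. norm z \<le> R" "g holomorphic_on UNIV"
      "\<forall>w. G w = poly (map_poly of_real q) w * g w" "\<forall>w. norm w \<le> R \<longrightarrow> g w \<noteq> 0"
      using real_entire_factorization[OF G real, of w0 R] R x0 norm_ge_zero[of w0] unfolding w0_def[symmetric] by (auto simp del: norm_ge_zero)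
    note ev = poly_real_zero_poly[OF Z(1)]
    define Q where "Q = poly (map_poly complex_of_real q)"
    define q0 where "q0 = poly q x0"
    have Qw0: "Q w0 = of_real q0" by (simp add: Q_def w0_def q0_def of_real_poly)
    have q0nz: "q0 \<noteq> 0" using Z(4)[rule_format, of w0] x0 Qw0 unfolding Q_def[symmetric] by (auto simp: w0_def)
    define p where "p = smult (g0 / q0) q"
    have P: "poly (map_poly of_real p) w = of_real (g0 / q0) * Q w" for w
      unfolding p_def Q_def by (rule poly_map_smult)
    have GQ: "G w = Q w * g w" for w using Z(4) unfolding Q_def by blast
    \<comment> \<open>The disc of radius R / 2 around w0, rescaled to the unit disc. As R >= 2 *
      norm w0, it stays within the disc of radius R, where g has no zeros.\<close>
    define f where "f z = of_real (q0 / g0) * g (w0 + of_real (R / 2) * z)" for z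
    have f0: "f 0 = 1"
    proof -
      have "of_real q0 * g w0 = of_real g0" using GQ[of w0] g0 Qw0 by simp
      moreover have "f 0 = of_real q0 * g w0 / of_real g0" by (simp add: f_def)
      ultimately show ?thesis using g0nz by simp
    qed
    have in_R: "norm (w0 + of_real (R / 2) * z) \<le> R" if "norm z < 1" for z
    proof -
      have "norm (w0 + of_real (R / 2) * z) \<le> norm w0 + R / 2 * norm z"
        using R by (intro order_trans[OF norm_triangle_ineq]) (auto simp: norm_mult)
      also have "\<dots> \<le> R / 2 + R / 2 * 1" using R that by (intro add_mono mult_left_mono) auto
      finally show ?thesis by simp
    qed
    have fnz: "f z \<noteq> 0" if "norm z < 1" for z
      using Z(5) in_R[OF that] g0nz q0nz by (simp add: f_def)
    have "(\<lambda>z. g (w0 + of_real (R / 2) * z)) holomorphic_on UNIV"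
      using holomorphic_on_compose_gen[of "\<lambda>z. w0 + of_real (R / 2) * z" UNIV g UNIV] Z(3)
      by (simp add: o_def holomorphic_intros)
    hence fh: "f holomorphic_on ball 0 1"
      unfolding f_def[abs_def] by (intro holomorphic_intros) (auto intro: holomorphic_on_subset)
    obtain l where l: "l holomorphic_on ball 0 1" "\<And>z. norm z < 1 \<Longrightarrow> exp (l z) = f z"
    proof (rule holomorphic_logarithm_exists[of "ball 0 1" f 0])
    qed (use fh fnz in auto)
    define k where "k z = l z - l 0" for z
    have k: "k holomorphic_on ball 0 1" "k 0 = 0"
      unfolding k_def[abs_def] by (intro holomorphic_intros l(1)) simp
    have expk: "exp (k z) = f z" if "norm z < 1" for z
      using l(2)[OF that] l(2)[of 0] f0 by (simp add: k_def exp_diff)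
    have gbound: "norm (g w) \<le> c * exp ((3 * R) powr s) / \<bar>q0\<bar>" if "norm w \<le> 3 * R" for w
    proof (rule entire_max_modulus[OF Z(3) _ that])
      fix w :: complex assume w: "norm w = 3 * R"
      have "norm (Q w0) \<le> (norm w0 + R) ^ size Z"
        unfolding Q_def ev using Z(2) by (intro norm_prod_mset_bounds) auto
      also have "\<dots> \<le> (2 * R) ^ size Z" using R by (intro power_mono) auto
      also have "2 * R = norm w - R" using w by simp
      also have "(norm w - R) ^ size Z \<le> norm (Q w)"
        unfolding Q_def ev using Z(2) w R by (intro norm_prod_mset_bounds) auto
      finally have "\<bar>q0\<bar> \<le> norm (Q w)" by (simp add: Qw0)
      hence "\<bar>q0\<bar> * norm (g w) \<le> norm (Q w) * norm (g w)" by (intro mult_right_mono) auto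
      also have "\<dots> = norm (G w)" by (simp add: GQ norm_mult)
      also have "\<dots> \<le> c * exp ((3 * R) powr s)" using growth(4)[of w] w R by simp
      finally show "norm (g w) \<le> c * exp ((3 * R) powr s) / \<bar>q0\<bar>"
        using q0nz by (simp add: le_divide_eq mult.commute)
    qed (use R in auto)
    have Rek: "Re (k z) < \<Lambda> R" if z: "norm z < 1" for z
    proof -
      have "exp (Re (k z)) = norm (f z)" using expk[OF z] by (metis norm_exp_eq_Re)
      also have "\<dots> = \<bar>q0\<bar> / \<bar>g0\<bar> * norm (g (w0 + of_real (R / 2) * z))"
        by (simp add: f_def norm_mult norm_divide)
      also have "\<dots> \<le> \<bar>q0\<bar> / \<bar>g0\<bar> * (c * exp ((3 * R) powr s) / \<bar>q0\<bar>)"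
        using in_R[OF z] R by (intro mult_left_mono gbound) auto
      also have "\<dots> = c * exp ((3 * R) powr s) / \<bar>g0\<bar>" using q0nz by simp
      also have "\<dots> = exp (\<Lambda> R - 1)"
        using growth(1) g0nz by (simp add: \<Lambda>_def exp_diff exp_add)
      finally show ?thesis by simp
    qed
    show ?thesis
    proof (intro exI[of _ p] conjI allI impI)
      have "q \<noteq> 0" using q0nz by (auto simp: q0_def)
      thus "p \<noteq> 0" using g0nz q0nz by (simp add: p_def)
      show "G z = 0" if "poly (map_poly of_real p) z = 0" for z
        using that g0nz q0nz unfolding P GQ by simp
      fix w assume w: "norm (w - w0) < R / 2"
      define \<zeta> where "\<zeta> = (w - w0) / of_real (R / 2)"
      have n\<zeta>: "norm \<zeta> = norm (w - w0) / (R / 2)" using R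
        unfolding \<zeta>_def norm_divide norm_of_real by (simp only: abs_of_pos half_gt_zero)
      hence \<zeta>1: "norm \<zeta> < 1" using w R by (simp add: divide_less_eq)
      have w\<zeta>: "w0 + of_real (R / 2) * \<zeta> = w"
      proof -
        have "w0 + a * ((w - w0) / a) = w" if "a \<noteq> 0" for a using that by simp
        moreover have "complex_of_real (R / 2) \<noteq> 0" using R by simp
        ultimately show ?thesis unfolding \<zeta>_def by blast
      qed
      show "\<exists>k. norm k \<le> 2 * \<Lambda> R * (norm (w - w0) / (R / 2)) / (1 - norm (w - w0) / (R / 2)) \<and>
        poly (map_poly of_real p) w * exp k = G w"
      proof (intro exI[of _ "k \<zeta>"] conjI)
        show "norm (k \<zeta>) \<le> 2 * \<Lambda> R * (norm (w - w0) / (R / 2)) / (1 - norm (w - w0) / (R / 2))"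
          using borel_caratheodory_unit_disc[OF k Rek \<zeta>1] unfolding n\<zeta> .
        have "exp (k \<zeta>) = of_real (q0 / g0) * g w" using expk[OF \<zeta>1] by (simp only: f_def w\<zeta>)
        thus "poly (map_poly of_real p) w * exp (k \<zeta>) = G w"
          unfolding P GQ using g0nz q0nz by simp
      qed
    qed
  qed
  define R where "R k = real k + 1 + 2 * norm w0 + \<bar>b\<bar>" for k
  have R: "R k > 0" "R k \<ge> 2 * norm w0" "3 * R k \<ge> b" for k
    using norm_ge_zero[of w0] unfolding R_def by (simp_all add: add_pos_nonneg del: norm_ge_zero)
  have "\<forall>k. \<exists>p. p \<noteq> 0 \<and> (\<forall>z. poly (map_poly of_real p) z = 0 \<longrightarrow> G z = 0) \<and>
     (\<forall>w. norm (w - w0) < R k / 2 \<longrightarrow> (\<exists>e. norm e \<le> 2 * \<Lambda> (R k) * (norm (w - w0) / (R k / 2)) / (1 - norm (w - w0) / (R k / 2)) \<and>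
        poly (map_poly of_real p) w * exp e = G w))"
    using key R by blast
  then obtain p where p: "\<And>k. p k \<noteq> 0" "\<And>k z. poly (map_poly of_real (p k)) z = 0 \<Longrightarrow> G z = 0"
    "\<And>k w. norm (w - w0) < R k / 2 \<Longrightarrow> \<exists>e. norm e \<le> 2 * \<Lambda> (R k) * (norm (w - w0) / (R k / 2)) / (1 - norm (w - w0) / (R k / 2)) \<and>
        poly (map_poly of_real (p k)) w * exp e = G w"
    by metis
  have "(\<lambda>k. poly (map_poly of_real (p k)) w) \<longlonglongrightarrow> G w" for w
  proof -
    define D where "D = norm (w - w0)"
    define B where "B k = 2 * \<Lambda> (R k) * (D / (R k / 2)) / (1 - D / (R k / 2))" for k
    have RL: "filterlim R at_top sequentially" unfolding R_def[abs_def] by real_asymp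
    have B0: "B \<longlonglongrightarrow> 0"
    proof -
      have "((\<lambda>x. 2 * (ln c + (3 * x) powr s - ln \<bar>g0\<bar> + 1) * (D / (x / 2)) / (1 - D / (x / 2))) \<longlongrightarrow> 0) at_top"
      proof (rule Lim_transform_eventually)
        have "((\<lambda>x. x powr (s - 1)) \<longlongrightarrow> 0) at_top"
          using growth(3) by (intro tendsto_neg_powr filterlim_ident) auto
        moreover have "((\<lambda>x::real. 1 / x) \<longlongrightarrow> 0) at_top" by real_asymp
        ultimately have "((\<lambda>x. 4 * D * ((ln c - ln \<bar>g0\<bar> + 1) * (1 / x) + 3 powr s * x powr (s - 1)) / (1 - 2 * D * (1 / x)))
            \<longlongrightarrow> 4 * D * ((ln c - ln \<bar>g0\<bar> + 1) * 0 + 3 powr s * 0) / (1 - 2 * D * 0)) at_top"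
          by (intro tendsto_intros) auto
        thus "((\<lambda>x. 4 * D * ((ln c - ln \<bar>g0\<bar> + 1) * (1 / x) + 3 powr s * x powr (s - 1)) / (1 - 2 * D * (1 / x)))
            \<longlongrightarrow> 0) at_top" by simp
        show "eventually (\<lambda>x. 4 * D * ((ln c - ln \<bar>g0\<bar> + 1) * (1 / x) + 3 powr s * x powr (s - 1)) / (1 - 2 * D * (1 / x)) =
            2 * (ln c + (3 * x) powr s - ln \<bar>g0\<bar> + 1) * (D / (x / 2)) / (1 - D / (x / 2))) at_top"
          using eventually_gt_at_top[of 0]
        proof eventually_elim
          case (elim x)
          have "x powr (s - 1) = x powr s / x" using elim by (simp add: powr_diff)
          moreover have "(3 * x) powr s = 3 powr s * x powr s" by (rule powr_mult)
          ultimately have "4 * D * ((ln c - ln \<bar>g0\<bar> + 1) * (1 / x) + 3 powr s * x powr (s - 1)) =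
              2 * (ln c + (3 * x) powr s - ln \<bar>g0\<bar> + 1) * (D / (x / 2))"
            by (simp add: add_divide_distrib diff_divide_distrib algebra_simps)
          moreover have "1 - 2 * D * (1 / x) = 1 - D / (x / 2)" by simp
          ultimately show ?case by (simp only:)
        qed
      qed
      from filterlim_compose[OF this RL] show ?thesis by (simp add: B_def[abs_def] \<Lambda>_def)
    qed
    have ev: "eventually (\<lambda>k. R k > 2 * D) sequentially" using RL by (simp add: filterlim_at_top_dense)
    have "\<forall>k. \<exists>e. R k > 2 * D \<longrightarrow> norm e \<le> B k \<and> poly (map_poly of_real (p k)) w * exp e = G w"
      using p(3)[of w] unfolding B_def D_def by (metis (no_types, lifting) less_divide_eq_numeral1(1) mult.commute)
    then obtain e where e: "\<And>k. R k > 2 * D \<Longrightarrow> norm (e k) \<le> B k \<and> poly (map_poly of_real (p k)) w * exp (e k) = G w"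
      by metis
    have "e \<longlonglongrightarrow> 0"
      by (rule Lim_null_comparison[OF _ B0]) (use ev e in \<open>auto elim: eventually_mono\<close>)
    hence "(\<lambda>k. G w * exp (- e k)) \<longlonglongrightarrow> G w * exp (- 0)" by (intro tendsto_intros)
    moreover have "eventually (\<lambda>k. G w * exp (- e k) = poly (map_poly of_real (p k)) w) sequentially"
      using ev
    proof eventually_elim
      case (elim k)
      have "poly (map_poly of_real (p k)) w * exp (e k) = G w" using e[OF elim] by blast
      thus ?case by (simp add: exp_minus field_simps)
    qed
    ultimately show ?thesis using Lim_transform_eventually by force
  qed
  thus ?thesis using p(1,2) by blast
qed

text \<open>The square root of a zero of an approximant is a zero of F, which keeps the approximants
  in the parabola. Evaluating G at (r + 1/2)^2 recovers the eigenvalues of the multiplier.\<close>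

lemma entire_order_le_one_approx:
  assumes F: "entire_order_le_one F" "real_fun F" "even_fun F" "F \<noteq> (\<lambda>_. 0)" "zero_set F \<subseteq> strip h"
  shows "\<exists>g. (\<forall>k. in_parabola h (g k)) \<and>
     (\<forall>r::nat. (\<lambda>k. poly (g k) ((real r + 1 / 2)\<^sup>2)) \<longlonglongrightarrow> Re (F (of_nat r + 1 / 2)))"
proof -
  obtain G where G: "G holomorphic_on UNIV" "\<And>z. G (z\<^sup>2) = F z"
    using entire_even_square F unfolding entire_order_le_one_def by blast
  obtain c b s where g: "c > 0" "0 \<le> s" "s < 1" "\<And>z. norm z \<ge> b \<Longrightarrow> norm (F z) \<le> c * exp ((norm z)\<^sup>2 powr s)"
    using order_le_one_growth F unfolding entire_order_le_one_def by metis
  have real: "G (cnj w) = cnj (G w)" for w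
  proof -
    have "(cnj (csqrt w))\<^sup>2 = cnj w" by (simp flip: complex_cnj_power)
    thus ?thesis using F(2) G(2)[of "csqrt w"] G(2)[of "cnj (csqrt w)"] by (simp add: real_fun_def)
  qed
  obtain v where v: "F v \<noteq> 0" using F(4) by auto
  have growth: "norm (G w) \<le> c * exp (norm w powr s)" if "norm w \<ge> b\<^sup>2" for w
  proof -
    have n: "(norm (csqrt w))\<^sup>2 = norm w" by (simp flip: norm_power)
    have "b\<^sup>2 \<le> (norm (csqrt w))\<^sup>2" unfolding n by (rule that)
    hence "b \<le> norm (csqrt w)" by (rule power2_le_imp_le) simp
    from g(4)[OF this] show ?thesis using G(2)[of "csqrt w"] by (simp add: n)
  qed
  obtain p where p: "\<And>k. p k \<noteq> 0" "\<And>k z. poly (map_poly of_real (p k)) z = 0 \<Longrightarrow> G z = 0"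
    "\<And>w. (\<lambda>k. poly (map_poly of_real (p k)) w) \<longlonglongrightarrow> G w"
    using entire_approx_by_zero_polys[OF G(1) real _ g(1-3) growth, of "v\<^sup>2"] v unfolding G(2) by metis
  have "in_parabola h (p k)" for k
    unfolding in_parabola_def parabola_region_def
  proof (intro conjI allI impI)
    fix z :: complex assume "poly (map_poly of_real (p k)) z = 0"
    hence "F (csqrt z) = 0" using p(2) G(2)[of "csqrt z"] by simp
    hence "csqrt z \<in> strip h" using F(5) by (auto simp: zero_set_def)
    thus "z \<in> {u\<^sup>2 |u. \<bar>Re u\<bar> \<le> h}" by (auto simp: strip_def intro!: exI[of _ "csqrt z"])
  qed (rule p(1))
  moreover have "(\<lambda>k. poly (p k) ((real r + 1 / 2)\<^sup>2)) \<longlonglongrightarrow> Re (F (of_nat r + 1 / 2))" for r :: nat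
  proof -
    have "(\<lambda>k. Re (poly (map_poly of_real (p k)) (of_real ((real r + 1 / 2)\<^sup>2)))) \<longlonglongrightarrow> Re (G (of_real ((real r + 1 / 2)\<^sup>2)))"
      by (intro tendsto_Re p(3))
    moreover have "G (of_real ((real r + 1 / 2)\<^sup>2)) = F (of_nat r + 1 / 2)"
      using G(2)[of "of_nat r + 1 / 2"] by simp
    ultimately show ?thesis unfolding of_real_poly[symmetric] Re_complex_of_real by simp
  qed
  ultimately show ?thesis by blast
qed

text \<open>The rate \<epsilon> is arbitrary so that the induction can spend half of it on the
  factor norm z.\<close>

lemma poly_exp_bound:
  fixes p :: "complex poly"
  assumes "\<epsilon> > 0"
  shows "\<exists>C. \<forall>z. norm (poly p z) \<le> C * exp (\<epsilon> * norm z)"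
  using assms
proof (induction p arbitrary: \<epsilon>)
  case 0
  show ?case by (intro exI[of _ 0]) simp
next
  case (pCons a p)
  obtain C where C: "\<And>z. norm (poly p z) \<le> C * exp (\<epsilon> / 2 * norm z)" using pCons.IH[of "\<epsilon> / 2"] pCons.prems by auto
  have "norm (poly (pCons a p) z) \<le> (norm a + 2 / \<epsilon> * C) * exp (\<epsilon> * norm z)" for z
  proof -
    have t: "norm z \<le> 2 / \<epsilon> * exp (\<epsilon> / 2 * norm z)"
      using exp_ge_add_one_self[of "\<epsilon> / 2 * norm z"] pCons.prems by (simp add: field_simps)
    have "norm (poly (pCons a p) z) \<le> norm a + norm z * norm (poly p z)"
      by (simp add: order_trans[OF norm_triangle_ineq] norm_mult)
    also have "\<dots> \<le> norm a * exp (\<epsilon> * norm z) + (2 / \<epsilon> * exp (\<epsilon> / 2 * norm z)) * (C * exp (\<epsilon> / 2 * norm z))"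
      using pCons.prems by (intro add_mono mult_mono t C) (auto simp: mult_le_cancel_left1)
    also have "\<dots> = (norm a + 2 / \<epsilon> * C) * exp (\<epsilon> * norm z)"
      by (simp add: algebra_simps flip: exp_add)
    finally show ?thesis .
  qed
  thus ?case by blast
qed

lemma polynomial_order_le_one:
  assumes "is_polynomial F"
  shows "entire_order_le_one F"
proof -
  obtain p where p: "F = poly p" using assms unfolding is_polynomial_def by blast
  obtain C where C: "\<And>z. norm (poly p z) \<le> C * exp (norm z)" using poly_exp_bound[of 1 p] by auto
  have "(\<lambda>z. norm (poly p z)) \<in> O[at_infinity](\<lambda>z. exp (norm z powr 1))"
    by (rule landau_o.bigI[of "max C 1"])
       (use C in \<open>auto intro!: always_eventually order_trans[OF C] mult_right_mono\<close>)
  hence "growth_order F \<le> ereal 1"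
    unfolding growth_order_def p by (intro Inf_lower) (auto intro!: exI[of _ 1])
  thus ?thesis unfolding entire_order_le_one_def p by (auto intro!: holomorphic_intros simp: one_ereal_def)
qed

subsection \<open>The pencil and sharpness\<close>

text \<open>A nonreal zero comes with its conjugate, which makes two zeros outside the
  interval.\<close>

lemma one_defect_imp_real_rooted:
  assumes "f \<in> one_defect N" "f \<noteq> 0"
  shows "real_rooted f"
  unfolding real_rooted_def
proof (intro allI impI, rule ccontr)
  fix z assume z: "poly (map_poly complex_of_real f) z = 0" "z \<notin> \<real>"
  define M where "M = {# z \<in># proots (map_poly complex_of_real f). z \<notin> complex_of_real ` {0..4} #}"
  have nz: "map_poly complex_of_real f \<noteq> 0"
    using assms(2) by (metis coeff_0 coeff_map_poly of_real_0 of_real_eq_0_iff poly_eq_iff)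
  have "poly (map_poly complex_of_real f) (cnj z) = cnj (poly (map_poly complex_of_real f) z)"
    by (induction f) (auto simp: map_poly_pCons)
  moreover have "w \<notin> complex_of_real ` {0..4}" if "w \<notin> \<real>" for w using that by auto
  moreover have "cnj z \<notin> \<real>" using z(2) by (metis Reals_cnj_iff complex_cnj_cnj)
  ultimately have "z \<in># M" "cnj z \<in># M" using z nz by (auto simp: M_def)
  moreover have "size M \<le> 1" using assms unfolding one_defect_def M_def by auto
  hence "M = {#} \<or> (\<exists>x. M = {#x#})"
    by (metis One_nat_def le_Suc_eq le_zero_eq size_1_singleton_mset size_eq_0_iff_empty)
  ultimately have "cnj z = z" by auto
  thus False using z(2) by (simp add: Reals_cnj_iff)
qed

lemma pencil_eq: "pencil n t = [:0, 1:] ^ (n + 1) + smult t ([:0, 1:] ^ n)"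
proof -
  have "[:t, 1:] = [:0, 1:] + smult t 1" by (simp flip: one_pCons)
  thus ?thesis by (simp only: pencil_def distrib_left mult_smult_right mult_1_right power_add power_one_right)
qed

lemma multiplier_pencil:
  "multiplier F \<nu> ([:0, 1:] ^ (n + 1)) + smult t (multiplier F \<nu> ([:0, 1:] ^ n)) = multiplier F \<nu> (pencil n t)"
  unfolding multiplier_eq_diag_op pencil_eq by (simp only: diag_op_linear)

lemma weak_obreschkoff_if_one_defect:
  assumes "\<And>t. multiplier F \<nu> (pencil n t) \<in> one_defect N"
  shows "multiplier F \<nu> ([:0, 1:] ^ n) \<preceq> multiplier F \<nu> ([:0, 1:] ^ (n + 1))"
  unfolding weak_obreschkoff_def multiplier_pencil using one_defect_imp_real_rooted[OF assms] by blast

lemma multiplier_pencil_one_defect: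
  assumes \<nu>: "0 < \<nu>" "\<nu> < 2" and n: "n \<ge> 1"
    and F: "F \<noteq> (\<lambda>_. 0)" "real_fun F" "even_fun F" "is_polynomial F \<or> entire_order_le_one F"
           "zero_set F \<subseteq> strip (h_const n \<nu>)"
  shows "multiplier F \<nu> (pencil n t) \<in> one_defect (n + 1)"
proof -
  have "entire_order_le_one F" using F(4) polynomial_order_le_one by blast
  from entire_order_le_one_approx[OF this F(2,3,1,5)] obtain g where
    g: "\<And>k. in_parabola (h_const n \<nu>) (g k)"
       "\<And>r::nat. (\<lambda>k. poly (g k) ((real r + 1 / 2)\<^sup>2)) \<longlonglongrightarrow> Re (F (of_nat r + 1 / 2))"
    by blast
  have "one_defect_form n (multiplier F \<nu> (pencil n t))"
  proof (rule one_defect_form_closed)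
    show "one_defect_form n (poly_diag_op \<nu> (g k) (pencil n t))" for k
      by (rule one_defect_form_poly_diag_op[OF \<nu> n g(1)])
    show "(\<lambda>k. coeff (poly_diag_op \<nu> (g k) (pencil n t)) i) \<longlonglongrightarrow> coeff (multiplier F \<nu> (pencil n t)) i" for i
      unfolding poly_diag_op_def multiplier_eq_diag_op by (intro tendsto_coeff_diag_op g(2))
  qed
  thus ?thesis by (rule one_defect_form_imp_one_defect)
qed

lemma e_const_nonneg: "0 < \<nu> \<Longrightarrow> \<nu> < 2 \<Longrightarrow> e_const n \<nu> \<ge> 0"
  by (simp add: e_const_def)

text \<open>After clearing denominators the claim is 2 (2 n + \<nu>) <= n (n + 1) (2 + \<nu>), which
  holds separately for the terms with and without \<nu>.\<close>

lemma e_const_1_le: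
  assumes \<nu>: "0 < \<nu>" "\<nu> < 2" and n: "n \<ge> 1"
  shows "e_const 1 \<nu> \<le> e_const n \<nu>"
proof -
  have n1: "real n \<ge> 1" using n by simp
  have "real n * 2 \<le> real n * (real n + 1)" using n1 by (intro mult_left_mono) auto
  moreover have "\<nu> * 2 \<le> \<nu> * (real n * (real n + 1))"
    using \<nu> mult_mono[of 1 "real n" 2 "real n + 1"] n1 by (intro mult_left_mono) auto
  ultimately have "2 * (2 * real n + \<nu>) \<le> real n * (real n + 1) * (2 + \<nu>)"
    by (simp add: algebra_simps)
  hence "2 * (2 - \<nu>) * (2 * real n + \<nu>) \<le> real n * (real n + 1) * (2 - \<nu>) * (2 + \<nu>)"
    using mult_left_mono[of "2 * (2 * real n + \<nu>)" "real n * (real n + 1) * (2 + \<nu>)" "2 - \<nu>"] \<nu>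
    by (simp only: mult_ac)
  moreover have "2 + \<nu> > 0" "2 * real n + \<nu> > 0" using \<nu> n1 by auto
  ultimately show ?thesis by (simp add: e_const_def frac_le_eq divide_le_0_iff)
qed

lemma h_const_1_le:
  assumes "0 < \<nu>" "\<nu> < 2" "n \<ge> 1"
  shows "h_const 1 \<nu> \<le> h_const n \<nu>"
  unfolding h_const_def using e_const_1_le[OF assms] by (intro min.mono) auto

text \<open>The function u^2 - W gives one unpaired factor with a = 1/4 - W just below
  -\<open>e_const n \<nu>\<close>. Then A * B < C * D, and some member of the pencil is sent to a
  quadratic without real zeros times a power of y.\<close>

lemma strip_sharp:
  assumes \<nu>: "0 < \<nu>" "\<nu> < 2" and n: "n \<ge> 1" and e: "e_const n \<nu> \<le> 3 / 4" and H: "H > h_const n \<nu>"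
  shows "\<exists>F :: complex \<Rightarrow> complex. F \<noteq> (\<lambda>_. 0) \<and> real_fun F \<and> even_fun F \<and> is_polynomial F \<and>
           zero_set F \<subseteq> strip H \<and>
           \<not> (multiplier F \<nu> ([:0, 1:] ^ n) \<preceq> multiplier F \<nu> ([:0, 1:] ^ (n + 1)))"
proof -
  have e0: "e_const n \<nu> \<ge> 0" by (rule e_const_nonneg[OF \<nu>])
  have "sqrt (1 / 4 + e_const n \<nu>) \<le> sqrt 1" using e by (intro real_sqrt_le_mono) simp
  hence h: "h_const n \<nu> = sqrt (1 / 4 + e_const n \<nu>)" by (simp add: h_const_def)
  have "(sqrt (1 / 4 + e_const n \<nu>))\<^sup>2 < H\<^sup>2"
    using H e0 unfolding h by (intro power_strict_mono) auto
  hence H2: "1 / 4 + e_const n \<nu> < H\<^sup>2" using e0 by simp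
  have H0: "H > 0" using H h_const_nonneg[OF \<nu>, of n] by linarith
  \<comment> \<open>The cap 1/8 keeps a above -1, given \<open>e_const n \<nu>\<close> <= 3/4; the
    other term keeps W at most H^2.\<close>
  define \<epsilon> where "\<epsilon> = min (H\<^sup>2 - (1 / 4 + e_const n \<nu>)) (1 / 8)"
  have \<epsilon>: "0 < \<epsilon>" "\<epsilon> \<le> 1 / 8" "\<epsilon> \<le> H\<^sup>2 - (1 / 4 + e_const n \<nu>)"
    unfolding \<epsilon>_def by (simp add: H2, rule min.cobounded2, rule min.cobounded1)
  define W where "W = 1 / 4 + e_const n \<nu> + \<epsilon>"
  have W: "W > 0" "W \<le> H\<^sup>2" using \<epsilon> e0 by (auto simp: W_def)
  define a where "a = 1 / 4 - W"
  have a: "a = - e_const n \<nu> - \<epsilon>" "a > - 1" using \<epsilon> e by (auto simp: a_def W_def)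
  define F where "F u = u\<^sup>2 - complex_of_real W" for u
  define A where "A = real n * (real n + 1) + a"
  define B where "B = 4 * (real n + 1) * (real n + \<nu>)"
  define C where "C = (real n + 1) * (real n + 2) + a"
  define D where "D = 4 * real n * (real n - 1 + \<nu>)"
  note coeffs = pencil_coefficients[OF \<nu> n a(2), folded A_def B_def C_def D_def]
  note A = coeffs(1) and C = coeffs(2) and D = coeffs(3)
  have "(a + e_const n \<nu>) * (2 * real n + \<nu>) < 0" using a(1) \<epsilon>(1) coeffs(4) by (simp add: mult_neg_pos)
  hence AB: "A * B < C * D" using coeffs(5) by linarith
  \<comment> \<open>The minimiser over t of the discriminant (t A - B)^2 + 4 C D t; the minimum is 4
    C D (A B - C D) / A^2.\<close>
  define t where "t = (A * B - 2 * C * D) / A\<^sup>2"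
  define Q where "Q = [:- (D * t), t * A - B, C:]"
  have disc: "(t * A - B)\<^sup>2 + 4 * C * D * t < 0"
  proof -
    have tA: "t * A - B = - (2 * C * D) / A" using A by (simp add: t_def field_simps power2_eq_square)
    have "(t * A - B)\<^sup>2 + 4 * C * D * t = 4 * C * D * (A * B - C * D) / A\<^sup>2"
      unfolding tA using A by (simp add: t_def power_divide field_simps power2_eq_square)
    also have "\<dots> < 0" using A C D AB by (intro divide_neg_pos mult_pos_neg) auto
    finally show ?thesis .
  qed
  have Qpos: "poly Q x \<noteq> 0" for x :: real
  proof
    assume "poly Q x = 0"
    moreover have "4 * C * poly Q x = (2 * C * x + (t * A - B))\<^sup>2 - ((t * A - B)\<^sup>2 + 4 * C * D * t)"
      by (simp add: Q_def power2_eq_square algebra_simps)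
    ultimately show False using disc zero_le_power2[of "2 * C * x + (t * A - B)"] by (simp del: zero_le_power2)
  qed
  have multiplier_F: "multiplier F \<nu> p = jacobi_op \<nu> p + smult a p" for p
  proof -
    have "(\<lambda>r. Re (F (of_nat r + 1 / 2))) = (\<lambda>r. (real r + 1 / 2)\<^sup>2 - W)"
      by (simp add: F_def power2_eq_square fun_eq_iff)
    thus ?thesis unfolding multiplier_eq_diag_op using diag_op_linear_factor[of \<nu> W p]
      by (simp add: a_def smult_diff_left)
  qed
  have MQ: "multiplier F \<nu> (pencil n t) = [:0, 1:] ^ (n - 1) * Q"
    unfolding multiplier_F using pencil_step[OF n, of \<nu> t a] unfolding Q_def A_def B_def C_def D_def .
  have "degree Q = 2" using C by (simp add: Q_def)
  hence "degree (map_poly complex_of_real Q) = 2" by (subst degree_map_poly) auto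
  hence "\<not> constant (poly (map_poly complex_of_real Q))" by (simp add: constant_degree)
  then obtain z where z: "poly (map_poly complex_of_real Q) z = 0"
    using fundamental_theorem_of_algebra by blast
  have "z \<notin> \<real>"
  proof
    assume "z \<in> \<real>"
    then obtain x where "z = of_real x" by (auto elim: Reals_cases)
    hence "complex_of_real (poly Q x) = 0" using z by (simp only: of_real_poly)
    thus False using Qpos[of x] by simp
  qed
  hence "\<not> real_rooted (multiplier F \<nu> (pencil n t))"
    unfolding real_rooted_def MQ map_poly_of_real_mult using z by auto
  moreover have "multiplier F \<nu> (pencil n t) \<noteq> 0" unfolding MQ using \<open>degree Q = 2\<close> by auto
  ultimately have "\<not> (multiplier F \<nu> ([:0, 1:] ^ n) \<preceq> multiplier F \<nu> ([:0, 1:] ^ (n + 1)))"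
    unfolding weak_obreschkoff_def multiplier_pencil by blast
  moreover have "F \<noteq> (\<lambda>_. 0)"
  proof
    assume "F = (\<lambda>_. 0)"
    hence "F 0 = 0" by simp
    thus False using W by (simp add: F_def)
  qed
  moreover have "real_fun F" "even_fun F" by (auto simp: real_fun_def even_fun_def F_def)
  moreover have "is_polynomial F" unfolding is_polynomial_def
    by (intro exI[of _ "[:- complex_of_real W, 0, 1:]"]) (simp add: F_def fun_eq_iff power2_eq_square)
  moreover have "zero_set F \<subseteq> strip H"
  proof
    fix u assume "u \<in> zero_set F"
    hence u: "u\<^sup>2 = of_real W" by (simp add: zero_set_def F_def)
    have "Re (u\<^sup>2) = W" "Im (u\<^sup>2) = 0" unfolding u by simp_all
    hence *: "(Re u)\<^sup>2 - (Im u)\<^sup>2 = W" "Re u = 0 \<or> Im u = 0" by (auto simp: power2_eq_square)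
    have "Re u \<noteq> 0" using * W by auto
    hence "(Re u)\<^sup>2 \<le> H\<^sup>2" using * W by auto
    thus "u \<in> strip H" using H0 by (simp add: strip_def abs_le_square_iff[symmetric])
  qed
  ultimately show ?thesis by blast
qed

theorem theorem1p2:
  fixes \<nu> :: real
  assumes "0 < \<nu>" and "\<nu> < 2"
  shows
    "(\<forall>n::nat. n \<ge> 1 \<longrightarrow>
        (\<forall>F :: complex \<Rightarrow> complex.
           F \<noteq> (\<lambda>_. 0) \<and> real_fun F \<and> even_fun F \<and>
           (is_polynomial F \<or> entire_order_le_one F) \<and>
           zero_set F \<subseteq> strip (h_const n \<nu>) \<longrightarrow>
             (\<forall>t::real. multiplier F \<nu> ([:0, 1:] ^ n * [:t, 1:]) \<in> one_defect (n + 1)) \<and>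
             multiplier F \<nu> ([:0, 1:] ^ n) \<preceq> multiplier F \<nu> ([:0, 1:] ^ (n + 1))) \<and>
        (e_const n \<nu> \<le> 3 / 4 \<longrightarrow>
           (\<forall>H::real. H > h_const n \<nu> \<longrightarrow>
              (\<exists>F :: complex \<Rightarrow> complex.
                 F \<noteq> (\<lambda>_. 0) \<and> real_fun F \<and> even_fun F \<and> is_polynomial F \<and>
                 zero_set F \<subseteq> strip H \<and>
                 \<not> (multiplier F \<nu> ([:0, 1:] ^ n) \<preceq> multiplier F \<nu> ([:0, 1:] ^ (n + 1))) \<and>
                 \<not> (\<forall>t::real. multiplier F \<nu> ([:0, 1:] ^ n * [:t, 1:])
                        \<in> one_defect (n + 1)))))) \<and>
     (\<forall>F :: complex \<Rightarrow> complex.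
        F \<noteq> (\<lambda>_. 0) \<and> real_fun F \<and> even_fun F \<and>
        (is_polynomial F \<or> entire_order_le_one F) \<and>
        zero_set F \<subseteq> strip (h_const 1 \<nu>) \<longrightarrow>
          (\<forall>n::nat. multiplier F \<nu> ([:0, 1:] ^ n) \<preceq> multiplier F \<nu> ([:0, 1:] ^ (n + 1)))) \<and>
     (\<nu> \<ge> 10 / 11 \<longrightarrow>
        (\<forall>H::real. H > h_const 1 \<nu> \<longrightarrow>
           (\<exists>F :: complex \<Rightarrow> complex.
              F \<noteq> (\<lambda>_. 0) \<and> real_fun F \<and> even_fun F \<and> is_polynomial F \<and>
              zero_set F \<subseteq> strip H \<and>
              (\<exists>n::nat. \<not> (multiplier F \<nu> ([:0, 1:] ^ n)
                               \<preceq> multiplier F \<nu> ([:0, 1:] ^ (n + 1)))))))"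
proof -
  note \<nu> = assms
  have main: "(\<forall>t::real. multiplier F \<nu> ([:0, 1:] ^ n * [:t, 1:]) \<in> one_defect (n + 1)) \<and>
      multiplier F \<nu> ([:0, 1:] ^ n) \<preceq> multiplier F \<nu> ([:0, 1:] ^ (n + 1))"
    if "n \<ge> 1" "F \<noteq> (\<lambda>_. 0) \<and> real_fun F \<and> even_fun F \<and>
      (is_polynomial F \<or> entire_order_le_one F) \<and> zero_set F \<subseteq> strip (h_const n \<nu>)" for n F
  proof -
    have "multiplier F \<nu> (pencil n t) \<in> one_defect (n + 1)" for t
      using that by (intro multiplier_pencil_one_defect[OF \<nu>]) auto
    thus ?thesis using weak_obreschkoff_if_one_defect[of F \<nu> n "n + 1"] by (simp add: pencil_def)
  qed
  have sharp: "\<exists>F :: complex \<Rightarrow> complex. F \<noteq> (\<lambda>_. 0) \<and> real_fun F \<and> even_fun F \<and> is_polynomial F \<and>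
      zero_set F \<subseteq> strip H \<and>
      \<not> (multiplier F \<nu> ([:0, 1:] ^ n) \<preceq> multiplier F \<nu> ([:0, 1:] ^ (n + 1))) \<and>
      \<not> (\<forall>t::real. multiplier F \<nu> ([:0, 1:] ^ n * [:t, 1:]) \<in> one_defect (n + 1))"
    if n: "n \<ge> 1" "e_const n \<nu> \<le> 3 / 4" "H > h_const n \<nu>" for n H
  proof -
    obtain F :: "complex \<Rightarrow> complex" where F: "F \<noteq> (\<lambda>_. 0)" "real_fun F" "even_fun F" "is_polynomial F"
      "zero_set F \<subseteq> strip H"
      "\<not> (multiplier F \<nu> ([:0, 1:] ^ n) \<preceq> multiplier F \<nu> ([:0, 1:] ^ (n + 1)))"
      using strip_sharp[OF \<nu> n] by blast
    have "\<not> (\<forall>t::real. multiplier F \<nu> ([:0, 1:] ^ n * [:t, 1:]) \<in> one_defect (n + 1))"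
      using weak_obreschkoff_if_one_defect[of F \<nu> n "n + 1"] F(6) unfolding pencil_def by blast
    thus ?thesis using F by blast
  qed
  have uniform: "multiplier F \<nu> ([:0, 1:] ^ n) \<preceq> multiplier F \<nu> ([:0, 1:] ^ (n + 1))"
    if F: "F \<noteq> (\<lambda>_. 0) \<and> real_fun F \<and> even_fun F \<and>
      (is_polynomial F \<or> entire_order_le_one F) \<and> zero_set F \<subseteq> strip (h_const 1 \<nu>)" for n F
  proof (cases "n = 0")
    \<comment> \<open>For n = 0 the image of the pencil has degree at most 1, so it lies in the
      class whatever the eigenvalues are.\<close>
    case True
    have "degree (multiplier F \<nu> (pencil 0 t)) \<le> 1" for t
      using degree_diag_op_le[of \<nu> _ "pencil 0 t"] unfolding multiplier_eq_diag_op
      by (rule order_trans) (simp add: pencil_def)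
    hence "multiplier F \<nu> (pencil 0 t) \<in> one_defect (0 + 1)" for t
      by (intro one_defect_form_imp_one_defect one_defect_form_linear)
    thus ?thesis unfolding True by (rule weak_obreschkoff_if_one_defect)
  next
    case False
    hence n: "n \<ge> 1" by simp
    have "strip (h_const 1 \<nu>) \<subseteq> strip (h_const n \<nu>)"
      using h_const_1_le[OF \<nu> n] by (auto simp: strip_def)
    thus ?thesis using main[OF n, of F] F by blast
  qed
  \<comment> \<open>2 (2 - \<nu>) / (2 + \<nu>) <= 3/4 is equivalent to \<nu> >= 10/11.\<close>
  have e1: "e_const 1 \<nu> \<le> 3 / 4" if "\<nu> \<ge> 10 / 11"
    using that \<nu> by (simp add: e_const_def divide_le_eq)
  show ?thesis
    using main sharp uniform sharp[OF order_refl e1] by blast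
qed

end
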